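(* Let $\Omega$ be one of the following: (i) for some $m\ge2$, a body in $\mathbb{R}^m$ of the form $$\Omega=\left\{ (y_1,\bar y)\in\mathbb{R}\times\mathbb{R}^{m-1} \;\middle|\; 0\le y_1\le 1,\ |\bar y|\le \omega(y_1)\right\},$$ where $\omega:[0,1]\to[0,+\infty)$ is a piecewise $C^1$ function such that $t\mapsto\omega(t)^{m-1}$ is concave; or (ii) a non-obtuse triangle in $\mathbb{R}^2$ (in which case $m=2$). Then for any $1<\alpha<m+2$, $\Omega$ has a unique $r^{\alpha-m}$-center.
   Context: A body in $\mathbb{R}^m$ is the closure of a (non-empty) bounded open set. Piecewise $C^1$ for $\omega$ is understood as: $\omega$ is continuous on $[0,1]$ and continuously differentiable off a finite set of points, so that for instance $\omega(t)=t^p$ with $0\le p\le 1/(m-1)$ is allowed. Triangles are closed, solid and non-degenerate; non-obtuse means every angle is at most $\pi/2$. The $r^{\alpha-m}$-potential of order $\alpha>0$ of $\Omega\subset\mathbb{R}^m$ is, for $x\in\mathbb{R}^m$, $V^{(\alpha)}_\Omega(x)=\mathrm{sign}(m-\alpha)\int_\Omega |x-y|^{\alpha-m}\,dy$ if $\alpha\ne m$, and $V^{(\alpha)}_\Omega(x)=-\int_\Omega\log|x-y|\,dy$ if $\alpha=m$. A point $x\in\mathbb{R}^m$ is an $r^{\alpha-m}$-center of $\Omega$ if it gives the maximum value of $V^{(\alpha)}_\Omega$ on $\mathbb{R}^m$. *)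

theory Defs
  imports "HOL-Analysis.Analysis"
begin

definition body :: "'a::euclidean_space set \<Rightarrow> bool" where
  "body \<Omega> \<longleftrightarrow> (\<exists>U. open U \<and> bounded U \<and> U \<noteq> {} \<and> \<Omega> = closure U)"

(* The dimension m is that of the ambient type, DIM('a).  At y = x the integrands take
   the values 0 powr _ = 0 and ln 0 = 0, which is harmless as {x} is a null set; for
   \<alpha> > 0 and \<Omega> compact the integrands are integrable, so the Bochner integral
   is the genuine one. *)
definition riesz_potential :: "real \<Rightarrow> 'a::euclidean_space set \<Rightarrow> 'a \<Rightarrow> real" where
  "riesz_potential \<alpha> \<Omega> x =
     (if \<alpha> = real DIM('a)
      then - (LINT y:\<Omega>|lborel. ln (norm (x - y)))
      else sgn (real DIM('a) - \<alpha>) *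
             (LINT y:\<Omega>|lborel. norm (x - y) powr (\<alpha> - real DIM('a))))"

definition is_center :: "real \<Rightarrow> 'a::euclidean_space set \<Rightarrow> 'a \<Rightarrow> bool" where
  "is_center \<alpha> \<Omega> x \<longleftrightarrow>
     (\<forall>z. riesz_potential \<alpha> \<Omega> z \<le> riesz_potential \<alpha> \<Omega> x)"

definition profile_solid :: "(real \<Rightarrow> real) \<Rightarrow> (real \<times> 'a::euclidean_space) set" where
  "profile_solid \<omega> = {(y1, ybar). 0 \<le> y1 \<and> y1 \<le> 1 \<and> norm ybar \<le> \<omega> y1}"

definition angle_at :: "'a::euclidean_space \<Rightarrow> 'a \<Rightarrow> 'a \<Rightarrow> real" where
  "angle_at a b c = arccos (((b - a) \<bullet> (c - a)) / (norm (b - a) * norm (c - a)))"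

definition non_obtuse_triangle :: "'a::euclidean_space set \<Rightarrow> bool" where
  "non_obtuse_triangle \<Omega> \<longleftrightarrow>
     (\<exists>a b c. \<not> collinear {a, b, c} \<and> \<Omega> = convex hull {a, b, c} \<and>
        angle_at a b c \<le> pi / 2 \<and> angle_at b c a \<le> pi / 2 \<and> angle_at c a b \<le> pi / 2)"

end

theory Submission
  imports Defs
begin

text \<open>
  Write \<open>m\<close> for the dimension. As a function of \<open>q = |x - y|\<^sup>2\<close>, each of the kernels in question has
  derivative \<open>- c q\<^sup>-\<^sup>\<gamma>\<close> with \<open>c > 0\<close> and \<open>\<gamma> = (m + 2 - \<alpha>) / 2 > 0\<close>: it is decreasing and
  convex. Everything else is proved for an arbitrary smooth kernel \<open>K\<close> of this kind, that is for
  \<open>K' = - \<Psi>\<close> with \<open>\<Psi>\<close> decreasing and nonnegative (locale \<open>convex_kernel\<close>). Such a \<open>\<Psi>\<close> is a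
  nonnegative constant plus a nonnegative superposition of step functions \<open>1(q < s)\<close>
  (lemma \<open>layer_cake\<close>), so a linear inequality for the derivatives of the potential only has to be verified for the steps, where it
  becomes a statement about the part of the solid, or of its boundary, inside a ball.

  The Riesz potential is the limit, for \<open>\<epsilon> \<longlonglongrightarrow> 0\<close>, of the potentials with kernel shifted to
  \<open>q + \<epsilon>\<close>, and on a bounded range of \<open>q\<close> one can split off \<open>- c q\<close> with a fixed \<open>c > 0\<close> and still
  keep a decreasing convex kernel. Hence the weak inequalities between the values of all convex-kernel
  potentials pass to the limit, and the second moment \<open>\<integral>|x - y|\<^sup>2 dy\<close>, a strictly convex function of
  \<open>x\<close>, makes them strict. This gives the criterion \<open>unique_center\<close>: it suffices to find a set \<open>C\<close> such
  that every point outside \<open>C\<close> is beaten by some other point for all convex kernels, and such that the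
  potentials are midpoint concave on \<open>C\<close>. A center exists because the potential is continuous and
  because projecting a point onto a ball containing the solid brings it closer to every point of the
  solid.

  For the solid of revolution, moving a point to the axis increases the potential: all slices are balls
  about the axis (\<open>potential_off_axis\<close>). On the axis, the derivative for a step kernel is the integral
  over \<open>s\<close> of \<open>s (k(x + s) - k(x - s))\<close>, up to a positive factor, where \<open>k\<close> is the minimum of the
  concave function \<open>\<omega>\<^sup>m\<^sup>-\<^sup>1\<close> and a number depending only on \<open>|s|\<close>, cut off outside \<open>[0, 1]\<close>. If \<open>p\<close>
  is a maximum point of \<open>\<omega>\<close>, the bracket is nonnegative for \<open>x \<le> p / 2\<close>, decreasing in \<open>x\<close> on
  \<open>[p / 2, (1 + p) / 2]\<close>, and nonpositive from there on (locale \<open>concave_bump\<close>). So \<open>C\<close> is this segment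
  of the axis.

  For the triangle, \<open>C\<close> is the medial triangle, where all barycentric coordinates are at most \<open>1/2\<close>.
  The divergence theorem expresses the derivative of the potential by integrals of \<open>K\<close> over the
  sides (\<open>potential_T_deriv\<close>). If the coordinate at \<open>A\<close> exceeds \<open>1/2\<close>, moving along the altitude
  towards \<open>BC\<close> increases the potential, because each point of \<open>BC\<close> is farther away than the point of
  \<open>AB\<close> or \<open>AC\<close> on the same parallel to the altitude; here the angles at \<open>B\<close> and \<open>C\<close> must not be obtuse. On the medial
  triangle the second derivative along a direction is nonpositive: for a step kernel and the direction
  of the first coordinate axis, this says that \<open>\<integral> y\<^sub>1 dy\<^sub>2\<close> over the part of the boundary inside a
  disc about \<open>x\<close> is nonnegative. Closing this part by chords of the disc turns the integral into
  areas, and in barycentric coordinates the claim is an elementary inequality for each number of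
  vertices inside the disc (\<open>clipped_sum_nonneg\<close>).
\<close>

section \<open>Decreasing convex kernels\<close>

text \<open>The kernel is a function of the squared distance; this turns the convexity that matters below into convexity of
  a function of one real variable.\<close>

definition potential :: "(real \<Rightarrow> real) \<Rightarrow> 'b::euclidean_space set \<Rightarrow> 'b \<Rightarrow> real" where
  "potential K \<Omega> x = (LINT y:\<Omega>|lborel. K ((norm (x - y))^2))"

lemma set_integrable_continuous_bounded:
  fixes f :: "'b::euclidean_space \<Rightarrow> real"
  assumes "bounded S" "S \<in> sets borel" "continuous_on UNIV f"
  shows "set_integrable lborel S f"
proof (rule set_integrable_subset)
  show "set_integrable lborel (closure S) f"
    unfolding set_integrable_def
    using assms by (intro borel_integrable_compact)
      (auto simp: compact_closure intro: continuous_on_subset)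
qed (use assms closure_subset in auto)

lemma integrable_lborel_tensor:
  fixes g :: "'b::euclidean_space \<Rightarrow> real" and h :: "'c::euclidean_space \<Rightarrow> real"
  assumes g: "integrable lborel g" and h: "integrable lborel h"
  shows "integrable (lborel \<Otimes>\<^sub>M lborel) (\<lambda>(s, y). g s * h y)"
proof (rule lborel_pair.Fubini_integrable)
  have [measurable]: "g \<in> borel_measurable borel" "h \<in> borel_measurable borel"
    using g h by (auto dest: borel_measurable_integrable)
  show "(\<lambda>(s, y). g s * h y) \<in> borel_measurable (lborel \<Otimes>\<^sub>M lborel)"
    by measurable
  show "integrable lborel (\<lambda>x. LINT y|lborel. norm (case (x, y) of (s, y) \<Rightarrow> g s * h y))"
    using g by (simp add: abs_mult)
  show "AE x in lborel. integrable lborel (\<lambda>y. case (x, y) of (s, y) \<Rightarrow> g s * h y)"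
    using h by simp
qed

text \<open>The derivatives \<open>- \<Psi>\<close> and \<open>- w\<close> are part of the data because \<open>w\<close> is
  the weight in the layer-cake formula. The sign of \<open>\<Psi>\<close> is prescribed only up to
  \<open>D\<close>: this leaves room to subtract a small constant from \<open>\<Psi>\<close>, which is how strict
  inequalities are obtained later.\<close>

locale convex_kernel =
  fixes K \<Psi> w :: "real \<Rightarrow> real" and D :: real
  assumes K_deriv: "0 \<le> q \<Longrightarrow> (K has_real_derivative - \<Psi> q) (at q)"
    and \<Psi>_deriv: "0 \<le> q \<Longrightarrow> (\<Psi> has_real_derivative - w q) (at q)"
    and w_cont: "continuous_on {0..} w"
    and w_nonneg: "0 \<le> q \<Longrightarrow> 0 \<le> w q"
    and D_nonneg: "0 \<le> D"
    and \<Psi>_D: "0 \<le> \<Psi> D"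
begin

lemma K_cont: "continuous_on {0..} K"
  by (rule DERIV_continuous_on, rule has_field_derivative_at_within, rule K_deriv) simp

lemma \<Psi>_cont: "continuous_on {0..} \<Psi>"
  by (rule DERIV_continuous_on, rule has_field_derivative_at_within, rule \<Psi>_deriv) simp

lemma cont_K_compose [continuous_intros]:
  "continuous_on A f \<Longrightarrow> (\<And>x. x \<in> A \<Longrightarrow> 0 \<le> f x) \<Longrightarrow> continuous_on A (\<lambda>x. K (f x))"
  by (rule continuous_on_compose2[OF K_cont]) auto

lemma cont_\<Psi>_compose [continuous_intros]:
  "continuous_on A f \<Longrightarrow> (\<And>x. x \<in> A \<Longrightarrow> 0 \<le> f x) \<Longrightarrow> continuous_on A (\<lambda>x. \<Psi> (f x))"
  by (rule continuous_on_compose2[OF \<Psi>_cont]) auto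

lemma \<Psi>_antimono: "0 \<le> q \<Longrightarrow> q \<le> r \<Longrightarrow> \<Psi> r \<le> \<Psi> q"
  by (rule DERIV_nonpos_imp_nonincreasing[of q r \<Psi>])
    (auto intro!: exI[of _ "- w _"] \<Psi>_deriv w_nonneg)

lemma \<Psi>_nonneg: "0 \<le> q \<Longrightarrow> q \<le> D \<Longrightarrow> 0 \<le> \<Psi> q"
  using \<Psi>_antimono[of q D] \<Psi>_D by simp

lemma K_antimono: "0 \<le> q \<Longrightarrow> q \<le> r \<Longrightarrow> r \<le> D \<Longrightarrow> K r \<le> K q"
  by (rule DERIV_nonpos_imp_nonincreasing[of q r K])
    (auto intro!: exI[of _ "- \<Psi> _"] K_deriv \<Psi>_nonneg)

lemma w_integrable: "0 \<le> a \<Longrightarrow> integrable lborel (\<lambda>s. indicator {a..b} s * w s)"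
  using borel_integrable_compact[of "{a..b}" w] continuous_on_subset[OF w_cont, of "{a..b}"] by simp

lemma \<Psi>_layers:
  assumes "0 \<le> q" "q \<le> D"
  shows "\<Psi> q = \<Psi> D + (LINT s|lborel. indicator {0..D} s * w s * indicator {q<..} s)"
proof -
  have "(LINT s|lborel. indicator {q..D} s *\<^sub>R w s) = (- \<Psi> D) - (- \<Psi> q)"
  proof (rule integral_FTC_atLeastAtMost)
    fix s assume "q \<le> s" "s \<le> D"
    then have "((\<lambda>s. - \<Psi> s) has_real_derivative w s) (at s)"
      using assms by (auto intro!: derivative_eq_intros \<Psi>_deriv)
    then show "((\<lambda>s. - \<Psi> s) has_vector_derivative w s) (at s within {q..D})"
      by (simp add: has_field_derivative_at_within
          flip: has_real_derivative_iff_has_vector_derivative)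
  qed (use assms in \<open>auto intro: continuous_on_subset[OF w_cont]\<close>)
  moreover have "(LINT s|lborel. indicator {q..D} s *\<^sub>R w s) =
    (LINT s|lborel. indicator {0..D} s * w s * indicator {q<..} s)"
  proof (rule integral_cong_AE)
    have m: "(\<lambda>s. indicator {0..D} s *\<^sub>R w s) \<in> borel_measurable borel"
      "(\<lambda>s. indicator {q..D} s *\<^sub>R w s) \<in> borel_measurable borel"
      using assms by (auto intro!: borel_measurable_integrable[of lborel, simplified] w_integrable)
    show "(\<lambda>s. indicator {q..D} s *\<^sub>R w s) \<in> borel_measurable lborel" using m by simp
    show "(\<lambda>s. indicator {0..D} s * w s * indicator {q<..} s) \<in> borel_measurable lborel"
      using m(1) by (auto intro!: borel_measurable_times)
    show "AE s in lborel. indicator {q..D} s *\<^sub>R w s = indicator {0..D} s * w s * indicator {q<..} s"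
      using AE_lborel_singleton[of q] by eventually_elim (use assms in \<open>auto simp: indicator_def\<close>)
  qed
  ultimately show ?thesis by simp
qed

text \<open>Since \<open>\<Psi> q = \<Psi> D + \<integral> w s 1(q < s) ds\<close>, with \<open>s\<close> running from
  \<open>0\<close> to \<open>D\<close>, Fubini reduces integrals against \<open>\<Psi>\<close> to integrals over
  sublevel sets of \<open>q\<close>, with nonnegative weights.\<close>

lemma layer_cake:
  fixes a q :: "'b::euclidean_space \<Rightarrow> real"
  assumes a: "set_integrable lborel S a"
    and q [measurable]: "q \<in> borel_measurable borel"
    and q_bounds: "\<And>y. y \<in> S \<Longrightarrow> 0 \<le> q y \<and> q y \<le> D"
  shows "(LINT y:S|lborel. a y * \<Psi> (q y)) =
      \<Psi> D * (LINT y:S|lborel. a y) +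
      (LINT s:{0..D}|lborel. w s * (LINT y:S|lborel. a y * indicator {y. q y < s} y))"
    (is "?lhs = ?rhs")
    and "set_integrable lborel {0..D}
      (\<lambda>s. w s * (LINT y:S|lborel. a y * indicator {y. q y < s} y))" (is ?int)
proof -
  define g where "g s = indicator {0..D} s * w s" for s
  define h where "h y = indicator S y * a y" for y
  define F where "F s y = g s * h y * indicator {(s, y). q y < s} (s, y)" for s y
  have g: "integrable lborel g"
    unfolding g_def by (rule w_integrable) simp
  have h: "integrable lborel h"
    using a by (simp add: h_def[abs_def] set_integrable_def)
  have [measurable]: "g \<in> borel_measurable borel" "h \<in> borel_measurable borel"
    using g h by (auto dest: borel_measurable_integrable)
  have F: "integrable (lborel \<Otimes>\<^sub>M lborel) (\<lambda>(s, y). F s y)"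
  proof (rule Bochner_Integration.integrable_bound[OF integrable_lborel_tensor[OF g h]])
    show "(\<lambda>(s, y). F s y) \<in> borel_measurable (lborel \<Otimes>\<^sub>M lborel)"
      unfolding F_def by measurable
  qed (auto simp: F_def indicator_def)
  have inner: "(LINT y|lborel. F s y) =
      indicator {0..D} s *\<^sub>R (w s * (LINT y:S|lborel. a y * indicator {y. q y < s} y))" for s
  proof -
    have "(LINT y|lborel. F s y) =
        (LINT y|lborel. g s * (indicator S y * (a y * indicator {y. q y < s} y)))"
      by (rule Bochner_Integration.integral_cong) (auto simp: F_def h_def indicator_def)
    then show ?thesis
      by (simp add: g_def set_lebesgue_integral_def)
  qed
  show ?int
    unfolding set_integrable_def inner[symmetric]
    using lborel_pair.integrable_fst'[OF F] by simp
  have "?lhs = (LINT y|lborel. \<Psi> D * h y + (LINT s|lborel. F s y))"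
    unfolding set_lebesgue_integral_def
  proof (rule Bochner_Integration.integral_cong)
    fix y
    show "indicator S y *\<^sub>R (a y * \<Psi> (q y)) = \<Psi> D * h y + (LINT s|lborel. F s y)"
    proof (cases "y \<in> S")
      case True
      have "(LINT s|lborel. F s y) = (LINT s|lborel. h y * (indicator {0..D} s * w s * indicator {q y<..} s))"
        by (rule Bochner_Integration.integral_cong) (auto simp: F_def g_def indicator_def)
      also have "\<dots> = h y * (\<Psi> (q y) - \<Psi> D)"
        using \<Psi>_layers[of "q y"] q_bounds[OF True] by simp
      finally show ?thesis using True by (simp add: h_def algebra_simps)
    qed (simp add: h_def F_def)
  qed simp
  also have "\<dots> = \<Psi> D * (LINT y|lborel. h y) + (LINT y|lborel. LINT s|lborel. F s y)"
    using h lborel_pair.integrable_snd[OF F] by simp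
  also have "(LINT y|lborel. LINT s|lborel. F s y) = (LINT s|lborel. LINT y|lborel. F s y)"
    by (rule lborel_pair.Fubini_integral[OF F])
  finally show "?lhs = ?rhs"
    by (simp add: inner h_def set_lebesgue_integral_def)
qed

end

lemma potential_continuous:
  fixes S :: "'b::euclidean_space set"
  assumes S: "bounded S" "S \<in> sets borel" and K: "continuous_on {0..} K"
  shows "continuous_on UNIV (potential K S)"
  unfolding continuous_on_sequentially o_def
proof (intro allI ballI impI, elim conjE)
  fix X :: "nat \<Rightarrow> 'b" and x
  assume X: "X \<longlonglongrightarrow> x"
  have Kc: "continuous_on A f \<Longrightarrow> (\<And>x. x \<in> A \<Longrightarrow> 0 \<le> f x) \<Longrightarrow> continuous_on A (\<lambda>x. K (f x))"
    for A :: "'z::topological_space set" and f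
    by (rule continuous_on_compose2[OF K]) auto
  define f where "f z y = K ((norm (z - y))^2)" for z y :: 'b
  have "bounded (range X)" using X by (rule convergent_imp_bounded)
  then have "compact (closure (range X) \<times> closure S)"
    using S by (auto simp: compact_Times)
  moreover have "continuous_on (closure (range X) \<times> closure S) (\<lambda>(z, y). f z y)"
    unfolding f_def case_prod_beta by (intro Kc continuous_intros) auto
  ultimately have "bounded ((\<lambda>(z, y). f z y) ` (closure (range X) \<times> closure S))"
    by (intro compact_imp_bounded compact_continuous_image)
  then obtain B where "\<forall>u \<in> (\<lambda>(z, y). f z y) ` (closure (range X) \<times> closure S). norm u \<le> B"
    unfolding bounded_iff by blast
  then have B: "\<bar>f z y\<bar> \<le> B" if "z \<in> range X" "y \<in> S" for z y
    using that closure_subset[of S] closure_subset[of "range X"] by fastforce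
  have fm: "(\<lambda>y. f z y) \<in> borel_measurable borel" for z
    unfolding f_def by (intro borel_measurable_continuous_onI Kc continuous_intros) auto
  show "(\<lambda>n. potential K S (X n)) \<longlonglongrightarrow> potential K S x"
    unfolding potential_def set_lebesgue_integral_def f_def[symmetric]
  proof (rule integral_dominated_convergence)
    show "integrable lborel (\<lambda>y. indicator S y * B)"
      using set_integrable_continuous_bounded[OF S, of "\<lambda>_. B"] by (simp add: set_integrable_def)
    show "AE y in lborel. (\<lambda>n. indicator S y *\<^sub>R f (X n) y) \<longlonglongrightarrow> indicator S y *\<^sub>R f x y"
    proof (rule AE_I2, intro tendsto_intros)
      fix y
      have "continuous_on UNIV (\<lambda>z. f z y)"
        unfolding f_def by (intro Kc continuous_intros) auto
      then show "(\<lambda>n. f (X n) y) \<longlonglongrightarrow> f x y"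
        using X by (auto intro: continuous_on_tendsto_compose)
    qed
    show "AE y in lborel. norm (indicator S y *\<^sub>R f (X n) y) \<le> indicator S y * B" for n
      using B by (auto simp: indicator_def)
  qed (use fm S in auto)
qed

context convex_kernel begin

lemma kernel_deriv:
  fixes x v y :: "'b::euclidean_space"
  shows "((\<lambda>s. K ((norm (x + s *\<^sub>R v - y))^2)) has_real_derivative
    2 * ((y - (x + s *\<^sub>R v)) \<bullet> v) * \<Psi> ((norm (x + s *\<^sub>R v - y))^2)) (at s)"
proof -
  have e: "(norm (x + s *\<^sub>R v - y))^2 = (x - y) \<bullet> (x - y) + 2 * s * ((x - y) \<bullet> v) + s\<^sup>2 * (v \<bullet> v)" for s
    unfolding power2_norm_eq_inner by (simp add: algebra_simps inner_commute power2_eq_square)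
  have "((\<lambda>s. (norm (x + s *\<^sub>R v - y))^2) has_real_derivative 2 * ((x + s *\<^sub>R v - y) \<bullet> v)) (at s)"
    unfolding e by (auto intro!: derivative_eq_intros simp: algebra_simps)
  from DERIV_chain2[OF K_deriv this] show ?thesis by (simp add: algebra_simps)
qed

text \<open>Differentiation under the integral sign. The map \<open>Y\<close> is the identity for solids and parametrises a
  side for boundary integrals of triangles.\<close>

lemma kernel_integral_deriv:
  fixes S :: "'c::euclidean_space set" and x v :: "'b::euclidean_space" and Y :: "'c \<Rightarrow> 'b"
  assumes S: "bounded S" "S \<in> sets borel" and Y: "continuous_on UNIV Y"
  shows "((\<lambda>t. LINT y:S|lborel. K ((norm (x + t *\<^sub>R v - Y y))^2)) has_real_derivative
    (LINT y:S|lborel. 2 * ((Y y - (x + t *\<^sub>R v)) \<bullet> v) * \<Psi> ((norm (x + t *\<^sub>R v - Y y))^2))) (at t)"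
proof -
  have Yc [continuous_intros]: "continuous_on A g \<Longrightarrow> continuous_on A (\<lambda>z. Y (g z))"
    for A :: "'z::topological_space set" and g
    by (rule continuous_on_compose2[OF Y]) auto
  define f where "f s y = K ((norm (x + s *\<^sub>R v - Y y))^2)" for s y
  define f' where "f' s y = 2 * ((Y y - (x + s *\<^sub>R v)) \<bullet> v) * \<Psi> ((norm (x + s *\<^sub>R v - Y y))^2)" for s y
  have deriv: "((\<lambda>s. f s y) has_real_derivative f' s y) (at s)" for s y
    unfolding f_def f'_def by (rule kernel_deriv)
  have cf: "continuous_on UNIV (\<lambda>y. f s y)" and cf': "continuous_on UNIV (\<lambda>y. f' s y)" for s
    unfolding f_def f'_def by (intro continuous_intros; simp)+
  then have fm: "(\<lambda>y. f s y) \<in> borel_measurable borel" "(\<lambda>y. f' s y) \<in> borel_measurable borel" for s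
    by (auto intro: borel_measurable_continuous_onI)
  have f_int: "integrable lborel (\<lambda>y. indicator S y * f s y)" for s
    using set_integrable_continuous_bounded[OF S cf] by (simp add: set_integrable_def)
  have "compact ({t-1..t+1} \<times> closure S)"
    using S by (auto simp: compact_Times)
  moreover have "continuous_on ({t-1..t+1} \<times> closure S) (\<lambda>(s, y). f' s y)"
    unfolding f'_def case_prod_beta by (intro continuous_intros; simp)
  ultimately have "bounded ((\<lambda>(s, y). f' s y) ` ({t-1..t+1} \<times> closure S))"
    by (intro compact_imp_bounded compact_continuous_image)
  then obtain B where "\<forall>u \<in> (\<lambda>(s, y). f' s y) ` ({t-1..t+1} \<times> closure S). norm u \<le> B"
    unfolding bounded_iff by blast
  then have B: "\<bar>f' s y\<bar> \<le> B" if "s \<in> {t-1..t+1}" "y \<in> S" for s y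
    using that closure_subset[of S] by fastforce
  define F where "F s = (LINT y|lborel. indicator S y * f s y)" for s
  have "(F has_real_derivative (LINT y|lborel. indicator S y * f' t y)) (at t within {t-1..t+1})"
    unfolding has_field_derivative_iff tendsto_at_iff_sequentially o_def
  proof (intro allI impI)
    fix X :: "nat \<Rightarrow> real"
    assume X: "\<forall>i. X i \<in> {t-1..t+1} - {t}" and lim: "X \<longlonglongrightarrow> t"
    have "(F (X n) - F t) / (X n - t) = (LINT y|lborel. indicator S y * ((f (X n) y - f t y) / (X n - t)))" for n
    proof -
      have "(F (X n) - F t) / (X n - t) =
          (LINT y|lborel. (indicator S y * f (X n) y - indicator S y * f t y) / (X n - t))"
        by (simp add: F_def f_int)
      then show ?thesis by (simp add: right_diff_distrib)
    qed
    moreover have "(\<lambda>n. LINT y|lborel. indicator S y * ((f (X n) y - f t y) / (X n - t)))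
        \<longlonglongrightarrow> (LINT y|lborel. indicator S y * f' t y)"
    proof (rule integral_dominated_convergence)
      show "integrable lborel (\<lambda>y. indicator S y * B)"
        using set_integrable_continuous_bounded[OF S, of "\<lambda>_. B"] by (simp add: set_integrable_def)
      show "AE y in lborel. (\<lambda>n. indicator S y * ((f (X n) y - f t y) / (X n - t)))
          \<longlonglongrightarrow> indicator S y * f' t y"
      proof (rule AE_I2, intro tendsto_intros)
        fix y
        show "(\<lambda>n. (f (X n) y - f t y) / (X n - t)) \<longlonglongrightarrow> f' t y"
          using deriv[of y t] X lim
          unfolding has_field_derivative_iff tendsto_at_iff_sequentially o_def by blast
      qed
      show "AE y in lborel. norm (indicator S y * ((f (X n) y - f t y) / (X n - t))) \<le> indicator S y * B" for n
      proof (rule AE_I2)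
        fix y
        have "\<bar>(f (X n) y - f t y) / (X n - t)\<bar> \<le> B" if "y \<in> S"
        proof -
          have Xn: "X n \<in> {t-1..t+1}" "X n \<noteq> t" using X by auto
          have "norm (f (X n) y - f t y) \<le> B * norm (X n - t)"
          proof (rule field_differentiable_bound)
            show "convex {t-1..t+1}" by simp
            show "((\<lambda>s. f s y) has_field_derivative f' s y) (at s within {t-1..t+1})" for s
              using deriv by (rule has_field_derivative_at_within)
            show "norm (f' s y) \<le> B" if "s \<in> {t-1..t+1}" for s
              using B[OF that \<open>y \<in> S\<close>] by simp
          qed (use Xn in auto)
          then show ?thesis using Xn by (simp add: abs_divide divide_le_eq)
        qed
        then show "norm (indicator S y * ((f (X n) y - f t y) / (X n - t))) \<le> indicator S y * B"
          by (auto simp: indicator_def)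
      qed
    qed (use fm S in auto)
    ultimately show "(\<lambda>n. (F (X n) - F t) / (X n - t)) \<longlonglongrightarrow> (LINT y|lborel. indicator S y * f' t y)"
      by (simp only:)
  qed
  moreover have "at t within {t-1..t+1} = at t"
    by (rule at_within_interior) auto
  ultimately show ?thesis
    by (simp add: F_def[abs_def] f_def f'_def set_lebesgue_integral_def)
qed

lemma potential_deriv:
  fixes S :: "'b::euclidean_space set" and x v :: 'b
  assumes S: "bounded S" "S \<in> sets borel"
  shows "((\<lambda>t. potential K S (x + t *\<^sub>R v)) has_real_derivative
    (LINT y:S|lborel. 2 * ((y - (x + t *\<^sub>R v)) \<bullet> v) * \<Psi> ((norm (x + t *\<^sub>R v - y))^2))) (at t)"
  using kernel_integral_deriv[OF S continuous_on_id] by (simp add: potential_def)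

end

section \<open>The Riesz kernel as a limit of convex kernels\<close>

lemma lborel_distr_reflect: "distr lborel borel (\<lambda>y. x - y) = (lborel :: 'b::euclidean_space measure)"
  using lborel_affine[of "-1" x] by (simp add: density_1)

text \<open>On the shell \<open>r (Suc k) \<le> |y| < r k\<close>, with radii halved at each step, the function is at most
  \<open>r (Suc k)\<^sup>-\<^sup>\<beta>\<close>, and the ball of radius \<open>r k\<close> has volume
  proportional to \<open>r k\<close> to the power of the dimension; since the dimension exceeds
  \<open>\<beta>\<close>, the products form a convergent geometric series.\<close>

lemma integrable_norm_powr_ball:
  fixes \<beta> R :: real
  assumes "0 < \<beta>" "\<beta> < DIM('b::euclidean_space)"
  shows "set_integrable lborel (ball (0::'b) R) (\<lambda>y. norm y powr - \<beta>)"
proof (cases "0 < R")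
  case R: True
  define d where "d = DIM('b)"
  define r where "r k = R * (1/2) ^ k" for k
  define T where "T k = unit_ball_vol d * r k ^ d * r (Suc k) powr - \<beta>" for k
  have r_pos: "0 < r k" for k using R by (simp add: r_def)
  have T_eq: "T k = (unit_ball_vol d * R ^ d * (R / 2) powr - \<beta>) * (((1/2) ^ d) * ((1/2) powr - \<beta>)) ^ k" for k
  proof -
    have "r (Suc k) powr - \<beta> = ((R / 2) * (1/2) ^ k) powr - \<beta>" by (simp add: r_def)
    also have "\<dots> = (R / 2) powr - \<beta> * ((1/2) ^ k) powr - \<beta>"
      using R by (subst powr_mult) auto
    also have "((1/2) ^ k) powr - \<beta> = ((1/2::real) powr real k) powr - \<beta>"
      by (subst powr_realpow) auto
    also have "\<dots> = ((1/2) powr - \<beta>) powr real k"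
      by (simp only: powr_powr mult.commute)
    also have "\<dots> = ((1/2) powr - \<beta>) ^ k"
      by (subst powr_realpow) auto
    finally have r_Suc: "r (Suc k) powr - \<beta> = (R / 2) powr - \<beta> * ((1/2) powr - \<beta>) ^ k" .
    have "((1/2::real) ^ k) ^ d = ((1/2) ^ d) ^ k"
      unfolding power_mult[symmetric] by (rule arg_cong[OF mult.commute])
    then have "r k ^ d = R ^ d * ((1/2) ^ d) ^ k"
      unfolding r_def power_mult_distrib by (rule arg_cong)
    then show ?thesis
      unfolding T_def r_Suc power_mult_distrib by (simp only: mult_ac)
  qed
  have "(1/2) ^ d = (1/2::real) powr d" by (subst powr_realpow) auto
  then have "((1/2) ^ d) * ((1/2) powr - \<beta>) = (1/2::real) powr (d - \<beta>)"
    by (simp only: powr_add[symmetric] diff_conv_add_uminus)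
  also have "\<dots> < 1" using assms by (subst powr01_less_one) (auto simp: d_def)
  finally have "summable (\<lambda>k. (((1/2) ^ d) * ((1/2::real) powr - \<beta>)) ^ k)"
    by (intro summable_geometric) simp
  then have summ: "summable T" unfolding T_eq by (rule summable_mult)
  have T_nonneg: "0 \<le> T k" for k using r_pos[of k] by (simp add: T_def)
  have "(\<integral>\<^sup>+y. ennreal (norm (indicator (ball (0::'b) R) y *\<^sub>R norm y powr - \<beta>)) \<partial>lborel)
     \<le> (\<integral>\<^sup>+y. (\<Sum>k. ennreal (r (Suc k) powr - \<beta>) * indicator (ball (0::'b) (r k)) y) \<partial>lborel)"
  proof (rule nn_integral_mono)
    fix y :: 'b
    show "ennreal (norm (indicator (ball (0::'b) R) y *\<^sub>R norm y powr - \<beta>))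
        \<le> (\<Sum>k. ennreal (r (Suc k) powr - \<beta>) * indicator (ball (0::'b) (r k)) y)"
    proof (cases "y \<in> ball 0 R \<and> y \<noteq> 0")
      case True
      define n where "n = (LEAST n. r n \<le> norm y)"
      obtain j where "(1/2) ^ j < norm y / R"
        using real_arch_pow_inv[of "norm y / R" "1/2"] True R by auto
      then have "r j \<le> norm y" using R by (simp add: r_def field_simps)
      then have n: "r n \<le> norm y" unfolding n_def by (rule LeastI)
      have "n \<noteq> 0" using n True by (intro notI) (simp add: r_def)
      then obtain k where k: "n = Suc k" using not0_implies_Suc by blast
      have "norm y < r k" using not_less_Least[of k "\<lambda>n. r n \<le> norm y"] k unfolding n_def by simp
      then have "ennreal (norm (indicator (ball (0::'b) R) y *\<^sub>R norm y powr - \<beta>))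
          \<le> ennreal (r (Suc k) powr - \<beta>) * indicator (ball (0::'b) (r k)) y"
        using True n k r_pos[of "Suc k"] assms by (auto intro!: ennreal_leI powr_mono2')
      also have "\<dots> \<le> (\<Sum>k. ennreal (r (Suc k) powr - \<beta>) * indicator (ball (0::'b) (r k)) y)"
      proof -
        have "f k \<le> (\<Sum>k. f k)" for f :: "nat \<Rightarrow> ennreal"
          using sum_le_suminf[of f "{k}"] by simp
        then show ?thesis .
      qed
      finally show ?thesis .
    qed auto
  qed
  also have "\<dots> = (\<Sum>k. \<integral>\<^sup>+y. ennreal (r (Suc k) powr - \<beta>) * indicator (ball (0::'b) (r k)) y \<partial>lborel)"
    by (rule nn_integral_suminf)
      (intro borel_measurable_times_ennreal borel_measurable_const borel_measurable_indicator; simp)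
  also have "\<dots> = (\<Sum>k. ennreal (T k))"
  proof (rule suminf_cong)
    fix k
    have "(\<integral>\<^sup>+y. ennreal (r (Suc k) powr - \<beta>) * indicator (ball (0::'b) (r k)) y \<partial>lborel)
        = ennreal (r (Suc k) powr - \<beta>) * emeasure lborel (ball (0::'b) (r k))"
      by (rule nn_integral_cmult_indicator) simp
    also have "\<dots> = ennreal (T k)"
      using r_pos[of k] by (simp add: emeasure_ball T_def d_def ennreal_mult'[symmetric] mult.commute)
    finally show "(\<integral>\<^sup>+y. ennreal (r (Suc k) powr - \<beta>) * indicator (ball (0::'b) (r k)) y \<partial>lborel) = ennreal (T k)" .
  qed
  also have "\<dots> = ennreal (\<Sum>k. T k)"
    by (rule suminf_ennreal2[OF T_nonneg summ])
  also have "\<dots> < \<infinity>" by simp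
  finally show ?thesis
    unfolding set_integrable_def
    by (intro integrableI_bounded) (auto intro!: borel_measurable_times borel_measurable_indicator)
next
  case False
  then have empty: "ball (0::'b) R = {}" by simp
  show ?thesis unfolding empty by (simp add: set_integrable_def)
qed

definition riesz_kernel :: "real \<Rightarrow> real \<Rightarrow> real \<Rightarrow> real" where
  "riesz_kernel \<alpha> m q =
     (if \<alpha> = m then - (ln q / 2) else sgn (m - \<alpha>) * q powr ((\<alpha> - m) / 2))"

lemma riesz_kernel_measurable [measurable]:
  "f \<in> borel_measurable M \<Longrightarrow> (\<lambda>x. riesz_kernel \<alpha> m (f x)) \<in> borel_measurable M"
  by (cases "\<alpha> = m") (auto simp: riesz_kernel_def)

lemma power2_norm_powr: "((norm z)^2) powr (b / 2) = norm z powr b"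
  by (cases "z = 0") (auto simp: powr_powr simp flip: powr_numeral)

lemma riesz_potential_eq:
  "riesz_potential \<alpha> \<Omega> = potential (riesz_kernel \<alpha> DIM('b)) (\<Omega> :: 'b::euclidean_space set)"
proof
  fix x :: 'b
  have "ln ((norm z)^2) / 2 = ln (norm z)" for z :: 'b
    by (cases "z = 0") (auto simp: ln_realpow)
  then show "riesz_potential \<alpha> \<Omega> x = potential (riesz_kernel \<alpha> DIM('b)) \<Omega> x"
    by (simp add: riesz_potential_def potential_def riesz_kernel_def power2_norm_powr
        set_lebesgue_integral_def mult.left_commute[of "indicator _ _" "sgn _"])
qed

text \<open>In each of the three regimes the kernel is dominated by \<open>C |y|\<^sup>-\<^sup>\<beta> + E\<close> with
  \<open>\<beta>\<close> below the dimension; for the logarithm, \<open>\<beta> = 1/2\<close>.\<close>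

lemma riesz_kernel_integrable_ball:
  assumes "0 < \<alpha>"
  shows "set_integrable lborel (ball (0::'b::euclidean_space) R)
    (\<lambda>y. riesz_kernel \<alpha> DIM('b) ((norm y)^2))"
proof -
  define m where "m = real DIM('b)"
  have "m \<ge> 1" using DIM_positive[where 'a='b] unfolding m_def by linarith
  have "\<exists>\<beta> C E. 0 < \<beta> \<and> \<beta> < m \<and> (\<forall>y\<in>ball (0::'b) R. y \<noteq> 0 \<longrightarrow>
      \<bar>riesz_kernel \<alpha> m ((norm y)^2)\<bar> \<le> C * norm y powr - \<beta> + E)"
  proof -
    consider "\<alpha> < m" | "\<alpha> = m" | "\<alpha> > m" by linarith
    then show ?thesis
    proof cases
      case 1
      then show ?thesis
        using assms by (intro exI[of _ "m - \<alpha>"] exI[of _ 1] exI[of _ 0])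
          (auto simp: riesz_kernel_def power2_norm_powr)
    next
      case 2
      have "\<bar>ln r\<bar> \<le> 2 * r powr - (1/2) + R" if "0 < r" "r < R" for r
      proof -
        have "ln r \<le> r" using ln_bound[of r] that by simp
        moreover have "ln (r powr - (1/2)) \<le> r powr - (1/2)" using that by (intro ln_bound) auto
        then have "- ln r \<le> 2 * r powr - (1/2)" using that by (simp add: ln_powr)
        moreover have "0 \<le> r powr - (1/2)" by simp
        ultimately show ?thesis using that by linarith
      qed
      then show ?thesis
        using \<open>m \<ge> 1\<close> 2 by (intro exI[of _ "1/2"] exI[of _ 2] exI[of _ R])
          (auto simp: riesz_kernel_def ln_realpow)
    next
      case 3
      then show ?thesis
        using \<open>m \<ge> 1\<close> by (intro exI[of _ "1/2"] exI[of _ 0] exI[of _ "R powr (\<alpha> - m)"])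
          (auto simp: riesz_kernel_def power2_norm_powr intro!: powr_mono2)
    qed
  qed
  then obtain \<beta> C E where *: "0 < \<beta>" "\<beta> < m" and
    bd: "\<And>y. y \<in> ball (0::'b) R \<Longrightarrow> y \<noteq> 0 \<Longrightarrow>
      \<bar>riesz_kernel \<alpha> m ((norm y)^2)\<bar> \<le> C * norm y powr - \<beta> + E" by blast
  show ?thesis unfolding m_def[symmetric]
  proof (rule set_integrable_bound)
    show "set_integrable lborel (ball (0::'b) R) (\<lambda>y. C * norm y powr - \<beta> + E)"
      using integrable_norm_powr_ball[of \<beta> R, where 'b='b] *
        set_integrable_continuous_bounded[of "ball (0::'b) R" "\<lambda>_. E"]
      by (intro set_integral_add set_integrable_mult_right) (auto simp: m_def)
    show "set_borel_measurable lborel (ball (0::'b) R) (\<lambda>y. riesz_kernel \<alpha> m ((norm y)^2))"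
      unfolding set_borel_measurable_def by (auto intro!: borel_measurable_times borel_measurable_indicator riesz_kernel_measurable)
    show "AE y in lborel. y \<in> ball (0::'b) R \<longrightarrow>
        norm (riesz_kernel \<alpha> m ((norm y)^2)) \<le> norm (C * norm y powr - \<beta> + E)"
      using AE_lborel_singleton[of "0::'b"] by eventually_elim (use bd in force)
  qed
qed

text \<open>The constant \<open>c\<close> for which the kernel has derivative \<open>- c q\<^sup>-\<^sup>\<gamma>\<close>
  with \<open>\<gamma> = (m + 2 - \<alpha>) / 2\<close>. The sign in the definition of the potential makes it
  positive for every \<open>\<alpha>\<close>.\<close>

definition riesz_coeff :: "real \<Rightarrow> real \<Rightarrow> real" where
  "riesz_coeff \<alpha> m = (if \<alpha> = m then 1/2 else \<bar>m - \<alpha>\<bar> / 2)"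

lemma riesz_coeff_pos: "0 < riesz_coeff \<alpha> m"
  by (simp add: riesz_coeff_def)

lemma riesz_kernel_deriv:
  assumes "0 < q"
  shows "(riesz_kernel \<alpha> m has_real_derivative - (riesz_coeff \<alpha> m * q powr - ((m + 2 - \<alpha>) / 2))) (at q)"
proof (cases "\<alpha> = m")
  case True
  have "((\<lambda>q. - (ln q / 2)) has_real_derivative - (1/2 * q powr - 1)) (at q)"
    using assms by (auto intro!: derivative_eq_intros simp: powr_minus field_simps)
  then show ?thesis using True by (simp add: riesz_kernel_def[abs_def] riesz_coeff_def)
next
  case False
  have "((\<lambda>q. sgn (m - \<alpha>) * q powr ((\<alpha> - m) / 2)) has_real_derivative
      sgn (m - \<alpha>) * (((\<alpha> - m) / 2) * q powr ((\<alpha> - m) / 2 - 1))) (at q)"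
    using assms by (intro DERIV_cmult has_real_derivative_powr)
  moreover have "(\<alpha> - m) / 2 - 1 = - ((m + 2 - \<alpha>) / 2)" by (simp add: field_simps)
  moreover have "sgn (m - \<alpha>) * ((\<alpha> - m) / 2) = - riesz_coeff \<alpha> m"
    using False by (simp add: riesz_coeff_def sgn_if abs_if)
  ultimately show ?thesis using False
    by (simp add: riesz_kernel_def[abs_def] mult.assoc[symmetric])
qed

lemma riesz_kernel_antimono:
  assumes "0 < q" "q \<le> r"
  shows "riesz_kernel \<alpha> m r \<le> riesz_kernel \<alpha> m q"
proof (rule DERIV_nonpos_imp_nonincreasing[OF assms(2)])
  fix s assume "q \<le> s"
  then show "\<exists>y. (riesz_kernel \<alpha> m has_real_derivative y) (at s) \<and> y \<le> 0"
    using assms riesz_kernel_deriv[of s \<alpha> m] riesz_coeff_pos[of \<alpha> m]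
    by (intro exI conjI) (auto intro!: mult_nonneg_nonneg)
qed

text \<open>The shift by \<open>e\<close> removes the singularity at \<open>q = 0\<close>. The added linear term \<open>c
  q\<close> leaves \<open>\<Psi>\<close> nonnegative up to \<open>D\<close>, and its coefficient is the same for
  all \<open>e \<le> 1\<close>.\<close>

lemma convex_kernel_riesz_shift:
  assumes e: "0 < e" "e \<le> 1" and D: "0 \<le> D" and \<alpha>: "\<alpha> < m + 2"
  defines "\<gamma> \<equiv> (m + 2 - \<alpha>) / 2"
  defines "c \<equiv> riesz_coeff \<alpha> m * (D + 1) powr - \<gamma>"
  shows "convex_kernel (\<lambda>q. riesz_kernel \<alpha> m (q + e) + c * q)
    (\<lambda>q. riesz_coeff \<alpha> m * (q + e) powr - \<gamma> - c)
    (\<lambda>q. riesz_coeff \<alpha> m * \<gamma> * (q + e) powr (- \<gamma> - 1)) D"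
proof
  have \<gamma>: "0 < \<gamma>" using \<alpha> by (simp add: \<gamma>_def)
  note pos = riesz_coeff_pos[of \<alpha> m]
  show "((\<lambda>q. riesz_kernel \<alpha> m (q + e) + c * q) has_real_derivative
      - (riesz_coeff \<alpha> m * (q + e) powr - \<gamma> - c)) (at q)" if "0 \<le> q" for q
  proof -
    have d: "((\<lambda>q. q + e) has_real_derivative 1) (at q)" by (auto intro!: derivative_eq_intros)
    have "0 < q + e" using e that by simp
    from DERIV_chain2[OF riesz_kernel_deriv[OF this] d]
    have "((\<lambda>q. riesz_kernel \<alpha> m (q + e)) has_real_derivative - (riesz_coeff \<alpha> m * (q + e) powr - \<gamma>)) (at q)"
      by (simp add: \<gamma>_def)
    then show ?thesis by (auto intro!: derivative_eq_intros)
  qed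
  show "((\<lambda>q. riesz_coeff \<alpha> m * (q + e) powr - \<gamma> - c) has_real_derivative
      - (riesz_coeff \<alpha> m * \<gamma> * (q + e) powr (- \<gamma> - 1))) (at q)" if "0 \<le> q" for q
  proof -
    have d: "((\<lambda>q. q + e) has_real_derivative 1) (at q)" by (auto intro!: derivative_eq_intros)
    have "0 < q + e" using e that by simp
    from DERIV_chain2[OF has_real_derivative_powr[OF this, of "- \<gamma>"] d]
    have "((\<lambda>q. (q + e) powr - \<gamma>) has_real_derivative - \<gamma> * (q + e) powr (- \<gamma> - 1)) (at q)"
      by (simp only: mult_1_right)
    from DERIV_diff[OF DERIV_cmult[OF this] DERIV_const] show ?thesis by (simp add: mult.assoc)
  qed
  show "continuous_on {0..} (\<lambda>q. riesz_coeff \<alpha> m * \<gamma> * (q + e) powr (- \<gamma> - 1))"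
    using e by (auto intro!: continuous_intros)
  show "0 \<le> riesz_coeff \<alpha> m * \<gamma> * (q + e) powr (- \<gamma> - 1)" for q
    using pos \<gamma> by simp
  show "0 \<le> riesz_coeff \<alpha> m * (D + e) powr - \<gamma> - c"
    using e D \<gamma> pos unfolding c_def by (auto intro!: powr_mono2')
qed (rule D)


definition sq_moment :: "'b::euclidean_space set \<Rightarrow> 'b \<Rightarrow> real" where
  "sq_moment = potential (\<lambda>q. q)"

lemma riesz_kernel_shift_continuous:
  "0 < e \<Longrightarrow> continuous_on {0..} (\<lambda>q. riesz_kernel \<alpha> m (q + e))"
  by (cases "\<alpha> = m") (auto simp: riesz_kernel_def intro!: continuous_intros)

abbreviation riesz_approx :: "real \<Rightarrow> real \<Rightarrow> nat \<Rightarrow> real \<Rightarrow> real" where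
  "riesz_approx \<alpha> m n \<equiv> \<lambda>q. riesz_kernel \<alpha> m (q + inverse (real (Suc n)))"

text \<open>The difference of the two kernels is nonnegative away from \<open>0\<close>. Its integral over
  \<open>\<Omega>\<close> is therefore at most its integral over a large ball about \<open>x\<close>, which does
  not depend on \<open>x\<close> and tends to \<open>0\<close> by dominated convergence.\<close>

lemma riesz_potential_uniform_approx:
  fixes \<Omega> :: "'b::euclidean_space set"
  assumes \<Omega>: "bounded \<Omega>" "\<Omega> \<in> sets borel" and \<alpha>: "0 < \<alpha>"
  obtains \<delta> where "\<delta> \<longlonglongrightarrow> 0" "\<And>n x. x \<in> cball 0 \<rho> \<Longrightarrow>
    \<bar>riesz_potential \<alpha> \<Omega> x -
      potential (riesz_approx \<alpha> DIM('b) n) \<Omega> x\<bar> \<le> \<delta> n"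
proof -
  define k where "k = riesz_kernel \<alpha> DIM('b)"
  define e where "e n = inverse (real (Suc n))" for n
  have e: "0 < e n" "e n \<le> 1" for n by (auto simp: e_def inverse_le_1_iff)
  obtain r where r: "\<And>y. y \<in> \<Omega> \<Longrightarrow> norm y \<le> r"
    using \<Omega>(1) unfolding bounded_iff by blast
  define B where "B = ball (0::'b) (\<rho> + r + 1)"
  define H where "H n z = k ((norm z)^2) - k ((norm z)^2 + e n)" for n and z :: 'b
  define \<delta> where "\<delta> n = (LINT z|lborel. indicator B z * H n z)" for n
  have [measurable]: "B \<in> sets borel" by (simp add: B_def)
  have [measurable]: "(\<lambda>z. H n z) \<in> borel_measurable borel" for n
    unfolding H_def k_def by measurable
  have H_nonneg: "0 \<le> H n z" if "z \<noteq> 0" for n z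
    using that e[of n] unfolding H_def k_def by (auto intro!: riesz_kernel_antimono)
  have shift_int: "set_integrable lborel A (\<lambda>y. k ((norm (x - y))^2 + e n))"
    if "bounded A" "A \<in> sets borel" for A x n
    using that e[of n] unfolding k_def
    by (intro set_integrable_continuous_bounded
        continuous_on_compose2[OF riesz_kernel_shift_continuous[OF e(1)[of n]]])
      (auto intro!: continuous_intros)
  have k_int: "set_integrable lborel B (\<lambda>z. k ((norm z)^2))"
    unfolding B_def k_def by (rule riesz_kernel_integrable_ball[OF \<alpha>])
  have H_int: "integrable lborel (\<lambda>z. indicator B z * H n z)" for n
    using set_integral_diff(1)[OF k_int shift_int[of B 0 n]]
    by (simp add: H_def set_integrable_def B_def)
  have "\<delta> \<longlonglongrightarrow> (LINT z|lborel. indicator B (z::'b) * 0)"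
    unfolding \<delta>_def
  proof (rule integral_dominated_convergence[OF _ _ H_int[of 0]])
    show "AE z in lborel. (\<lambda>n. indicator B z * H n z) \<longlonglongrightarrow> indicator B z * 0"
      using AE_lborel_singleton[of "0::'b"]
    proof eventually_elim
      fix z :: 'b assume "z \<noteq> 0"
      have "isCont k ((norm z)^2)"
        unfolding k_def using \<open>z \<noteq> 0\<close> by (intro DERIV_isCont[OF riesz_kernel_deriv]) simp
      moreover have "(\<lambda>n. (norm z)^2 + e n) \<longlonglongrightarrow> (norm z)^2 + 0"
        unfolding e_def by (intro tendsto_intros LIMSEQ_inverse_real_of_nat)
      ultimately have "(\<lambda>n. k ((norm z)^2 + e n)) \<longlonglongrightarrow> k ((norm z)^2)"
        using isCont_tendsto_compose by fastforce
      then have "(\<lambda>n. H n z) \<longlonglongrightarrow> k ((norm z)^2) - k ((norm z)^2)"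
        unfolding H_def by (intro tendsto_intros)
      then show "(\<lambda>n. indicator B z * H n z) \<longlonglongrightarrow> indicator B z * 0"
        by (intro tendsto_intros) simp
    qed
    show "AE z in lborel. norm (indicator B z * H n z) \<le> indicator B z * H 0 z" for n
      using AE_lborel_singleton[of "0::'b"]
    proof eventually_elim
      fix z :: 'b assume z: "z \<noteq> 0"
      have "k ((norm z)^2 + e 0) \<le> k ((norm z)^2 + e n)"
        using e[of n] z unfolding k_def
        by (intro riesz_kernel_antimono) (auto simp: e_def add_pos_pos inverse_le_1_iff)
      then have "H n z \<le> H 0 z" by (simp add: H_def)
      then show "norm (indicator B z * H n z) \<le> indicator B z * H 0 z"
        using H_nonneg[OF z, of n] by (simp add: indicator_def)
    qed
  qed auto
  then have "\<delta> \<longlonglongrightarrow> 0" by simp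
  moreover have "\<bar>riesz_potential \<alpha> \<Omega> x - potential (\<lambda>q. k (q + e n)) \<Omega> x\<bar> \<le> \<delta> n"
    if x: "x \<in> cball 0 \<rho>" for x n
  proof -
    have in_B: "x - y \<in> B" if "y \<in> \<Omega>" for y
      using norm_triangle_ineq4[of x y] r[OF that] x by (simp add: B_def)
    have HB: "integrable lborel (\<lambda>y. indicator B (x - y) * H n (x - y))"
      and HBeq: "(LINT y|lborel. indicator B (x - y) * H n (x - y)) = \<delta> n"
      using H_int[of n] integrable_distr_eq[of "\<lambda>y. x - y" lborel borel "\<lambda>z. indicator B z * H n z"]
        integral_distr[of "\<lambda>y. x - y" lborel borel "\<lambda>z. indicator B z * H n z"]
      by (simp_all add: lborel_distr_reflect \<delta>_def)
    have kB: "integrable lborel (\<lambda>y. indicator B (x - y) * k ((norm (x - y))^2))"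
      using k_int integrable_distr_eq[of "\<lambda>y. x - y" lborel borel "\<lambda>z. indicator B z * k ((norm z)^2)"]
      by (simp add: lborel_distr_reflect set_integrable_def k_def)
    have k\<Omega>: "integrable lborel (\<lambda>y. indicator \<Omega> y * k ((norm (x - y))^2))"
    proof (rule Bochner_Integration.integrable_bound[OF kB])
      show "(\<lambda>y. indicator \<Omega> y * k ((norm (x - y))^2)) \<in> borel_measurable lborel"
        using \<Omega> unfolding k_def by measurable
    qed (use in_B in \<open>auto simp: indicator_def\<close>)
    have diff: "riesz_potential \<alpha> \<Omega> x - potential (\<lambda>q. k (q + e n)) \<Omega> x
        = (LINT y|lborel. indicator \<Omega> y * H n (x - y))"
      using k\<Omega> shift_int[OF \<Omega>, of x n]
      by (simp add: riesz_potential_eq potential_def set_lebesgue_integral_def set_integrable_def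
          H_def right_diff_distrib flip: k_def)
    have AE0: "AE y in lborel. 0 \<le> indicator \<Omega> y * H n (x - y) \<and>
        indicator \<Omega> y * H n (x - y) \<le> indicator B (x - y) * H n (x - y)"
      using AE_lborel_singleton[of x]
      by eventually_elim (use in_B H_nonneg in \<open>auto simp: indicator_def\<close>)
    have "0 \<le> (LINT y|lborel. indicator \<Omega> y * H n (x - y))"
      using AE0 by (intro integral_nonneg_AE) auto
    moreover have "(LINT y|lborel. indicator \<Omega> y * H n (x - y)) \<le> \<delta> n"
      unfolding HBeq[symmetric] using AE0 HB \<Omega> by (intro integral_mono_AE') auto
    ultimately show ?thesis unfolding diff by simp
  qed
  ultimately show ?thesis unfolding k_def e_def by (rule that)
qed

lemma riesz_potential_continuous:
  fixes \<Omega> :: "'b::euclidean_space set"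
  assumes \<Omega>: "bounded \<Omega>" "\<Omega> \<in> sets borel" and \<alpha>: "0 < \<alpha>"
  shows "continuous_on (cball 0 \<rho>) (riesz_potential \<alpha> \<Omega>)"
proof -
  obtain \<delta> where \<delta>: "\<delta> \<longlonglongrightarrow> 0" and bd: "\<And>n x. x \<in> cball 0 \<rho> \<Longrightarrow>
      \<bar>riesz_potential \<alpha> \<Omega> x -
      potential (riesz_approx \<alpha> DIM('b) n) \<Omega> x\<bar> \<le> \<delta> n"
    by (rule riesz_potential_uniform_approx[OF assms, of \<rho>]) (rule that)
  show ?thesis
  proof (rule uniform_limit_theorem)
    show "uniform_limit (cball 0 \<rho>)
        (\<lambda>n. potential (riesz_approx \<alpha> DIM('b) n) \<Omega>)
        (riesz_potential \<alpha> \<Omega>) sequentially"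
      unfolding uniform_limit_iff
    proof (intro allI impI)
      fix \<epsilon> :: real assume "0 < \<epsilon>"
      with \<delta> have "\<forall>\<^sub>F n in sequentially. \<delta> n < \<epsilon>" by (rule order_tendstoD)
      then show "\<forall>\<^sub>F n in sequentially. \<forall>x\<in>cball 0 \<rho>.
          dist (potential (riesz_approx \<alpha> DIM('b) n) \<Omega> x)
            (riesz_potential \<alpha> \<Omega> x) < \<epsilon>"
      proof eventually_elim
        case (elim n)
        then show ?case using bd[of _ n] by (force simp: dist_real_def abs_minus_commute)
      qed
    qed
    show "\<forall>\<^sub>F n in sequentially. continuous_on (cball 0 \<rho>)
        (potential (riesz_approx \<alpha> DIM('b) n) \<Omega>)"
      using \<Omega> by (intro always_eventually allI continuous_on_subset[OF potential_continuous]
          riesz_kernel_shift_continuous) auto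
  qed simp
qed

text \<open>The Riesz potential is a limit of convex-kernel potentials minus a fixed positive multiple of the second moment.
  Weak inequalities for the former survive the limit; the latter makes them strict.\<close>

lemma riesz_potential_limit:
  fixes \<Omega> :: "'b::euclidean_space set"
  assumes \<Omega>: "bounded \<Omega>" "\<Omega> \<in> sets borel" and \<alpha>: "0 < \<alpha>" "\<alpha> < real DIM('b) + 2" and D: "0 \<le> D"
  obtains c K \<Psi> w where "0 < c" "\<And>n. convex_kernel (K n) (\<Psi> n) (w n) D"
    "\<And>x. (\<lambda>n. potential (K n) \<Omega> x - c * sq_moment \<Omega> x) \<longlonglongrightarrow> riesz_potential \<alpha> \<Omega> x"
proof -
  define c where "c = riesz_coeff \<alpha> DIM('b) * (D + 1) powr - ((real DIM('b) + 2 - \<alpha>) / 2)"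
  define k where "k n = (riesz_approx \<alpha> DIM('b) n)" for n
  have "0 < c" using riesz_coeff_pos D by (simp add: c_def)
  moreover have "convex_kernel (\<lambda>q. k n q + c * q)
      (\<lambda>q. riesz_coeff \<alpha> DIM('b) * (q + inverse (real (Suc n))) powr - ((real DIM('b) + 2 - \<alpha>) / 2) - c)
      (\<lambda>q. riesz_coeff \<alpha> DIM('b) * ((real DIM('b) + 2 - \<alpha>) / 2) *
        (q + inverse (real (Suc n))) powr (- ((real DIM('b) + 2 - \<alpha>) / 2) - 1)) D" for n
    unfolding k_def c_def
    by (rule convex_kernel_riesz_shift) (use \<alpha> D in \<open>auto simp: inverse_le_1_iff\<close>)
  moreover have "(\<lambda>n. potential (\<lambda>q. k n q + c * q) \<Omega> x - c * sq_moment \<Omega> x) \<longlonglongrightarrow> riesz_potential \<alpha> \<Omega> x" for x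
  proof -
    have "set_integrable lborel \<Omega> (\<lambda>y. k n ((norm (x - y))^2))" for n
      unfolding k_def
      by (intro set_integrable_continuous_bounded[OF \<Omega>]
        continuous_on_compose2[OF riesz_kernel_shift_continuous])
        (auto intro!: continuous_intros)
    moreover have "set_integrable lborel \<Omega> (\<lambda>y. (norm (x - y))^2)"
      by (intro set_integrable_continuous_bounded[OF \<Omega>] continuous_intros)
    ultimately have eq: "potential (\<lambda>q. k n q + c * q) \<Omega> x - c * sq_moment \<Omega> x = potential (k n) \<Omega> x" for n
      by (simp add: potential_def sq_moment_def)
    obtain \<delta> where \<delta>: "\<delta> \<longlonglongrightarrow> 0" and bd: "\<And>n z. z \<in> cball 0 (norm x) \<Longrightarrow>
        \<bar>riesz_potential \<alpha> \<Omega> z -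
          potential (riesz_approx \<alpha> DIM('b) n) \<Omega> z\<bar> \<le> \<delta> n"
      by (rule riesz_potential_uniform_approx[OF \<Omega> \<alpha>(1), of "norm x"]) (rule that)
    have "(\<lambda>n. riesz_potential \<alpha> \<Omega> x - potential (k n) \<Omega> x) \<longlonglongrightarrow> 0"
      by (rule Lim_null_comparison[OF _ \<delta>]) (use bd[of x, folded k_def] in auto)
    from tendsto_diff[OF tendsto_const[of "riesz_potential \<alpha> \<Omega> x"] this]
    show ?thesis unfolding eq by simp
  qed
  ultimately show ?thesis by (rule that)
qed

section \<open>Reduction to convex kernels\<close>

lemma convex_kernel_neg_id: "convex_kernel (\<lambda>q. - q) (\<lambda>_. 1) (\<lambda>_. 0) D" if "0 \<le> D"
  by standard (use that in \<open>auto intro!: derivative_eq_intros\<close>)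

text \<open>The parallelogram law, integrated over \<open>\<Omega>\<close>.\<close>

lemma sq_moment_midpoint:
  fixes \<Omega> :: "'b::euclidean_space set"
  assumes \<Omega>: "bounded \<Omega>" "\<Omega> \<in> sets borel"
  shows "sq_moment \<Omega> (midpoint x z) =
    (sq_moment \<Omega> x + sq_moment \<Omega> z) / 2 - (norm (x - z))^2 / 4 * measure lborel \<Omega>"
proof -
  have pt: "(norm (midpoint x z - y))^2 =
      (1/2) * (norm (x - y))^2 + (1/2) * (norm (z - y))^2 - (norm (x - z))^2 / 4" for y
  proof -
    have "midpoint x z - y = (1/2) *\<^sub>R ((x - y) + (z - y))"
      by (simp add: midpoint_def algebra_simps scaleR_2[symmetric])
    moreover have "x - z = (x - y) - (z - y)" by simp
    ultimately show ?thesis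
      unfolding power2_norm_eq_inner
      by (simp add: inner_add_left inner_add_right inner_diff_left inner_diff_right inner_commute field_simps)
  qed
  have int: "set_integrable lborel \<Omega> (\<lambda>y. (norm (x - y))^2)" for x
    by (intro set_integrable_continuous_bounded[OF \<Omega>] continuous_intros)
  have fin: "emeasure lborel \<Omega> < \<infinity>"
    by (rule emeasure_bounded_finite[OF \<Omega>(1)])
  have const: "set_integrable lborel \<Omega> (\<lambda>_. a)" for a :: real
    by (intro set_integrable_continuous_bounded[OF \<Omega>] continuous_intros)
  have "(LINT y:\<Omega>|lborel. a) = measure lborel \<Omega> * a" for a :: real
    using fin \<Omega> by (simp add: set_lebesgue_integral_def)
  then show ?thesis
    unfolding sq_moment_def potential_def pt
    using int const by (simp add: set_integral_diff set_integral_add field_simps)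
qed

lemma sq_moment_midpoint_less:
  fixes \<Omega> :: "'b::euclidean_space set"
  assumes "bounded \<Omega>" "\<Omega> \<in> sets borel" "0 < measure lborel \<Omega>" "x \<noteq> z"
  shows "sq_moment \<Omega> (midpoint x z) < (sq_moment \<Omega> x + sq_moment \<Omega> z) / 2"
proof -
  have "0 < (norm (x - z))^2 / 4 * measure lborel \<Omega>" using assms by simp
  then show ?thesis unfolding sq_moment_midpoint[OF assms(1,2)] by linarith
qed

lemma potential_neg_id: "potential (\<lambda>q. - q) \<Omega> x = - sq_moment \<Omega> x"
  by (simp add: potential_def sq_moment_def set_lebesgue_integral_def)

text \<open>Domination of the midpoint as well as of \<open>z\<close> is what gives strictness for the Riesz potential:
  applied to the kernel \<open>- q\<close> it says that the second moment at \<open>z'\<close> is at most that at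
  the midpoint, so by strict convexity it is smaller than that at \<open>z\<close>.\<close>

definition dominated :: "'b::euclidean_space set \<Rightarrow> 'b \<Rightarrow> bool" where
  "dominated \<Omega> z \<longleftrightarrow> (\<exists>z' D. 0 \<le> D \<and> z \<noteq> z' \<and> (\<forall>K \<Psi> w. convex_kernel K \<Psi> w D \<longrightarrow>
      potential K \<Omega> z \<le> potential K \<Omega> z' \<and> potential K \<Omega> (midpoint z z') \<le> potential K \<Omega> z'))"

definition midpoint_concave :: "'b::euclidean_space set \<Rightarrow> 'b \<Rightarrow> 'b \<Rightarrow> bool" where
  "midpoint_concave \<Omega> x z \<longleftrightarrow> (\<exists>D\<ge>0. \<forall>K \<Psi> w. convex_kernel K \<Psi> w D \<longrightarrow>
      (potential K \<Omega> x + potential K \<Omega> z) / 2 \<le> potential K \<Omega> (midpoint x z))"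

locale solid =
  fixes \<Omega> :: "'b::euclidean_space set" and \<alpha> :: real
  assumes bounded: "bounded \<Omega>" and borel: "\<Omega> \<in> sets borel"
    and measure_pos: "0 < measure lborel \<Omega>"
    and \<alpha>: "0 < \<alpha>" "\<alpha> < real DIM('b) + 2"
begin

lemma riesz_potential_gain:
  assumes D: "0 \<le> D"
    and le: "\<And>K \<Psi> w. convex_kernel K \<Psi> w D \<Longrightarrow> potential K \<Omega> z \<le> potential K \<Omega> z'"
  obtains c where "0 < c" "riesz_potential \<alpha> \<Omega> z + c * sq_moment \<Omega> z \<le> riesz_potential \<alpha> \<Omega> z' + c * sq_moment \<Omega> z'"
proof -
  obtain c K \<Psi> w where c: "0 < c" and K: "\<And>n. convex_kernel (K n) (\<Psi> n) (w n) D"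
    and lim: "\<And>x. (\<lambda>n. potential (K n) \<Omega> x - c * sq_moment \<Omega> x) \<longlonglongrightarrow> riesz_potential \<alpha> \<Omega> x"
    using riesz_potential_limit[OF bounded borel \<alpha> D] by metis
  have lim': "(\<lambda>n. potential (K n) \<Omega> x) \<longlonglongrightarrow> riesz_potential \<alpha> \<Omega> x + c * sq_moment \<Omega> x" for x
    using tendsto_add[OF lim[of x] tendsto_const[of "c * sq_moment \<Omega> x"]] by simp
  have "riesz_potential \<alpha> \<Omega> z + c * sq_moment \<Omega> z \<le> riesz_potential \<alpha> \<Omega> z' + c * sq_moment \<Omega> z'"
    by (rule LIMSEQ_le[OF lim' lim']) (use le[OF K] in auto)
  with c show ?thesis by (rule that)
qed

lemma riesz_potential_le:
  assumes D: "0 \<le> D"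
    and le: "\<And>K \<Psi> w. convex_kernel K \<Psi> w D \<Longrightarrow> potential K \<Omega> z \<le> potential K \<Omega> z'"
  shows "riesz_potential \<alpha> \<Omega> z \<le> riesz_potential \<alpha> \<Omega> z'"
proof -
  obtain c where "0 < c"
    "riesz_potential \<alpha> \<Omega> z + c * sq_moment \<Omega> z \<le> riesz_potential \<alpha> \<Omega> z' + c * sq_moment \<Omega> z'"
    by (rule riesz_potential_gain[OF D, of z z']) (erule le, rule that)
  moreover have "sq_moment \<Omega> z' \<le> sq_moment \<Omega> z"
    using le[OF convex_kernel_neg_id[OF D]] by (simp add: potential_neg_id)
  ultimately show ?thesis using mult_left_mono[of "sq_moment \<Omega> z'" "sq_moment \<Omega> z" c] by linarith
qed

lemma riesz_potential_less:
  assumes D: "0 \<le> D" and "z \<noteq> z'"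
    and le: "\<And>K \<Psi> w. convex_kernel K \<Psi> w D \<Longrightarrow>
      potential K \<Omega> z \<le> potential K \<Omega> z' \<and> potential K \<Omega> (midpoint z z') \<le> potential K \<Omega> z'"
  shows "riesz_potential \<alpha> \<Omega> z < riesz_potential \<alpha> \<Omega> z'"
proof -
  obtain c where c: "0 < c"
    "riesz_potential \<alpha> \<Omega> z + c * sq_moment \<Omega> z \<le> riesz_potential \<alpha> \<Omega> z' + c * sq_moment \<Omega> z'"
    by (rule riesz_potential_gain[OF D, of z z']) (erule le[THEN conjunct1], rule that)
  have "sq_moment \<Omega> z' \<le> sq_moment \<Omega> (midpoint z z')"
    using le[OF convex_kernel_neg_id[OF D]] by (simp add: potential_neg_id)
  with sq_moment_midpoint_less[OF bounded borel measure_pos \<open>z \<noteq> z'\<close>]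
  have "sq_moment \<Omega> z' < sq_moment \<Omega> z" by simp
  with c mult_strict_left_mono[OF this c(1)] show ?thesis by linarith
qed

lemma riesz_potential_midpoint:
  assumes D: "0 \<le> D" and "x \<noteq> z"
    and le: "\<And>K \<Psi> w. convex_kernel K \<Psi> w D \<Longrightarrow>
      (potential K \<Omega> x + potential K \<Omega> z) / 2 \<le> potential K \<Omega> (midpoint x z)"
  shows "(riesz_potential \<alpha> \<Omega> x + riesz_potential \<alpha> \<Omega> z) / 2 < riesz_potential \<alpha> \<Omega> (midpoint x z)"
proof -
  obtain c K \<Psi> w where c: "0 < c" and K: "\<And>n. convex_kernel (K n) (\<Psi> n) (w n) D"
    and lim: "\<And>x. (\<lambda>n. potential (K n) \<Omega> x - c * sq_moment \<Omega> x) \<longlonglongrightarrow> riesz_potential \<alpha> \<Omega> x"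
    using riesz_potential_limit[OF bounded borel \<alpha> D] by metis
  have lim': "(\<lambda>n. potential (K n) \<Omega> x) \<longlonglongrightarrow> riesz_potential \<alpha> \<Omega> x + c * sq_moment \<Omega> x" for x
    using tendsto_add[OF lim[of x] tendsto_const[of "c * sq_moment \<Omega> x"]] by simp
  have "((riesz_potential \<alpha> \<Omega> x + c * sq_moment \<Omega> x) + (riesz_potential \<alpha> \<Omega> z + c * sq_moment \<Omega> z)) / 2
      \<le> riesz_potential \<alpha> \<Omega> (midpoint x z) + c * sq_moment \<Omega> (midpoint x z)"
  proof (rule LIMSEQ_le)
    show "(\<lambda>n. (potential (K n) \<Omega> x + potential (K n) \<Omega> z) / 2) \<longlonglongrightarrow>
        ((riesz_potential \<alpha> \<Omega> x + c * sq_moment \<Omega> x) + (riesz_potential \<alpha> \<Omega> z + c * sq_moment \<Omega> z)) / 2"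
      by (intro tendsto_intros lim') simp
    show "(\<lambda>n. potential (K n) \<Omega> (midpoint x z)) \<longlonglongrightarrow>
        riesz_potential \<alpha> \<Omega> (midpoint x z) + c * sq_moment \<Omega> (midpoint x z)"
      by (rule lim')
  qed (use le[OF K] in auto)
  moreover have "c * sq_moment \<Omega> (midpoint x z) < c * ((sq_moment \<Omega> x + sq_moment \<Omega> z) / 2)"
    using c sq_moment_midpoint_less[OF bounded borel measure_pos \<open>x \<noteq> z\<close>] by simp
  ultimately show ?thesis by (simp add: field_simps)
qed

lemma center_exists: "\<exists>x. is_center \<alpha> \<Omega> x"
proof -
  obtain \<rho> where \<rho>: "\<And>y. y \<in> \<Omega> \<Longrightarrow> norm y \<le> \<rho>"
    using bounded unfolding bounded_iff by blast
  have "\<Omega> \<noteq> {}" using measure_pos by auto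
  then have "0 \<le> \<rho>" using \<rho> norm_ge_zero order_trans by blast
  define B where "B = cball (0::'b) \<rho>"
  have B: "convex B" "closed B" "B \<noteq> {}" "compact B" using \<open>0 \<le> \<rho>\<close> by (auto simp: B_def)
  obtain x where x: "x \<in> B" "\<And>z. z \<in> B \<Longrightarrow> riesz_potential \<alpha> \<Omega> z \<le> riesz_potential \<alpha> \<Omega> x"
    using continuous_attains_sup[OF B(4,3) riesz_potential_continuous[OF bounded borel \<alpha>(1), of \<rho>, folded B_def]]
    by blast
  have "riesz_potential \<alpha> \<Omega> z \<le> riesz_potential \<alpha> \<Omega> x" for z
  proof -
    define z' where "z' = closest_point B z"
    \<comment> \<open>An upper bound for the squared distances from \<open>z\<close> to the points of \<open>\<Omega>\<close>, so that
  the kernels decrease on the whole range of distances that occurs.\<close>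
    define D where "D = (norm z + \<rho>)^2"
    have "z' \<in> B" unfolding z'_def using B by (simp add: closest_point_in_set)
    have closer: "norm (z' - y) \<le> norm (z - y)" "(norm (z - y))^2 \<le> D" if "y \<in> \<Omega>" for y
    proof -
      have "y \<in> B" using \<rho>[OF that] by (simp add: B_def)
      then show "norm (z' - y) \<le> norm (z - y)"
        using closest_point_lipschitz[OF B(1-3), of z y] closest_point_self[of y B]
        by (simp add: z'_def dist_norm)
      show "(norm (z - y))^2 \<le> D"
        unfolding D_def using norm_triangle_ineq4[of z y] \<rho>[OF that] by (intro power_mono) auto
    qed
    have "riesz_potential \<alpha> \<Omega> z \<le> riesz_potential \<alpha> \<Omega> z'"
    proof (rule riesz_potential_le)
      fix K \<Psi> w assume "convex_kernel K \<Psi> w D"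
      then interpret convex_kernel K \<Psi> w D .
      have int: "set_integrable lborel \<Omega> (\<lambda>y. K ((norm (x - y))^2))" for x
        by (intro set_integrable_continuous_bounded[OF bounded borel] continuous_intros) auto
      show "potential K \<Omega> z \<le> potential K \<Omega> z'"
        unfolding potential_def
        by (rule set_integral_mono[OF int int]) (use closer in \<open>auto intro!: K_antimono power_mono\<close>)
    qed (simp add: D_def)
    also have "\<dots> \<le> riesz_potential \<alpha> \<Omega> x" using x \<open>z' \<in> B\<close> by blast
    finally show ?thesis .
  qed
  then show ?thesis unfolding is_center_def by blast
qed

text \<open>Dominated points are not centers, and between two distinct centers the potential would be larger still.\<close>

lemma unique_center:
  assumes outside: "\<And>z. z \<notin> C \<Longrightarrow> dominated \<Omega> z"
    and inside: "\<And>x z. x \<in> C \<Longrightarrow> z \<in> C \<Longrightarrow> x \<noteq> z \<Longrightarrow> midpoint_concave \<Omega> x z"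
  shows "\<exists>!x. is_center \<alpha> \<Omega> x"
proof -
  have in_C: "z \<in> C" if "is_center \<alpha> \<Omega> z" for z
  proof (rule ccontr)
    assume "z \<notin> C"
    then obtain z' where "riesz_potential \<alpha> \<Omega> z < riesz_potential \<alpha> \<Omega> z'"
      using outside riesz_potential_less unfolding dominated_def by meson
    with that show False by (simp add: is_center_def not_less[symmetric])
  qed
  have "x = z" if c: "is_center \<alpha> \<Omega> x" "is_center \<alpha> \<Omega> z" for x z
  proof (rule ccontr)
    assume "x \<noteq> z"
    then have "(riesz_potential \<alpha> \<Omega> x + riesz_potential \<alpha> \<Omega> z) / 2 < riesz_potential \<alpha> \<Omega> (midpoint x z)"
      using inside[OF in_C in_C, OF c] riesz_potential_midpoint unfolding midpoint_concave_def by meson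
    moreover have "riesz_potential \<alpha> \<Omega> (midpoint x z) \<le> riesz_potential \<alpha> \<Omega> x"
      "riesz_potential \<alpha> \<Omega> (midpoint x z) \<le> riesz_potential \<alpha> \<Omega> z"
      using c by (auto simp: is_center_def)
    ultimately show False by (simp add: field_simps)
  qed
  with center_exists show ?thesis by blast
qed

end

section \<open>Solids with a concave profile\<close>

text \<open>Both \<open>b\<close> and \<open>c\<close> lie between \<open>a\<close> and \<open>d\<close>, with mirrored
  weights.\<close>

lemma concave_on_rearrange:
  fixes f :: "real \<Rightarrow> real"
  assumes f: "concave_on S f" and S: "a \<in> S" "d \<in> S" and ord: "a \<le> b" "b \<le> d" and sum: "a + d = b + c"
  shows "f a + f d \<le> f b + f c"
proof (cases "a = d")
  case True
  then show ?thesis using ord sum by simp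
next
  case False
  define l where "l = (b - a) / (d - a)"
  have ad: "a < d" using False ord by simp
  then have l: "0 \<le> l" "l \<le> 1" using ord by (auto simp: l_def)
  have "l * (d - a) = b - a" using ad by (simp add: l_def)
  then have b: "b = (1 - l) * a + l * d" and c: "c = l * a + (1 - l) * d"
    using sum by (auto simp: algebra_simps)
  have "(1 - l) * f a + l * f d \<le> f b" "l * f a + (1 - l) * f d \<le> f c"
    unfolding b c using f S l unfolding concave_on_iff by auto
  then show ?thesis by (simp add: algebra_simps)
qed

lemma concave_on_mono_below_max:
  fixes f :: "real \<Rightarrow> real"
  assumes f: "concave_on S f" and S: "a \<in> S" "p \<in> S" and max: "f a \<le> f p" and b: "b \<in> closed_segment a p"
  shows "f a \<le> f b"
proof -
  obtain l where l: "0 \<le> l" "l \<le> 1" and b: "b = (1 - l) * a + l * p"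
    using b by (auto simp: closed_segment_def)
  have "f a = (1 - l) * f a + l * f a" by (simp add: algebra_simps)
  also have "\<dots> \<le> (1 - l) * f a + l * f p" using max l by (simp add: mult_left_mono)
  also have "\<dots> \<le> f b" unfolding b using f S l unfolding concave_on_iff by auto
  finally show ?thesis .
qed

lemma concave_on_min_const:
  fixes f :: "real \<Rightarrow> real"
  assumes "concave_on S f"
  shows "concave_on S (\<lambda>t. min (f t) c)"
  unfolding concave_on_iff
proof (intro conjI ballI allI impI)
  show "convex S" using assms by (auto simp: concave_on_iff)
  fix x y l m :: real assume *: "x \<in> S" "y \<in> S" "0 \<le> l" "0 \<le> m" "l + m = 1"
  have "l * min (f x) c + m * min (f y) c \<le> l * f x + m * f y"
    using * by (intro add_mono mult_left_mono) auto
  also have "\<dots> \<le> f (l *\<^sub>R x + m *\<^sub>R y)"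
    using assms * by (auto simp: concave_on_iff)
  finally have 1: "l * min (f x) c + m * min (f y) c \<le> f (l *\<^sub>R x + m *\<^sub>R y)" .
  have "l * min (f x) c + m * min (f y) c \<le> l * c + m * c"
    using * by (intro add_mono mult_left_mono) auto
  also have "\<dots> = c" using * by (simp add: distrib_right[symmetric])
  finally show "l * min (f x) c + m * min (f y) c \<le> min (f (l *\<^sub>R x + m *\<^sub>R y)) c"
    using 1 by simp
qed

text \<open>A concave profile, extended by \<open>0\<close> outside the unit interval, is increasing up to \<open>p\<close>
  and decreasing afterwards, but it is concave only inside: at the end points it may jump down to
  \<open>0\<close>. The three lemmas on \<open>bump (x + s) - bump (x - s)\<close> deal with these jumps.\<close>

locale concave_bump =
  fixes f :: "real \<Rightarrow> real" and p :: real
  assumes concave: "concave_on {0..1} f" and nonneg: "\<And>t. t \<in> {0..1} \<Longrightarrow> 0 \<le> f t"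
    and p: "p \<in> {0..1}" and peak: "\<And>t. t \<in> {0..1} \<Longrightarrow> f t \<le> f p"
begin

definition bump :: "real \<Rightarrow> real" where "bump t = (if t \<in> {0..1} then f t else 0)"

lemma bump_nonneg: "0 \<le> bump t"
  using nonneg by (simp add: bump_def)

lemma bump_mono: "s \<le> t \<Longrightarrow> t \<le> p \<Longrightarrow> bump s \<le> bump t"
  using concave_on_mono_below_max[OF concave, of s p t] peak p nonneg
  by (auto simp: bump_def closed_segment_eq_real_ivl)

lemma bump_antimono: "p \<le> s \<Longrightarrow> s \<le> t \<Longrightarrow> bump t \<le> bump s"
  using concave_on_mono_below_max[OF concave, of t p s] peak p nonneg
  by (auto simp: bump_def closed_segment_eq_real_ivl)

lemma bump_right:
  assumes "(1 + p) / 2 \<le> x" "0 \<le> s"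
  shows "bump (x + s) \<le> bump (x - s)"
proof (cases "x + s \<le> 1")
  case True
  then show ?thesis using assms by (intro bump_antimono) auto
next
  case False
  then have "bump (x + s) = 0" by (simp add: bump_def)
  then show ?thesis using bump_nonneg by simp
qed

lemma bump_left:
  assumes "x \<le> p / 2" "0 \<le> s"
  shows "bump (x - s) \<le> bump (x + s)"
proof (cases "0 \<le> x - s")
  case True
  then show ?thesis using assms by (intro bump_mono) auto
next
  case False
  then have "bump (x - s) = 0" by (simp add: bump_def)
  then show ?thesis using bump_nonneg by simp
qed

text \<open>When all four points lie in the unit interval this is concavity. If \<open>x' + s\<close> has left it, then
  \<open>s > 1 - x' \<ge> (1 - p) / 2\<close>, hence \<open>x' - s < p\<close>, and the remaining terms compare by
  monotonicity on the increasing part; symmetrically if \<open>x - s\<close> has left it.\<close>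

lemma bump_middle:
  assumes x: "p / 2 \<le> x" "x \<le> x'" "x' \<le> (1 + p) / 2" and s: "0 \<le> s"
  shows "bump (x' + s) + bump (x - s) \<le> bump (x + s) + bump (x' - s)"
proof -
  consider "1 < x' + s" | "x - s < 0" | "x' + s \<le> 1" "0 \<le> x - s" by linarith
  then show ?thesis
  proof cases
    case 1
    then have "bump (x' + s) = 0" by (simp add: bump_def)
    moreover have "bump (x - s) \<le> bump (x' - s)" using 1 x by (intro bump_mono) auto
    ultimately show ?thesis using bump_nonneg[of "x + s"] by simp
  next
    case 2
    then have "bump (x - s) = 0" by (simp add: bump_def)
    moreover have "bump (x' + s) \<le> bump (x + s)" using 2 x by (intro bump_antimono) auto
    ultimately show ?thesis using bump_nonneg[of "x' - s"] by simp
  next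
    case 3
    then have "f (x - s) + f (x' + s) \<le> f (x + s) + f (x' - s)"
      using x s by (intro concave_on_rearrange[OF concave]) auto
    then show ?thesis using 3 x s by (simp add: bump_def)
  qed
qed

end

lemma measure_cball_Int_section:
  assumes "0 \<le> r"
  shows "measure lborel {y::'a::euclidean_space. norm y \<le> r \<and> s\<^sup>2 + (norm y)^2 < v} =
    unit_ball_vol DIM('a) * min (r ^ DIM('a)) (sqrt (max 0 (v - s\<^sup>2)) ^ DIM('a))"
proof -
  define S where "S = {y::'a. norm y \<le> r \<and> s\<^sup>2 + (norm y)^2 < v}"
  define R where "R = sqrt (max 0 (v - s\<^sup>2))"
  consider "v - s\<^sup>2 \<le> 0" | "0 < v - s\<^sup>2" "r < R" | "0 < v - s\<^sup>2" "R \<le> r" by linarith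
  then show ?thesis unfolding R_def[symmetric] S_def[symmetric]
  proof cases
    case 1
    have "\<not> s\<^sup>2 + (norm y)^2 < v" for y :: 'a
      using 1 zero_le_power2[of "norm y"] by linarith
    then have e: "S = {}" unfolding S_def by blast
    have R0: "R = 0" using 1 by (simp add: R_def)
    show "measure lborel S = unit_ball_vol DIM('a) * min (r ^ DIM('a)) (R ^ DIM('a))"
      unfolding e R0 using assms by (simp add: power_0_left)
  next
    case 2
    have "s\<^sup>2 + (norm y)^2 < v" if "norm y \<le> r" for y :: 'a
    proof -
      have "(norm y)^2 < R\<^sup>2" using that 2 by (intro power_strict_mono) auto
      then show ?thesis using 2 by (simp add: R_def)
    qed
    then have "S = cball 0 r" by (auto simp: S_def)
    moreover have "r ^ DIM('a) \<le> R ^ DIM('a)" using 2 assms by (intro power_mono) auto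
    ultimately show "measure lborel S = unit_ball_vol DIM('a) * min (r ^ DIM('a)) (R ^ DIM('a))"
      using assms by (simp add: content_cball)
  next
    case 3
    have R: "0 \<le> R" "R\<^sup>2 = v - s\<^sup>2" using 3 by (auto simp: R_def)
    have "s\<^sup>2 + (norm y)^2 < v \<longleftrightarrow> norm y < R" for y :: 'a
      using R power_mono_iff[of R "norm y" 2] by (auto simp: not_le[symmetric])
    moreover have "norm y < R \<Longrightarrow> norm y \<le> r" for y :: 'a using 3 by linarith
    ultimately have "S = ball 0 R" unfolding S_def
      by (intro set_eqI) (metis (mono_tags, lifting) mem_Collect_eq mem_ball_0)
    moreover have "R ^ DIM('a) \<le> r ^ DIM('a)" using 3 R by (intro power_mono) auto
    ultimately show "measure lborel S = unit_ball_vol DIM('a) * min (r ^ DIM('a)) (R ^ DIM('a))"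
      using R by (simp add: content_ball)
  qed
qed

locale concave_profile =
  fixes \<omega> :: "real \<Rightarrow> real" and p :: real and \<Omega> :: "(real \<times> 'a::euclidean_space) set"
  assumes \<Omega>_def: "\<Omega> = profile_solid \<omega>"
    and bounded: "bounded \<Omega>" and closed: "closed \<Omega>"
    and \<omega>_nonneg: "\<And>t. t \<in> {0..1} \<Longrightarrow> 0 \<le> \<omega> t"
    and \<omega>_cont: "continuous_on {0..1} \<omega>"
    and \<omega>_concave: "concave_on {0..1} (\<lambda>t. \<omega> t ^ DIM('a))"
    and p: "p \<in> {0..1}" and peak: "\<And>t. t \<in> {0..1} \<Longrightarrow> \<omega> t \<le> \<omega> p"
begin

lemma borel: "\<Omega> \<in> sets borel"
  using closed by auto

lemma mem: "(t, y) \<in> \<Omega> \<longleftrightarrow> t \<in> {0..1} \<and> norm y \<le> \<omega> t"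
  by (auto simp: \<Omega>_def profile_solid_def)

lemma bump_cut: "0 \<le> c \<Longrightarrow> concave_bump (\<lambda>t. min (\<omega> t ^ DIM('a)) c) p"
proof (intro concave_bump.intro concave_on_min_const \<omega>_concave p)
  assume "0 \<le> c"
  fix t :: real assume t: "t \<in> {0..1}"
  show "0 \<le> min (\<omega> t ^ DIM('a)) c" using \<omega>_nonneg[OF t] \<open>0 \<le> c\<close> by simp
  show "min (\<omega> t ^ DIM('a)) c \<le> min (\<omega> p ^ DIM('a)) c"
    using power_mono[OF peak[OF t] \<omega>_nonneg[OF t]] by (rule min.mono) simp
qed

text \<open>Up to the volume of the unit ball this is the volume of the part of the slice at \<open>t\<close> inside a ball
  of radius \<open>c\<^sup>1\<^sup>/\<^sup>d\<close>, \<open>d\<close> being the dimension of the slices. As a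
  minimum with a constant it inherits concavity from the power of \<open>\<omega>\<close>.\<close>

definition cut :: "real \<Rightarrow> real \<Rightarrow> real" where
  "cut c t = (if t \<in> {0..1} then min (\<omega> t ^ DIM('a)) c else 0)"

definition radius_power :: "real \<Rightarrow> real \<Rightarrow> real" where
  "radius_power v s = sqrt (max 0 (v - s\<^sup>2)) ^ DIM('a)"

text \<open>The derivative at \<open>(x, 0)\<close> of the potential along the axis, for the step \<open>\<Psi> q = 1(q <
  v)\<close>.\<close>

definition flux :: "real \<Rightarrow> real \<Rightarrow> real" where
  "flux v x = (LINT y:\<Omega>|lborel. 2 * (fst y - x) * indicator {y. (norm ((x, 0) - y))^2 < v} y)"

lemma flux_integrable: "set_integrable lborel \<Omega> (\<lambda>y. 2 * (fst y - x) * indicator {y. (norm ((x, 0) - y))^2 < v} y)"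
proof (rule set_integrable_bound)
  show "set_integrable lborel \<Omega> (\<lambda>y. 2 * (fst y - x))"
    by (intro set_integrable_continuous_bounded bounded borel continuous_intros)
  show "set_borel_measurable lborel \<Omega> (\<lambda>y. 2 * (fst y - x) * indicator {y. (norm ((x, 0) - y))^2 < v} y)"
  proof -
    have "open {y. (norm ((x, 0) - y))^2 < v}" by (intro open_Collect_less continuous_intros)
    moreover have "(\<lambda>y::real \<times> 'a. 2 * (fst y - x)) \<in> borel_measurable borel"
      by (intro borel_measurable_continuous_onI continuous_intros)
    ultimately show ?thesis
      unfolding set_borel_measurable_def using borel
      by (auto intro!: borel_measurable_times borel_measurable_scaleR borel_measurable_indicator)
  qed
qed (auto simp: indicator_def)

definition balance :: "real \<Rightarrow> real \<Rightarrow> real \<Rightarrow> real" where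
  "balance v x s = s * (cut (radius_power v s) (x + s) - cut (radius_power v s) (x - s))"

text \<open>Fubini over the slices, followed by symmetrisation \<open>s \<leftrightarrow> -s\<close>.\<close>

lemma flux_eq: "flux v x = unit_ball_vol DIM('a) * (LINT s|lborel. balance v x s)"
  and balance_integrable: "integrable lborel (balance v x)"
proof -
  define g where "g s = s * cut (radius_power v s) (x + s)" for s
  have balance: "balance v x s = g s + g (- s)" for s
    by (simp add: balance_def g_def radius_power_def algebra_simps)
  define F where "F z = indicator \<Omega> z * (2 * (fst z - x) * indicator {y. (norm ((x, 0) - y))^2 < v} z)"
    for z :: "real \<times> 'a"
  have F: "integrable (lborel \<Otimes>\<^sub>M lborel) F"
    using flux_integrable[of x v]
    by (simp add: set_integrable_def F_def[abs_def] lborel_prod)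
  have inner: "(LINT y|lborel. F (t, y)) = 2 * unit_ball_vol DIM('a) * g (t - x)" for t
  proof (cases "t \<in> {0..1}")
    case True
    have "F (t, y) = 2 * (t - x) * indicator {y. norm y \<le> \<omega> t \<and> (t - x)^2 + (norm y)^2 < v} y" for y
      using True by (auto simp: F_def mem indicator_def norm_Pair real_sqrt_pow2 power2_commute)
    then have "(LINT y|lborel. F (t, y)) = 2 * (t - x) *
        measure lborel {y::'a. norm y \<le> \<omega> t \<and> (t - x)^2 + (norm y)^2 < v}"
      by simp
    then show ?thesis
      using True \<omega>_nonneg[OF True]
      by (simp add: measure_cball_Int_section g_def cut_def radius_power_def)
  next
    case False
    then have "F (t, y) = 0" for y by (auto simp: F_def mem indicator_def)
    then show ?thesis using False by (auto simp: g_def cut_def)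
  qed
  have "integrable lborel (\<lambda>t. LINT y|lborel. F (t, y))"
    by (rule lborel_pair.integrable_fst'[OF F])
  then have "integrable lborel (\<lambda>t. g (t - x))"
    unfolding inner by (simp add: order_less_imp_not_eq2)
  from lborel_integrable_real_affine[OF this, of 1 x]
  have g: "integrable lborel g" by simp
  from lborel_integrable_real_affine[OF g, of "-1" 0]
  have g': "integrable lborel (\<lambda>s. g (- s))" by simp
  show "integrable lborel (balance v x)" unfolding balance[abs_def] using g g' by simp
  have "flux v x = (LINT t|lborel. LINT y|lborel. F (t, y))"
    unfolding lborel_pair.integral_fst'[OF F]
    by (simp add: flux_def F_def[abs_def] set_lebesgue_integral_def lborel_prod)
  also have "\<dots> = 2 * unit_ball_vol DIM('a) * (LINT t|lborel. g (t - x))"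
    unfolding inner by simp
  also have "(LINT t|lborel. g (t - x)) = (LINT s|lborel. g s)"
    using lborel_integral_real_affine[of 1 "\<lambda>t. g (t - x)" x] by simp
  also have "2 * unit_ball_vol DIM('a) * (LINT s|lborel. g s) =
      unit_ball_vol DIM('a) * ((LINT s|lborel. g s) + (LINT s|lborel. g s))" by simp
  also have "(LINT s|lborel. g s) + (LINT s|lborel. g s) = (LINT s|lborel. g s) + (LINT s|lborel. g (- s))"
    using lborel_integral_real_affine[of "-1" g 0] by simp
  also have "\<dots> = (LINT s|lborel. balance v x s)" unfolding balance using g g' by simp
  finally show "flux v x = unit_ball_vol DIM('a) * (LINT s|lborel. balance v x s)" .
qed

lemma balance_right: "(1 + p) / 2 \<le> x \<Longrightarrow> balance v x s \<le> 0"
  and balance_left: "x \<le> p / 2 \<Longrightarrow> 0 \<le> balance v x s"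
  and balance_antimono: "p / 2 \<le> x \<Longrightarrow> x \<le> x' \<Longrightarrow> x' \<le> (1 + p) / 2 \<Longrightarrow> balance v x' s \<le> balance v x s"
proof -
  define c where "c = radius_power v \<bar>s\<bar>"
  have eq: "balance v x s = \<bar>s\<bar> * (cut c (x + \<bar>s\<bar>) - cut c (x - \<bar>s\<bar>))" for x
    by (cases "0 \<le> s") (simp_all add: balance_def c_def radius_power_def right_diff_distrib)
  have "0 \<le> c" by (simp add: c_def radius_power_def)
  then interpret b: concave_bump "\<lambda>t. min (\<omega> t ^ DIM('a)) c" p by (rule bump_cut)
  have cut: "cut c = b.bump" by (auto simp: cut_def b.bump_def)
  show "(1 + p) / 2 \<le> x \<Longrightarrow> balance v x s \<le> 0"
    unfolding eq cut using b.bump_right[of x "\<bar>s\<bar>"] by (simp add: mult_nonneg_nonpos)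
  show "x \<le> p / 2 \<Longrightarrow> 0 \<le> balance v x s"
    unfolding eq cut using b.bump_left[of x "\<bar>s\<bar>"] by simp
  show "p / 2 \<le> x \<Longrightarrow> x \<le> x' \<Longrightarrow> x' \<le> (1 + p) / 2 \<Longrightarrow> balance v x' s \<le> balance v x s"
    unfolding eq cut using b.bump_middle[of x x' "\<bar>s\<bar>"] by (intro mult_left_mono) auto
qed

lemma flux_right: "(1 + p) / 2 \<le> x \<Longrightarrow> flux v x \<le> 0"
  unfolding flux_eq
  using integral_mono[OF balance_integrable integrable_zero balance_right, of x v]
  by (intro mult_nonneg_nonpos) auto

lemma flux_left: "x \<le> p / 2 \<Longrightarrow> 0 \<le> flux v x"
  unfolding flux_eq by (simp add: Bochner_Integration.integral_nonneg balance_left)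

lemma flux_antimono: "p / 2 \<le> x \<Longrightarrow> x \<le> x' \<Longrightarrow> x' \<le> (1 + p) / 2 \<Longrightarrow> flux v x' \<le> flux v x"
  unfolding flux_eq
  by (intro mult_left_mono integral_mono balance_integrable balance_antimono) auto

text \<open>The layer-cake formula for the derivative along the axis. The value \<open>D + 1\<close> only serves as a level
  above all occurring \<open>q\<close>, so that the first term is the integral over the whole solid.\<close>

definition axis_slope :: "(real \<Rightarrow> real) \<Rightarrow> (real \<Rightarrow> real) \<Rightarrow> real \<Rightarrow> real \<Rightarrow> real" where
  "axis_slope \<Psi> w D x = \<Psi> D * flux (D + 1) x + (LINT s:{0..D}|lborel. w s * flux s x)"

lemma potential_axis_deriv:
  assumes K: "convex_kernel K \<Psi> w D" and D: "\<And>y. y \<in> \<Omega> \<Longrightarrow> (norm ((x, 0) - y))^2 \<le> D"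
  shows "((\<lambda>x. potential K \<Omega> (x, 0)) has_real_derivative
      axis_slope \<Psi> w D x) (at x)"
    and "set_integrable lborel {0..D} (\<lambda>s. w s * flux s x)"
proof -
  interpret convex_kernel K \<Psi> w D by (rule K)
  have int: "set_integrable lborel \<Omega> (\<lambda>y. 2 * (fst y - x))"
    by (intro set_integrable_continuous_bounded bounded borel continuous_intros)
  have m: "(\<lambda>y::real \<times> 'a. (norm ((x, 0) - y))^2) \<in> borel_measurable borel"
    by (intro borel_measurable_continuous_onI continuous_intros)
  have q: "y \<in> \<Omega> \<Longrightarrow> 0 \<le> (norm ((x, 0) - y))^2 \<and> (norm ((x, 0) - y))^2 \<le> D" for y
    using D by simp
  note cake = layer_cake[OF int m q, folded flux_def]
  have "(LINT y:\<Omega>|lborel. 2 * (fst y - x)) = flux (D + 1) x"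
  proof -
    have "(norm ((x, 0) - y))^2 < D + 1" if "y \<in> \<Omega>" for y
      using D[OF that] by linarith
    then show ?thesis
      unfolding flux_def
      by (intro set_lebesgue_integral_cong) (use borel in \<open>simp_all add: indicator_def\<close>)
  qed
  with cake(1) have "(LINT y:\<Omega>|lborel. 2 * (fst y - x) * \<Psi> ((norm ((x, 0) - y))^2)) =
      axis_slope \<Psi> w D x"
    by (simp add: axis_slope_def)
  moreover have "((\<lambda>t. potential K \<Omega> (0 + t *\<^sub>R (1, 0))) has_real_derivative
      (LINT y:\<Omega>|lborel. 2 * (fst y - x) * \<Psi> ((norm ((x, 0) - y))^2))) (at x)"
    using potential_deriv[OF bounded borel, of 0 "(1, 0)" x] by (simp add: inner_prod_def)
  ultimately show "((\<lambda>x. potential K \<Omega> (x, 0)) has_real_derivative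
      axis_slope \<Psi> w D x) (at x)" by simp
  show "set_integrable lborel {0..D} (\<lambda>s. w s * flux s x)" by (rule cake(2))
qed

context
  fixes K \<Psi> w D a b
  assumes K: "convex_kernel K \<Psi> w D"
    and D: "\<And>x y. x \<in> {a..b} \<Longrightarrow> y \<in> \<Omega> \<Longrightarrow> (norm ((x, 0) - y))^2 \<le> D"
begin

interpretation convex_kernel K \<Psi> w D by (rule K)

lemma potential_axis_right:
  assumes "(1 + p) / 2 \<le> a" "a \<le> b"
  shows "potential K \<Omega> (b, 0) \<le> potential K \<Omega> (a, 0)"
proof (rule DERIV_nonpos_imp_nonincreasing[OF \<open>a \<le> b\<close>])
  fix x assume x: "a \<le> x" "x \<le> b"
  have "(LINT s:{0..D}|lborel. w s * flux s x) \<le> (LINT s:{0..D}|lborel. 0)"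
    using potential_axis_deriv(2)[OF K D, of x] x assms
    by (intro set_integral_mono) (auto simp: set_integrable_def w_nonneg flux_right intro!: mult_nonneg_nonpos)
  then have "(LINT s:{0..D}|lborel. w s * flux s x) \<le> 0" by simp
  moreover have "\<Psi> D * flux (D + 1) x \<le> 0"
    using \<Psi>_D flux_right[of x] x assms by (intro mult_nonneg_nonpos) auto
  ultimately show "\<exists>y. ((\<lambda>x. potential K \<Omega> (x, 0)) has_real_derivative y) (at x) \<and> y \<le> 0"
    using potential_axis_deriv(1)[OF K D, of x] x
    by (intro exI[of _ "axis_slope \<Psi> w D x"]) (auto simp: axis_slope_def)
qed

lemma potential_axis_left:
  assumes "a \<le> b" "b \<le> p / 2"
  shows "potential K \<Omega> (a, 0) \<le> potential K \<Omega> (b, 0)"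
proof (rule DERIV_nonneg_imp_nondecreasing[OF \<open>a \<le> b\<close>])
  fix x assume x: "a \<le> x" "x \<le> b"
  have "0 \<le> (LINT s:{0..D}|lborel. w s * flux s x)"
    unfolding set_lebesgue_integral_def
    using x assms by (intro Bochner_Integration.integral_nonneg) (auto simp: indicator_def w_nonneg flux_left)
  moreover have "0 \<le> \<Psi> D * flux (D + 1) x"
    using \<Psi>_D flux_left[of x] x assms by (intro mult_nonneg_nonneg) auto
  ultimately show "\<exists>y. ((\<lambda>x. potential K \<Omega> (x, 0)) has_real_derivative y) (at x) \<and> 0 \<le> y"
    using potential_axis_deriv(1)[OF K D, of x] x
    by (intro exI[of _ "axis_slope \<Psi> w D x"]) (auto simp: axis_slope_def)
qed

lemma potential_axis_concave:
  assumes "p / 2 \<le> a" "b \<le> (1 + p) / 2"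
  shows "concave_on {a..b} (\<lambda>x. potential K \<Omega> (x, 0))"
  unfolding concave_on_def
proof (rule convex_on_realI)
  show "((\<lambda>x. - potential K \<Omega> (x, 0)) has_real_derivative
      - axis_slope \<Psi> w D x) (at x)" if "x \<in> {a..b}" for x
    by (intro DERIV_minus potential_axis_deriv[OF K] D that)
  fix x x' assume x: "x \<in> {a..b}" "x' \<in> {a..b}" "x \<le> x'"
  have "(LINT s:{0..D}|lborel. w s * flux s x') \<le> (LINT s:{0..D}|lborel. w s * flux s x)"
    using x assms
    by (intro set_integral_mono potential_axis_deriv(2)[OF K] D mult_left_mono flux_antimono w_nonneg) auto
  moreover have "\<Psi> D * flux (D + 1) x' \<le> \<Psi> D * flux (D + 1) x"
    using x assms \<Psi>_D by (intro mult_left_mono flux_antimono) auto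
  ultimately show "- axis_slope \<Psi> w D x \<le> - axis_slope \<Psi> w D x'" by (simp add: axis_slope_def)
qed simp

end

text \<open>After translating, the two potentials are integrals of the same function \<open>k\<close> over
  \<open>\<Omega>\<close> and over a copy of \<open>\<Omega>\<close> shifted by \<open>z\<close> in the slices.
  Subtracting from \<open>k\<close> its value \<open>g\<close> on the boundary sphere of the slice does not change
  their difference, since \<open>g\<close> depends on the first coordinate only; but then the integrand is
  nonnegative on \<open>\<Omega>\<close> and nonpositive on the part of the copy outside \<open>\<Omega>\<close>.\<close>

lemma potential_off_axis:
  assumes K: "convex_kernel K \<Psi> w D"
    and D: "\<And>y. y \<in> \<Omega> \<Longrightarrow> (norm ((x, 0) - y))^2 \<le> D" "\<And>y. y \<in> \<Omega> \<Longrightarrow> (norm ((x, z) - y))^2 \<le> D"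
  shows "potential K \<Omega> (x, z) \<le> potential K \<Omega> (x, 0)"
proof -
  interpret convex_kernel K \<Psi> w D by (rule K)
  define k where "k y = K ((norm ((x, 0) - y))^2)" for y :: "real \<times> 'a"
  define g where "g y = K ((x - fst y)^2 + (\<omega> (fst y))^2)" for y :: "real \<times> 'a"
  define f where "f y = k y - g y" for y
  have norm2: "(norm ((x, u) - (t, v)))^2 = (x - t)^2 + (norm (u - v))^2" for u v :: 'a and t
    by (simp add: norm_Pair)
  have shift: "integrable lborel (\<lambda>y. indicator \<Omega> (y + (0, z)) * h y)
      \<and> (LINT y|lborel. indicator \<Omega> (y + (0, z)) * h y) = (LINT y|lborel. indicator \<Omega> y * h (y - (0, z)))"
    if "integrable lborel (\<lambda>y. indicator \<Omega> y * h (y - (0, z)))" for h :: "real \<times> 'a \<Rightarrow> real"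
  proof -
    let ?h = "\<lambda>y. indicator \<Omega> y * h (y - (0, z))"
    have d: "distr lborel borel ((+) (0, z)) = (lborel :: (real \<times> 'a) measure)"
      by (rule lborel_distr_plus)
    have m: "?h \<in> borel_measurable borel" using borel_measurable_integrable[OF that] by simp
    show ?thesis
      using integrable_distr_eq[of "(+) (0, z)" lborel borel ?h] integral_distr[of "(+) (0, z)" lborel borel ?h] m that
      unfolding d by (simp add: add.commute[of "(0, z)"])
  qed
  have comp: "compact \<Omega>" using bounded closed by (simp add: compact_eq_bounded_closed)
  have int: "integrable lborel (\<lambda>y. indicator \<Omega> y * h y)" if "continuous_on \<Omega> h" for h :: "real \<times> 'a \<Rightarrow> real"
    using borel_integrable_compact[OF comp that] by simp
  have fst01: "fst y \<in> {0..1}" if "y \<in> \<Omega>" for y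
    using that mem[of "fst y" "snd y"] by simp
  have k_cont: "continuous_on \<Omega> k" "continuous_on \<Omega> (\<lambda>y. k (y - (0, z)))"
    unfolding k_def by (intro continuous_intros; simp)+
  have \<omega>_fst: "continuous_on \<Omega> (\<lambda>y. \<omega> (fst y))"
    by (rule continuous_on_compose2[OF \<omega>_cont]) (use fst01 in \<open>auto intro!: continuous_intros\<close>)
  have g_cont: "continuous_on \<Omega> g"
    unfolding g_def by (intro continuous_intros \<omega>_fst) auto
  have g_shift: "g (y - (0, z)) = g y" for y by (simp add: g_def)
  have k_shift: "k (y - (0, z)) = K ((norm ((x, z) - y))^2)" for y
    by (cases y) (simp add: k_def)
  have ik: "integrable lborel (\<lambda>y. indicator \<Omega> y * k (y - (0, z)))"
    and ig: "integrable lborel (\<lambda>y. indicator \<Omega> y * g (y - (0, z)))"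
    and ik0: "integrable lborel (\<lambda>y. indicator \<Omega> y * k y)"
    and ig0: "integrable lborel (\<lambda>y. indicator \<Omega> y * g y)"
    using int[OF k_cont(2)] int[OF k_cont(1)] int[OF g_cont] unfolding g_shift by auto
  have "indicator \<Omega> (y + (0, z)) * f y \<le> indicator \<Omega> y * f y" for y
  proof -
    obtain t v where y: "y = (t, v)" by (cases y)
    show ?thesis
    proof (cases "y \<in> \<Omega>")
      case True
      then have t: "t \<in> {0..1}" and v: "norm v \<le> \<omega> t" by (auto simp: y mem)
      obtain e :: 'a where e: "norm e = \<omega> t" using \<omega>_nonneg[OF t] vector_choose_size by blast
      have "(t, e) \<in> \<Omega>" using t e by (simp add: mem)
      moreover have "(norm ((x, 0) - (t, e)))^2 = (x - t)^2 + (\<omega> t)^2"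
        unfolding norm2 using e by simp
      ultimately have "(x - t)^2 + (\<omega> t)^2 \<le> D" using D(1) by metis
      then have "0 \<le> f y"
        using v unfolding f_def k_def g_def y norm2 by (auto intro!: K_antimono power_mono)
      then show ?thesis using True by (simp add: indicator_def)
    next
      case False
      have "f y \<le> 0" if "y + (0, z) \<in> \<Omega>"
      proof -
        have t: "t \<in> {0..1}" using that by (auto simp: y mem)
        with False have "\<omega> t \<le> norm v" by (auto simp: y mem)
        moreover have "(x - t)^2 + (norm v)^2 \<le> D"
        proof -
          have "y + (0, z) = (t, v + z)" by (simp add: y)
          with D(2)[OF that] have "(norm ((x, z) - (t, v + z)))^2 \<le> D" by (simp only:)
          then show ?thesis unfolding norm2 by simp
        qed
        ultimately show ?thesis
          using \<omega>_nonneg[OF t] unfolding f_def k_def g_def y norm2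
          by (auto intro!: K_antimono power_mono)
      qed
      then show ?thesis using False by (simp add: indicator_def)
    qed
  qed
  then have "(LINT y|lborel. indicator \<Omega> (y + (0, z)) * f y) \<le> (LINT y|lborel. indicator \<Omega> y * f y)"
    using shift[OF ik] shift[OF ig] ik0 ig0
    by (intro integral_mono) (simp_all add: f_def right_diff_distrib)
  moreover have "(LINT y|lborel. indicator \<Omega> (y + (0, z)) * f y) =
      (LINT y|lborel. indicator \<Omega> y * k (y - (0, z))) - (LINT y|lborel. indicator \<Omega> y * g y)"
    using shift[OF ik] shift[OF ig] by (simp add: f_def right_diff_distrib g_shift)
  moreover have "(LINT y|lborel. indicator \<Omega> y * f y) =
      (LINT y|lborel. indicator \<Omega> y * k y) - (LINT y|lborel. indicator \<Omega> y * g y)"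
    using ik0 ig0 by (simp add: f_def right_diff_distrib)
  moreover have "potential K \<Omega> (x, z) = (LINT y|lborel. indicator \<Omega> y * k (y - (0, z)))"
    "potential K \<Omega> (x, 0) = (LINT y|lborel. indicator \<Omega> y * k y)"
    by (simp_all only: potential_def set_lebesgue_integral_def k_shift real_scaleR_def) (simp add: k_def)
  ultimately show ?thesis by simp
qed

text \<open>The set \<open>C\<close> of the criterion is the part of the axis over \<open>[p / 2, (1 + p) / 2]\<close>.\<close>

lemma unique_center_profile:
  assumes "solid \<Omega> \<alpha>"
  shows "\<exists>!x. is_center \<alpha> \<Omega> x"
proof -
  interpret solid \<Omega> \<alpha> by (rule assms)
  define C where "C = {p / 2..(1 + p) / 2} \<times> {0::'a}"
  obtain \<rho> where \<rho>: "\<And>y. y \<in> \<Omega> \<Longrightarrow> norm y \<le> \<rho>"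
    using bounded unfolding bounded_iff by blast
  have D: "(norm (z - y))^2 \<le> (M + \<rho>)^2" if "norm z \<le> M" "y \<in> \<Omega>" for z y M
    using norm_triangle_ineq4[of z y] \<rho>[of y] that by (intro power_mono) auto
  show ?thesis
  proof (rule unique_center[of C])
    fix z :: "real \<times> 'a" assume "z \<notin> C"
    obtain x v where z: "z = (x, v)" by (cases z)
    define M where "M = norm z + 1"
    have norm_axis: "norm (t, 0::'a) \<le> M" if "\<bar>t\<bar> \<le> max 1 \<bar>x\<bar>" for t
    proof -
      have "\<bar>x\<bar> \<le> norm z" using norm_fst_le[of x v] z by simp
      then show ?thesis using that norm_ge_zero[of z] unfolding M_def by (auto simp: norm_Pair)
    qed
    show "dominated \<Omega> z"
    proof (cases "v = 0")
      case False
      have m: "midpoint z (x, 0) = (x, (1/2) *\<^sub>R v)" by (simp add: z midpoint_def scaleR_2[symmetric])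
      have "norm (x, (1/2) *\<^sub>R v) \<le> norm z"
        by (simp add: z norm_Pair power_mult_distrib)
      then have "norm (x, (1/2) *\<^sub>R v) \<le> M" "norm (x, v) \<le> M" by (auto simp: M_def z)
      then show ?thesis
        using False norm_axis[of x] unfolding dominated_def
        by (intro exI[of _ "(x, 0)"] exI[of _ "(M + \<rho>)^2"])
          (auto simp: z m[unfolded z] intro!: potential_off_axis D)
    next
      case v: True
      show ?thesis
      proof (cases "x < p / 2")
        case True
        have m: "midpoint z (p / 2, 0) = ((x + p / 2) / 2, 0)" by (simp add: z v midpoint_def)
        have "\<bar>t\<bar> \<le> max 1 \<bar>x\<bar>" if "t \<in> {x..p/2}" for t using that p by auto
        then have bd: "(norm ((t, 0) - y))^2 \<le> (M + \<rho>)^2" if "t \<in> {x..p/2}" "y \<in> \<Omega>" for t y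
          using that by (intro D norm_axis) auto
        show ?thesis
          using True unfolding dominated_def z v
          by (intro exI[of _ "(p / 2, 0)"] exI[of _ "(M + \<rho>)^2"] conjI allI impI)
            (auto simp: m[unfolded z v] intro!: potential_axis_left bd)
      next
        case False
        define e where "e = (1 + p) / 2"
        have e: "e \<le> 1" "0 \<le> e" "(1 + p) / 2 \<le> e" using p by (auto simp: e_def)
        from False \<open>z \<notin> C\<close> have x: "e < x" by (auto simp: C_def z v e_def)
        have m: "midpoint z (e, 0) = ((x + e) / 2, 0)" by (simp add: z v midpoint_def)
        have "\<bar>t\<bar> \<le> max 1 \<bar>x\<bar>" if "t \<in> {e..x}" for t using that e by auto
        then have bd: "(norm ((t, 0) - y))^2 \<le> (M + \<rho>)^2" if "t \<in> {e..x}" "y \<in> \<Omega>" for t y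
          using that by (intro D norm_axis) auto
        have "potential K \<Omega> (b, 0) \<le> potential K \<Omega> (e, 0)"
          if "convex_kernel K \<Psi> w ((M + \<rho>)^2)" "e \<le> b" "b \<le> x" for K \<Psi> w b
          using that e bd by (intro potential_axis_right[OF that(1)]) auto
        then show ?thesis
          using x unfolding dominated_def z v
          by (intro exI[of _ "(e, 0)"] exI[of _ "(M + \<rho>)^2"] conjI allI impI)
            (auto simp: m[unfolded z v])
      qed
    qed
  next
    fix x z :: "real \<times> 'a" assume "x \<in> C" "z \<in> C" "x \<noteq> z"
    define a b where "a = fst x" and "b = fst z"
    have ab: "x = (a, 0)" "z = (b, 0)" "a \<in> {p / 2..(1 + p) / 2}" "b \<in> {p / 2..(1 + p) / 2}"
      using \<open>x \<in> C\<close> \<open>z \<in> C\<close> by (auto simp: C_def a_def b_def)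
    have bd: "(norm ((t, 0) - y))^2 \<le> (1 + \<rho>)^2" if "t \<in> {p / 2..(1 + p) / 2}" "y \<in> \<Omega>" for t y
      using that p by (intro D) (auto simp: norm_Pair)
    have "(potential K \<Omega> x + potential K \<Omega> z) / 2 \<le> potential K \<Omega> (midpoint x z)"
      if "convex_kernel K \<Psi> w ((1 + \<rho>)^2)" for K \<Psi> w
    proof -
      have "concave_on {p / 2..(1 + p) / 2} (\<lambda>x. potential K \<Omega> (x, 0))"
        by (rule potential_axis_concave[OF that bd]) auto
      from this[unfolded concave_on_iff, THEN conjunct2, rule_format, of a b "1/2" "1/2"] ab
      show ?thesis by (simp add: midpoint_def add_divide_distrib)
    qed
    then show "midpoint_concave \<Omega> x z" unfolding midpoint_concave_def
      by (intro exI[of _ "(1 + \<rho>)^2"]) auto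
  qed
qed

end

section \<open>Boundary flux of a triangle through a disc\<close>

definition cross :: "real \<times> real \<Rightarrow> real \<times> real \<Rightarrow> real" where
  "cross P Q = fst P * snd Q - snd P * fst Q"

text \<open>Twice the integral of \<open>y\<^sub>1 dy\<^sub>2\<close> along the segment from \<open>P\<close> to
  \<open>Q\<close>; summed over a closed polygon this is twice its area.\<close>

definition trapezoid :: "real \<times> real \<Rightarrow> real \<times> real \<Rightarrow> real" where
  "trapezoid P Q = (fst P + fst Q) * (snd Q - snd P)"

definition on_line :: "'b::real_vector \<Rightarrow> 'b \<Rightarrow> real \<Rightarrow> 'b" where
  "on_line P Q t = P + t *\<^sub>R (Q - P)"

lemma on_line_0 [simp]: "on_line P Q 0 = P" and on_line_1 [simp]: "on_line P Q 1 = Q"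
  by (auto simp: on_line_def)

lemma on_line_swap: "on_line Q P t = on_line P Q (1 - t)"
  by (simp add: on_line_def algebra_simps)

lemma norm_on_line_convex:
  fixes P Q :: "'b::real_normed_vector"
  assumes "0 \<le> l" "l \<le> 1"
  shows "norm (on_line P Q ((1 - l) * s + l * t)) \<le> (1 - l) * norm (on_line P Q s) + l * norm (on_line P Q t)"
proof -
  have "on_line P Q ((1 - l) * s + l * t) = (1 - l) *\<^sub>R on_line P Q s + l *\<^sub>R on_line P Q t"
    by (simp add: on_line_def algebra_simps)
  then show ?thesis
    using norm_triangle_ineq[of "(1 - l) *\<^sub>R on_line P Q s" "l *\<^sub>R on_line P Q t"] assms by simp
qed

lemma norm_on_line_less:
  fixes P Q :: "'b::real_normed_vector"
  assumes "norm (on_line P Q s) < r" "norm (on_line P Q t) \<le> r" "u \<in> closed_segment s t" "u \<noteq> t"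
  shows "norm (on_line P Q u) < r"
proof -
  obtain l where l: "0 \<le> l" "l \<le> 1" "u = (1 - l) * s + l * t"
    using assms(3) by (auto simp: closed_segment_def)
  then have "l \<noteq> 1" using assms(4) by auto
  have "norm (on_line P Q u) \<le> (1 - l) * norm (on_line P Q s) + l * norm (on_line P Q t)"
    unfolding l(3) by (rule norm_on_line_convex[OF l(1,2)])
  also have "\<dots> < (1 - l) * r + l * r"
    using l \<open>l \<noteq> 1\<close> assms by (intro add_less_le_mono mult_strict_left_mono mult_left_mono) auto
  finally show ?thesis by (simp add: algebra_simps)
qed

text \<open>By convexity of the norm, a line that starts inside a ball leaves it only once.\<close>

lemma exit_point:
  fixes P Q :: "'b::real_normed_vector"
  assumes inn: "norm (on_line P Q s) < r" and out: "r \<le> norm (on_line P Q t)"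
  obtains u where "u \<in> closed_segment s t" "norm (on_line P Q u) = r"
    "\<And>x. x \<in> closed_segment s u \<Longrightarrow> x \<noteq> u \<Longrightarrow> norm (on_line P Q x) < r"
    "\<And>x. x \<in> closed_segment u t \<Longrightarrow> r \<le> norm (on_line P Q x)"
proof -
  have cont: "continuous_on (closed_segment s t) (\<lambda>x. norm (on_line P Q x))"
    unfolding on_line_def by (intro continuous_intros)
  have "connected ((\<lambda>x. norm (on_line P Q x)) ` closed_segment s t)"
    by (intro connected_continuous_image cont) simp
  then obtain u where u: "u \<in> closed_segment s t" "norm (on_line P Q u) = r"
    using connectedD_interval[of "(\<lambda>x. norm (on_line P Q x)) ` closed_segment s t"
        "norm (on_line P Q s)" "norm (on_line P Q t)" r] inn out by auto
  show ?thesis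
  proof (rule that[OF u])
    show "norm (on_line P Q x) < r" if "x \<in> closed_segment s u" "x \<noteq> u" for x
      using norm_on_line_less[OF inn _ that] u by simp
    show "r \<le> norm (on_line P Q x)" if "x \<in> closed_segment u t" for x
    proof (rule ccontr)
      assume "\<not> r \<le> norm (on_line P Q x)"
      then have x: "norm (on_line P Q x) < r" by simp
      have "u \<in> closed_segment s x" using u(1) that
        by (auto simp: closed_segment_eq_real_ivl split: if_splits)
      then have "norm (on_line P Q u) < r"
      proof (cases "u = x")
        case False
        then show ?thesis using norm_on_line_less[OF inn less_imp_le[OF x] \<open>u \<in> closed_segment s x\<close>] by simp
      qed (use x in simp)
      with u show False by simp
    qed
  qed
qed

text \<open>Multiplied by \<open>snd Q - snd P\<close>, this is the integral of \<open>y\<^sub>1 dy\<^sub>2\<close> over the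
  part of the segment inside the disc of radius \<open>r\<close> about the origin. The four lemmas below evaluate
  it according to which end points lie in the disc.\<close>

definition clipped :: "real \<Rightarrow> real \<times> real \<Rightarrow> real \<times> real \<Rightarrow> real" where
  "clipped r P Q = (LINT t:{0..1}|lborel. fst (on_line P Q t) * indicator {t. norm (on_line P Q t) < r} t)"

lemma clipped_interval:
  assumes st: "0 \<le> s" "s \<le> t" "t \<le> 1"
    and inside: "\<And>x. s < x \<Longrightarrow> x < t \<Longrightarrow> norm (on_line P Q x) < r"
    and outside: "\<And>x. 0 \<le> x \<Longrightarrow> x < s \<Longrightarrow> r \<le> norm (on_line P Q x)"
      "\<And>x. t < x \<Longrightarrow> x \<le> 1 \<Longrightarrow> r \<le> norm (on_line P Q x)"
  shows "clipped r P Q * (snd Q - snd P) = trapezoid (on_line P Q s) (on_line P Q t) / 2"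
proof -
  have cont: "continuous_on A (on_line P Q)" for A
    unfolding on_line_def by (intro continuous_intros)
  have m: "(\<lambda>x. fst (on_line P Q x)) \<in> borel_measurable borel"
    by (intro borel_measurable_continuous_onI continuous_intros cont)
  have "open {x. norm (on_line P Q x) < r}"
    by (intro open_Collect_less continuous_intros cont)
  then have m2: "(\<lambda>x. indicator {x. norm (on_line P Q x) < r} x :: real) \<in> borel_measurable borel"
    by (intro borel_measurable_indicator) auto
  have "clipped r P Q = (LINT x|lborel. indicator {s..t} x *\<^sub>R fst (on_line P Q x))"
    unfolding clipped_def set_lebesgue_integral_def
  proof (rule integral_cong_AE)
    show "AE x in lborel. indicator {0..1} x *\<^sub>R (fst (on_line P Q x) * indicator {x. norm (on_line P Q x) < r} x)
        = indicator {s..t} x *\<^sub>R fst (on_line P Q x)"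
      using AE_lborel_singleton[of s] AE_lborel_singleton[of t]
    proof eventually_elim
      case (elim x)
      then consider "x < 0" | "0 \<le> x" "x < s" | "s < x" "x < t" | "t < x" "x \<le> 1" | "1 < x" by linarith
      then show ?case
        using inside[of x] outside[of x] st by cases (auto simp: indicator_def)
    qed
  qed (use m m2 in auto)
  also have "\<dots> = (fst P * t + (fst Q - fst P) * t\<^sup>2 / 2) - (fst P * s + (fst Q - fst P) * s\<^sup>2 / 2)"
    by (rule integral_FTC_atLeastAtMost[OF st(2)])
      (auto simp: on_line_def has_real_derivative_iff_has_vector_derivative[symmetric] field_simps
        intro!: derivative_eq_intros continuous_intros)
  finally have eq: "clipped r P Q = \<dots>" .
  show ?thesis
    unfolding eq by (simp add: trapezoid_def on_line_def power2_eq_square field_simps)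
qed

lemma clipped_in_in:
  assumes "norm P < r" "norm Q < r"
  shows "clipped r P Q * (snd Q - snd P) = trapezoid P Q / 2"
  using clipped_interval[of 0 1 P Q r] norm_on_line_less[of P Q 0 r 1] assms
  by (auto simp: closed_segment_eq_real_ivl)

lemma clipped_in_out:
  assumes "norm P < r" "r \<le> norm Q"
  obtains t where "0 \<le> t" "t \<le> 1" "norm (on_line P Q t) = r"
    "clipped r P Q * (snd Q - snd P) = trapezoid P (on_line P Q t) / 2"
proof -
  obtain u where "u \<in> closed_segment 0 1" "norm (on_line P Q u) = r"
    "\<And>x. x \<in> closed_segment 0 u \<Longrightarrow> x \<noteq> u \<Longrightarrow> norm (on_line P Q x) < r"
    "\<And>x. x \<in> closed_segment u 1 \<Longrightarrow> r \<le> norm (on_line P Q x)"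
    using exit_point[of P Q 0 r 1] assms by auto
  then show ?thesis
    using that[of u] clipped_interval[of 0 u P Q r]
    by (auto simp: closed_segment_eq_real_ivl)
qed

lemma clipped_out_in:
  assumes "r \<le> norm P" "norm Q < r"
  obtains t where "0 \<le> t" "t \<le> 1" "norm (on_line Q P t) = r"
    "clipped r P Q * (snd Q - snd P) = trapezoid (on_line Q P t) Q / 2"
proof -
  obtain u where "u \<in> closed_segment 1 0" "norm (on_line P Q u) = r"
    "\<And>x. x \<in> closed_segment 1 u \<Longrightarrow> x \<noteq> u \<Longrightarrow> norm (on_line P Q x) < r"
    "\<And>x. x \<in> closed_segment u 0 \<Longrightarrow> r \<le> norm (on_line P Q x)"
    using exit_point[of P Q 1 r 0] assms by auto
  then show ?thesis
    using that[of "1 - u"] clipped_interval[of u 1 P Q r]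
    by (auto simp: closed_segment_eq_real_ivl on_line_swap[of Q P] split: if_splits)
qed

lemma clipped_out_out:
  assumes "r \<le> norm P" "r \<le> norm Q"
  obtains "clipped r P Q * (snd Q - snd P) = 0"
  | s t where "0 \<le> s" "s \<le> t" "t \<le> 1" "norm (on_line P Q s) = r" "norm (on_line P Q t) = r"
    "clipped r P Q * (snd Q - snd P) = trapezoid (on_line P Q s) (on_line P Q t) / 2"
proof (cases "\<exists>m\<in>{0..1}. norm (on_line P Q m) < r")
  case True
  then obtain m where m: "0 \<le> m" "m \<le> 1" "norm (on_line P Q m) < r" by auto
  obtain t where t: "t \<in> closed_segment m 1" "norm (on_line P Q t) = r"
    "\<And>x. x \<in> closed_segment m t \<Longrightarrow> x \<noteq> t \<Longrightarrow> norm (on_line P Q x) < r"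
    "\<And>x. x \<in> closed_segment t 1 \<Longrightarrow> r \<le> norm (on_line P Q x)"
    using exit_point[of P Q m r 1] assms m by auto
  obtain s where s: "s \<in> closed_segment m 0" "norm (on_line P Q s) = r"
    "\<And>x. x \<in> closed_segment m s \<Longrightarrow> x \<noteq> s \<Longrightarrow> norm (on_line P Q x) < r"
    "\<And>x. x \<in> closed_segment s 0 \<Longrightarrow> r \<le> norm (on_line P Q x)"
    using exit_point[of P Q m r 0] assms m by auto
  have st: "0 \<le> s" "s \<le> m" "m \<le> t" "t \<le> 1"
    using s(1) t(1) m by (auto simp: closed_segment_eq_real_ivl split: if_splits)
  have "norm (on_line P Q x) < r" if "s < x" "x < t" for x
    using s(3)[of x] t(3)[of x] that st by (cases "x \<le> m") (auto simp: closed_segment_eq_real_ivl)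
  moreover have "r \<le> norm (on_line P Q x)" if "0 \<le> x" "x < s" for x
    using s(4)[of x] that st by (auto simp: closed_segment_eq_real_ivl)
  moreover have "r \<le> norm (on_line P Q x)" if "t < x" "x \<le> 1" for x
    using t(4)[of x] that st by (auto simp: closed_segment_eq_real_ivl)
  ultimately show ?thesis
    using clipped_interval[of s t P Q r] that(2)[of s t] st s(2) t(2) by auto
next
  case False
  then have "r \<le> norm (on_line P Q x)" if "0 \<le> x" "x \<le> 1" for x using that by (auto simp: not_less)
  then have "clipped r P Q * (snd Q - snd P) = trapezoid (on_line P Q 0) (on_line P Q 0) / 2"
    by (intro clipped_interval) auto
  then show ?thesis using that(1) by (simp add: trapezoid_def)
qed

text \<open>For a chord of a circle about the origin, \<open>trapezoid P Q\<close> is \<open>2 cross P Q\<close> times the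
  squared cosine of the angle between the first axis and the midpoint of the chord; so it lies between
  \<open>0\<close> and \<open>2 cross P Q\<close>. The proof avoids the angle: with \<open>X = trapezoid P
  Q\<close> and \<open>Y\<close> obtained by exchanging the coordinates, \<open>X - Y = 2 cross P Q\<close> and
  \<open>X Y \<le> 0\<close>.\<close>

lemma trapezoid_chord:
  assumes "norm P = norm Q"
  shows "min 0 (2 * cross P Q) \<le> trapezoid P Q"
proof -
  \<comment> \<open>The identity \<open>X Y = - (fst Q\<^sup>2 - fst P\<^sup>2)\<^sup>2\<close> uses that both points have the same
  norm.\<close>
  define X where "X = trapezoid P Q"
  define Y where "Y = (fst Q - fst P) * (snd P + snd Q)"
  have XY: "X - Y = 2 * cross P Q"
    by (simp add: X_def Y_def trapezoid_def cross_def algebra_simps)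
  have "(norm P)^2 = (norm Q)^2" using assms by simp
  then have sq: "(fst P)^2 + (snd P)^2 = (fst Q)^2 + (snd Q)^2"
    by (cases P; cases Q) (simp add: norm_Pair)
  have "X * Y = ((fst Q)^2 - (fst P)^2) * ((snd Q)^2 - (snd P)^2)"
    by (simp add: X_def Y_def trapezoid_def power2_eq_square algebra_simps)
  also have "(snd Q)\<^sup>2 - (snd P)\<^sup>2 = - ((fst Q)\<^sup>2 - (fst P)\<^sup>2)" using sq by simp
  also have "((fst Q)\<^sup>2 - (fst P)\<^sup>2) * - ((fst Q)\<^sup>2 - (fst P)\<^sup>2) = - ((fst Q)\<^sup>2 - (fst P)\<^sup>2)\<^sup>2"
    by (simp only: power2_eq_square[of "(fst Q)^2 - (fst P)^2"] mult_minus_right)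
  finally have "X * Y \<le> 0" by simp
  then have "0 \<le> X \<or> 0 \<le> Y" by (auto simp: mult_le_0_iff)
  then show ?thesis using XY unfolding X_def[symmetric] by auto
qed


text \<open>The origin has barycentric coordinates \<open>a, b, c\<close>, none above \<open>1/2\<close>, in the positively
  oriented triangle \<open>A B C\<close> of area \<open>J / 2\<close>, expressed by the areas of the three
  triangles that it spans with the sides.\<close>

locale medial_origin =
  fixes A B C :: "real \<times> real" and a b c J :: real
  assumes cross_AB: "cross A B = c * J" and cross_BC: "cross B C = a * J" and cross_CA: "cross C A = b * J"
    and bary: "a + b + c = 1" and nonneg: "0 \<le> a" "0 \<le> b" "0 \<le> c"
    and half: "a \<le> 1/2" "b \<le> 1/2" "c \<le> 1/2" and J: "0 \<le> J"
begin

lemma rotate: "medial_origin B C A b c a J"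
  using cross_AB cross_BC cross_CA bary nonneg half J by unfold_locales auto

lemma crosses: "cross B A = - c * J" "cross C B = - a * J" "cross A C = - b * J"
  using cross_AB cross_BC cross_CA by (simp_all add: cross_def algebra_simps)

lemma cross_corner:
  "cross (on_line B A p) (on_line B C q) = J * ((1 - p) * q * a + p * (1 - q) * c - p * q * b)"
proof -
  have "cross (on_line B A p) (on_line B C q) =
      (1 - p) * q * cross B C + p * (1 - q) * cross A B + p * q * cross A C"
    by (simp add: cross_def on_line_def algebra_simps)
  then show ?thesis by (simp add: cross_AB cross_BC crosses algebra_simps)
qed

lemma area: "trapezoid A B + trapezoid B C + trapezoid C A = J"
proof -
  have "trapezoid A B + trapezoid B C + trapezoid C A = cross A B + cross B C + cross C A"
    by (simp add: trapezoid_def cross_def algebra_simps)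
  also have "\<dots> = (a + b + c) * J" by (simp add: cross_AB cross_BC cross_CA algebra_simps)
  finally show ?thesis using bary by simp
qed

lemma corner_area:
  "trapezoid (on_line B A p) B + trapezoid B (on_line B C q) =
    p * q * J + trapezoid (on_line B A p) (on_line B C q)"
proof -
  have "trapezoid (on_line B A p) B + trapezoid B (on_line B C q) - trapezoid (on_line B A p) (on_line B C q) =
      p * q * (cross A B + cross B C + cross C A)"
    by (simp add: trapezoid_def cross_def on_line_def algebra_simps)
  also have "cross A B + cross B C + cross C A = J"
    using bary by (simp add: cross_AB cross_BC cross_CA flip: distrib_right)
  finally show ?thesis by (simp add: algebra_simps)
qed

text \<open>The path from \<open>P\<close> on \<open>BA\<close> over \<open>B\<close> to \<open>Q\<close> on
  \<open>BC\<close> is closed by the chord from \<open>Q\<close> to \<open>P\<close>. If the origin is on the same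
  side of the chord as \<open>B\<close>, the chord term is negative, at worst \<open>2 cross P Q\<close>; it is
  outweighed by \<open>p q J\<close>, twice the area of the corner, because \<open>b \<le> 1/2\<close>.\<close>

lemma corner_nonneg:
  assumes "0 \<le> p" "p \<le> 1" "0 \<le> q" "q \<le> 1"
    and "norm (on_line B A p) = norm (on_line B C q)"
  shows "0 \<le> trapezoid (on_line B A p) B + trapezoid B (on_line B C q)"
proof -
  have "0 \<le> p * q * (1 - 2 * b) + 2 * ((1 - p) * q * a + p * (1 - q) * c)"
    using assms nonneg half by simp
  also have "\<dots> = p * q + 2 * ((1 - p) * q * a + p * (1 - q) * c - p * q * b)"
    by (simp add: algebra_simps)
  finally have "0 \<le> J * (p * q + 2 * ((1 - p) * q * a + p * (1 - q) * c - p * q * b))"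
    using J by simp
  then have "0 \<le> p * q * J + 2 * cross (on_line B A p) (on_line B C q)"
    by (simp add: cross_corner algebra_simps)
  moreover have "0 \<le> p * q * J" using assms J by simp
  ultimately show ?thesis
    unfolding corner_area using trapezoid_chord[OF assms(5)] by linarith
qed

text \<open>The complementary case: the corner at \<open>B\<close> is outside the disc. The term \<open>(1 - p q) J\<close>,
  twice the area of the remaining quadrilateral, outweighs the chord term because \<open>a\<close> and
  \<open>c\<close> are at most \<open>1/2\<close>.\<close>

lemma opposite_corner_nonneg:
  assumes "0 \<le> p" "p \<le> 1" "0 \<le> q" "q \<le> 1"
    and "norm (on_line B A p) = norm (on_line B C q)"
  shows "0 \<le> trapezoid A (on_line B A p) + trapezoid (on_line B C q) C + trapezoid C A"
proof -
  let ?P = "on_line B A p" and ?Q = "on_line B C q"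
  have split: "trapezoid A ?P + trapezoid ?P B = trapezoid A B" "trapezoid B ?Q + trapezoid ?Q C = trapezoid B C"
    by (simp_all add: trapezoid_def on_line_def algebra_simps)
  have eq: "trapezoid A ?P + trapezoid ?Q C + trapezoid C A = (1 - p * q) * J + trapezoid ?Q ?P"
    using corner_area[of p q] split area by (simp add: trapezoid_def algebra_simps)
  \<comment> \<open>The right-hand side below, written as a sum of nonnegative terms.\<close>
  have "0 \<le> (1 - p) * (1 - q) + (1 - p) * q * (1 - 2 * a) + p * (1 - q) * (1 - 2 * c) + 2 * p * q * b"
    using assms nonneg half by simp
  also have "\<dots> = (1 - p * q) - 2 * ((1 - p) * q * a + p * (1 - q) * c - p * q * b)"
    by (simp add: algebra_simps)
  finally have "0 \<le> J * ((1 - p * q) - 2 * ((1 - p) * q * a + p * (1 - q) * c - p * q * b))"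
    using J by simp
  then have "0 \<le> (1 - p * q) * J + 2 * cross ?Q ?P"
    using cross_corner[of p q] by (simp add: cross_def algebra_simps)
  moreover have "0 \<le> (1 - p * q) * J" using assms J by (simp add: mult_le_one)
  ultimately show ?thesis
    unfolding eq using trapezoid_chord[OF assms(5)[symmetric]] by linarith
qed

lemma side_nonneg:
  assumes "r \<le> norm A" "r \<le> norm B"
  shows "0 \<le> clipped r A B * (snd B - snd A)"
  using assms
proof (cases rule: clipped_out_out)
  case 1
  then show ?thesis by linarith
next
  case (2 s t)
  have "cross (on_line A B s) (on_line A B t) = (t - s) * cross A B"
    by (simp add: cross_def on_line_def algebra_simps)
  then have "0 \<le> cross (on_line A B s) (on_line A B t)"
    using 2 nonneg J by (simp add: cross_AB)
  then show ?thesis using trapezoid_chord[of "on_line A B s" "on_line A B t"] 2 by simp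
qed

definition clipped_sum :: "real \<Rightarrow> real" where
  "clipped_sum r = clipped r A B * (snd B - snd A) + clipped r B C * (snd C - snd B) + clipped r C A * (snd A - snd C)"

lemma clipped_sum_one_inside:
  assumes "r \<le> norm A" "norm B < r" "r \<le> norm C"
  shows "0 \<le> clipped_sum r"
proof -
  interpret CAB: medial_origin C A B c a b J
    by (rule medial_origin.rotate[OF rotate])
  obtain p where p: "0 \<le> p" "p \<le> 1" "norm (on_line B A p) = r"
    "clipped r A B * (snd B - snd A) = trapezoid (on_line B A p) B / 2"
    using clipped_out_in assms by blast
  obtain q where q: "0 \<le> q" "q \<le> 1" "norm (on_line B C q) = r"
    "clipped r B C * (snd C - snd B) = trapezoid B (on_line B C q) / 2"
    using clipped_in_out assms by blast
  show ?thesis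
    using corner_nonneg[of p q] p q CAB.side_nonneg[of r] assms by (simp add: clipped_sum_def)
qed

lemma clipped_sum_one_outside:
  assumes "norm A < r" "r \<le> norm B" "norm C < r"
  shows "0 \<le> clipped_sum r"
proof -
  obtain p where p: "0 \<le> p" "p \<le> 1" "norm (on_line A B p) = r"
    "clipped r A B * (snd B - snd A) = trapezoid A (on_line A B p) / 2"
    using clipped_in_out assms by blast
  obtain q where q: "0 \<le> q" "q \<le> 1" "norm (on_line C B q) = r"
    "clipped r B C * (snd C - snd B) = trapezoid (on_line C B q) C / 2"
    using clipped_out_in assms by blast
  have "0 \<le> trapezoid A (on_line B A (1 - p)) + trapezoid (on_line B C (1 - q)) C + trapezoid C A"
    using p q by (intro opposite_corner_nonneg) (auto simp: on_line_swap[of A B] on_line_swap[of C B])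
  then show ?thesis
    using p q clipped_in_in[of C r A] assms
    by (simp add: clipped_sum_def on_line_swap[of A B] on_line_swap[of C B])
qed

lemma clipped_sum_nonneg: "0 \<le> clipped_sum r"
proof -
  interpret BCA: medial_origin B C A b c a J by (rule rotate)
  interpret CAB: medial_origin C A B c a b J by (rule BCA.rotate)
  have rot: "BCA.clipped_sum r = clipped_sum r" "CAB.clipped_sum r = clipped_sum r"
    by (simp_all add: clipped_sum_def BCA.clipped_sum_def CAB.clipped_sum_def)
  consider "r \<le> norm A" "r \<le> norm B" "r \<le> norm C" | "norm A < r" "norm B < r" "norm C < r"
    | "r \<le> norm A" "norm B < r" "r \<le> norm C" | "r \<le> norm B" "norm C < r" "r \<le> norm A"
    | "r \<le> norm C" "norm A < r" "r \<le> norm B" | "norm A < r" "r \<le> norm B" "norm C < r"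
    | "norm B < r" "r \<le> norm C" "norm A < r" | "norm C < r" "r \<le> norm A" "norm B < r"
    by linarith
  then show ?thesis
  proof cases
    case 1
    then show ?thesis
      unfolding clipped_sum_def
      using side_nonneg[of r] BCA.side_nonneg[of r] CAB.side_nonneg[of r] by simp
  next
    case 2
    then have "clipped_sum r = (trapezoid A B + trapezoid B C + trapezoid C A) / 2"
      by (simp add: clipped_sum_def clipped_in_in)
    then show ?thesis using J by (simp add: area)
  next
    case 3
    then show ?thesis by (rule clipped_sum_one_inside)
  next
    case 4
    then show ?thesis using BCA.clipped_sum_one_inside[of r] rot by simp
  next
    case 5
    then show ?thesis using CAB.clipped_sum_one_inside[of r] rot by simp
  next
    case 6
    then show ?thesis by (rule clipped_sum_one_outside)
  next
    case 7
    then show ?thesis using BCA.clipped_sum_one_outside[of r] rot by simp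
  next
    case 8
    then show ?thesis using CAB.clipped_sum_one_outside[of r] rot by simp
  qed
qed

end

section \<open>Affine coordinates in the plane\<close>

lemma lborel_eq_distr_line:
  fixes e :: "'a::euclidean_space"
  assumes e: "Basis = {e}"
  shows "distr lborel borel (\<lambda>t::real. t *\<^sub>R e) = (lborel :: 'a measure)"
proof (rule lborel_eqI[symmetric])
  have ee: "e \<bullet> e = 1" by (rule inner_same_Basis) (simp add: e)
  have m: "(\<lambda>t::real. t *\<^sub>R e) \<in> borel_measurable borel"
    by (intro borel_measurable_continuous_onI continuous_intros)
  fix l u :: 'a assume le: "\<And>b. b \<in> Basis \<Longrightarrow> l \<bullet> b \<le> u \<bullet> b"
  have "(\<lambda>t::real. t *\<^sub>R e) -` box l u = {l \<bullet> e<..<u \<bullet> e}"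
    by (auto simp: box_def e ee)
  then show "emeasure (distr lborel borel (\<lambda>t::real. t *\<^sub>R e)) (box l u) = ennreal (\<Prod>b\<in>Basis. (u - l) \<bullet> b)"
    using le[of e] m by (simp add: emeasure_distr e inner_diff_left)
qed simp

text \<open>One coordinate is substituted at a time, which requires a nonzero pivot \<open>v2\<close>.\<close>

lemma nn_integral_lborel_linear_real2_aux:
  fixes g :: "real \<times> real \<Rightarrow> ennreal"
  assumes [measurable]: "g \<in> borel_measurable borel"
    and d: "u1 * v2 - u2 * v1 \<noteq> 0" and v2: "v2 \<noteq> 0"
  shows "ennreal \<bar>u1 * v2 - u2 * v1\<bar> *
      (\<integral>\<^sup>+a. \<integral>\<^sup>+b. g (x0 + a * u1 + b * v1, y0 + a * u2 + b * v2) \<partial>lborel \<partial>lborel) =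
      (\<integral>\<^sup>+y. \<integral>\<^sup>+x. g (x, y) \<partial>lborel \<partial>lborel)"
proof -
  \<comment> \<open>The pivot that is left for the first coordinate after eliminating the second.\<close>
  define k where "k = (u1 * v2 - u2 * v1) / v2"
  have k: "k \<noteq> 0" using d v2 by (simp add: k_def)
  have [measurable]: "g \<in> borel_measurable (borel \<Otimes>\<^sub>M borel)" by (simp add: borel_prod)
  have "(\<integral>\<^sup>+y. \<integral>\<^sup>+x. g (x, y) \<partial>lborel \<partial>lborel) =
      (\<integral>\<^sup>+y. ennreal \<bar>k\<bar> * (\<integral>\<^sup>+a. g (x0 + (y - y0) * v1 / v2 + k * a, y) \<partial>lborel) \<partial>lborel)"
    by (intro nn_integral_cong nn_integral_real_affine k) measurable
  also have "\<dots> = ennreal \<bar>k\<bar> * (\<integral>\<^sup>+y. \<integral>\<^sup>+a. g (x0 + (y - y0) * v1 / v2 + k * a, y) \<partial>lborel \<partial>lborel)"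
    by (rule nn_integral_cmult) measurable
  also have "(\<integral>\<^sup>+y. \<integral>\<^sup>+a. g (x0 + (y - y0) * v1 / v2 + k * a, y) \<partial>lborel \<partial>lborel) =
      (\<integral>\<^sup>+a. \<integral>\<^sup>+y. g (x0 + (y - y0) * v1 / v2 + k * a, y) \<partial>lborel \<partial>lborel)"
    by (rule lborel_pair.Fubini') measurable
  also have "\<dots> = (\<integral>\<^sup>+a. ennreal \<bar>v2\<bar> *
      (\<integral>\<^sup>+b. g (x0 + ((y0 + a * u2 + v2 * b) - y0) * v1 / v2 + k * a, y0 + a * u2 + v2 * b) \<partial>lborel) \<partial>lborel)"
    by (intro nn_integral_cong nn_integral_real_affine v2) measurable
  also have "\<dots> = ennreal \<bar>v2\<bar> *
      (\<integral>\<^sup>+a. \<integral>\<^sup>+b. g (x0 + ((y0 + a * u2 + v2 * b) - y0) * v1 / v2 + k * a, y0 + a * u2 + v2 * b) \<partial>lborel \<partial>lborel)"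
    by (rule nn_integral_cmult) measurable
  also have "(\<integral>\<^sup>+a. \<integral>\<^sup>+b. g (x0 + ((y0 + a * u2 + v2 * b) - y0) * v1 / v2 + k * a, y0 + a * u2 + v2 * b) \<partial>lborel \<partial>lborel)
      = (\<integral>\<^sup>+a. \<integral>\<^sup>+b. g (x0 + a * u1 + b * v1, y0 + a * u2 + b * v2) \<partial>lborel \<partial>lborel)"
  proof (intro nn_integral_cong arg_cong[where f = g])
    fix a b
    have "((y0 + a * u2 + v2 * b) - y0) * v1 / v2 + k * a = a * u1 + b * v1"
      using v2 by (simp add: k_def field_simps)
    then show "(x0 + ((y0 + a * u2 + v2 * b) - y0) * v1 / v2 + k * a, y0 + a * u2 + v2 * b) =
        (x0 + a * u1 + b * v1, y0 + a * u2 + b * v2)" by (simp add: mult.commute)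
  qed
  finally have "(\<integral>\<^sup>+y. \<integral>\<^sup>+x. g (x, y) \<partial>lborel \<partial>lborel) = ennreal \<bar>k\<bar> * (ennreal \<bar>v2\<bar> *
      (\<integral>\<^sup>+a. \<integral>\<^sup>+b. g (x0 + a * u1 + b * v1, y0 + a * u2 + b * v2) \<partial>lborel \<partial>lborel))" .
  moreover have "ennreal \<bar>k\<bar> * ennreal \<bar>v2\<bar> = ennreal \<bar>u1 * v2 - u2 * v1\<bar>"
    using v2 by (simp add: k_def abs_divide flip: ennreal_mult')
  ultimately show ?thesis by (simp add: mult.assoc[symmetric])
qed

lemma nn_integral_lborel_linear_real2:
  fixes g :: "real \<times> real \<Rightarrow> ennreal"
  assumes [measurable]: "g \<in> borel_measurable borel" and d: "u1 * v2 - u2 * v1 \<noteq> 0"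
  shows "ennreal \<bar>u1 * v2 - u2 * v1\<bar> *
      (\<integral>\<^sup>+a. \<integral>\<^sup>+b. g (x0 + a * u1 + b * v1, y0 + a * u2 + b * v2) \<partial>lborel \<partial>lborel) =
      (\<integral>\<^sup>+x. \<integral>\<^sup>+y. g (x, y) \<partial>lborel \<partial>lborel)"
proof -
  have [measurable]: "g \<in> borel_measurable (borel \<Otimes>\<^sub>M borel)" by (simp add: borel_prod)
  have swap: "(\<integral>\<^sup>+x. \<integral>\<^sup>+y. g (x, y) \<partial>lborel \<partial>lborel) = (\<integral>\<^sup>+y. \<integral>\<^sup>+x. g (x, y) \<partial>lborel \<partial>lborel)"
    by (rule lborel_pair.Fubini') measurable
  show ?thesis
  proof (cases "v2 = 0")
    case False
    then show ?thesis unfolding swap by (rule nn_integral_lborel_linear_real2_aux[OF assms])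
  next
    case True
    have "(\<integral>\<^sup>+a. \<integral>\<^sup>+b. g (x0 + a * u1 + b * v1, y0 + a * u2 + b * v2) \<partial>lborel \<partial>lborel) =
        (\<integral>\<^sup>+b. \<integral>\<^sup>+a. g (x0 + a * u1 + b * v1, y0 + a * u2 + b * v2) \<partial>lborel \<partial>lborel)"
      by (rule lborel_pair.Fubini') measurable
    also have "\<dots> = (\<integral>\<^sup>+b. \<integral>\<^sup>+a. g (x0 + b * v1 + a * u1, y0 + b * v2 + a * u2) \<partial>lborel \<partial>lborel)"
      by (simp add: algebra_simps)
    finally show ?thesis
      unfolding swap
      using nn_integral_lborel_linear_real2_aux[of g v1 u2 v2 u1 x0 y0] True d
      by (simp add: abs_mult mult.commute)
  qed
qed

definition det2 :: "'a::real_inner \<Rightarrow> real \<times> 'a \<Rightarrow> real \<times> 'a \<Rightarrow> real" where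
  "det2 e U V = fst U * (snd V \<bullet> e) - (snd U \<bullet> e) * fst V"

text \<open>With a single basis vector \<open>e\<close> the product is a plane, and \<open>det2\<close> is the determinant
  in the coordinates \<open>fst\<close> and \<open>snd \<bullet> e\<close>. An affine image of the plane scales
  area by it.\<close>

lemma lborel_eq_affine_image:
  fixes e :: "'a::euclidean_space" and A U V :: "real \<times> 'a"
  assumes e: "Basis = {e}" and d: "det2 e U V \<noteq> 0"
  defines "\<Phi> \<equiv> \<lambda>p. A + fst p *\<^sub>R U + snd p *\<^sub>R V"
  shows "lborel = density (distr lborel borel \<Phi>) (\<lambda>_. ennreal \<bar>det2 e U V\<bar>)"
proof (rule measure_eqI)
  fix X assume "X \<in> sets (lborel :: (real \<times> 'a) measure)"
  then have X [measurable]: "X \<in> sets borel" by simp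
  have \<Phi> [measurable]: "\<Phi> \<in> borel_measurable borel"
    unfolding \<Phi>_def by (intro borel_measurable_continuous_onI continuous_intros)
  define g where "g p = (indicator X (fst p, snd p *\<^sub>R e) :: ennreal)" for p :: "real \<times> real"
  define h where "h a b = (fst A + a * fst U + b * fst V,
      snd A \<bullet> e + a * (snd U \<bullet> e) + b * (snd V \<bullet> e))" for a b
  have gm: "g \<in> borel_measurable borel"
  proof -
    have "(\<lambda>p::real \<times> real. (fst p, snd p *\<^sub>R e)) \<in> borel_measurable borel"
      by (intro borel_measurable_continuous_onI continuous_intros)
    from measurable_compose[OF this, of "indicator X" borel] show ?thesis
      unfolding g_def by simp
  qed
  have single: "snd y = (snd y \<bullet> e) *\<^sub>R e" for y :: "real \<times> 'a"
    using euclidean_representation[of "snd y", unfolded e] by (simp add: eq_commute)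
  have "(\<integral>\<^sup>+p. g (h (fst p) (snd p)) \<partial>lborel) = (\<integral>\<^sup>+p. indicator X (\<Phi> p) \<partial>lborel)"
  proof (rule nn_integral_cong)
    fix p :: "real \<times> real"
    have "\<Phi> p = (fst A + fst p * fst U + snd p * fst V,
        (snd A \<bullet> e + fst p * (snd U \<bullet> e) + snd p * (snd V \<bullet> e)) *\<^sub>R e)"
      using single[of "\<Phi> p"] by (auto simp: \<Phi>_def prod_eq_iff inner_add_left)
    then show "g (h (fst p) (snd p)) = indicator X (\<Phi> p)"
      by (simp add: g_def h_def)
  qed
  moreover have "(\<integral>\<^sup>+p. g (h (fst p) (snd p)) \<partial>lborel) =
      (\<integral>\<^sup>+a. \<integral>\<^sup>+b. g (h a b) \<partial>lborel \<partial>lborel)"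
  proof -
    have "(\<lambda>p. g (h (fst p) (snd p))) \<in> borel_measurable (lborel \<Otimes>\<^sub>M lborel)"
      unfolding lborel_prod measurable_lborel2 h_def
      by (rule measurable_compose[OF _ gm])
        (auto intro!: borel_measurable_continuous_onI continuous_intros)
    from lborel.nn_integral_fst[OF this] show ?thesis by (simp add: lborel_prod)
  qed
  ultimately have "emeasure (density (distr lborel borel \<Phi>) (\<lambda>_. ennreal \<bar>det2 e U V\<bar>)) X =
      ennreal \<bar>det2 e U V\<bar> * (\<integral>\<^sup>+a. \<integral>\<^sup>+b. g (h a b) \<partial>lborel \<partial>lborel)"
    using nn_integral_distr[of \<Phi> lborel borel "indicator X"]
    by (simp add: emeasure_density nn_integral_cmult)
  also have "\<dots> = (\<integral>\<^sup>+x. \<integral>\<^sup>+y. g (x, y) \<partial>lborel \<partial>lborel)"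
    unfolding det2_def h_def
    by (rule nn_integral_lborel_linear_real2[OF gm]) (use d in \<open>simp add: det2_def\<close>)
  also have "\<dots> = (\<integral>\<^sup>+x. \<integral>\<^sup>+y. indicator X (x, y) \<partial>lborel \<partial>lborel)"
  proof (rule nn_integral_cong)
    fix x :: real
    have m: "(\<lambda>y. indicator X (x, y)) \<in> borel_measurable borel"
      by (rule measurable_compose[of "\<lambda>y. (x, y)" borel borel])
        (auto intro!: borel_measurable_continuous_onI continuous_intros)
    have "(\<integral>\<^sup>+y. indicator X (x, y) \<partial>lborel) =
        (\<integral>\<^sup>+y. indicator X (x, y) \<partial>distr lborel borel (\<lambda>t::real. t *\<^sub>R e))"
      unfolding lborel_eq_distr_line[OF e] ..
    also have "\<dots> = (\<integral>\<^sup>+y. g (x, y) \<partial>lborel)"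
      unfolding g_def fst_conv snd_conv
      by (rule nn_integral_distr) (use m in \<open>auto intro!: borel_measurable_continuous_onI continuous_intros\<close>)
    finally show "(\<integral>\<^sup>+y. g (x, y) \<partial>lborel) = (\<integral>\<^sup>+y. indicator X (x, y) \<partial>lborel)" ..
  qed
  also have "\<dots> = (\<integral>\<^sup>+z. indicator X z \<partial>(lborel \<Otimes>\<^sub>M lborel))"
    by (rule lborel.nn_integral_fst) (simp add: lborel_prod)
  also have "\<dots> = emeasure lborel X" by (simp add: lborel_prod)
  finally show "emeasure lborel X = emeasure (density (distr lborel borel \<Phi>) (\<lambda>_. ennreal \<bar>det2 e U V\<bar>)) X" ..
qed simp

section \<open>Integrals over the sides of a triangle\<close>

definition unit_simplex2 :: "(real \<times> real) set" where
  "unit_simplex2 = {(a, b). 0 \<le> a \<and> 0 \<le> b \<and> a + b \<le> 1}"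

lemma compact_unit_simplex2: "compact unit_simplex2"
proof -
  have "closed unit_simplex2"
    unfolding unit_simplex2_def case_prod_beta
    by (intro closed_Collect_conj closed_Collect_le continuous_intros)
  moreover have "unit_simplex2 \<subseteq> cbox (0, 0) (1, 1)"
    by (auto simp: unit_simplex2_def cbox_Pair_eq)
  ultimately show ?thesis
    using bounded_subset[OF bounded_cbox] by (auto simp: compact_eq_bounded_closed)
qed

lemma integral_unit_simplex2_deriv_snd:
  fixes G g :: "real \<times> real \<Rightarrow> real"
  assumes cont: "continuous_on UNIV g"
    and deriv: "\<And>a b. ((\<lambda>b. G (a, b)) has_real_derivative g (a, b)) (at b)"
  shows "(LINT p:unit_simplex2|lborel. g p) = (LINT a:{0..1}|lborel. G (a, 1 - a) - G (a, 0))"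
proof -
  define F where "F p = indicator unit_simplex2 p * g p" for p
  have int: "integrable lborel F"
    unfolding F_def using borel_integrable_compact[OF compact_unit_simplex2 continuous_on_subset[OF cont]] by simp
  have "(LINT b|lborel. F (a, b)) = indicator {0..1} a * (G (a, 1 - a) - G (a, 0))" for a
  proof (cases "a \<in> {0..1}")
    case True
    have "(LINT b|lborel. F (a, b)) = (LINT b|lborel. indicator {0..1 - a} b *\<^sub>R g (a, b))"
      using True by (intro Bochner_Integration.integral_cong) (auto simp: F_def unit_simplex2_def indicator_def)
    also have "\<dots> = G (a, 1 - a) - G (a, 0)"
    proof (rule integral_FTC_atLeastAtMost)
      show "((\<lambda>b. G (a, b)) has_vector_derivative g (a, b)) (at b within {0..1 - a})" for b
        unfolding has_real_derivative_iff_has_vector_derivative[symmetric]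
        by (rule has_field_derivative_at_within[OF deriv])
      show "continuous_on {0..1 - a} (\<lambda>b. g (a, b))"
        by (rule continuous_on_compose2[OF cont]) (auto intro!: continuous_intros)
    qed (use True in simp)
    finally show ?thesis using True by simp
  next
    case False
    then have "F (a, b) = 0" for b by (auto simp: F_def unit_simplex2_def indicator_def)
    then show ?thesis using False by simp
  qed
  moreover have "(LINT p|lborel. F p) = (LINT a|lborel. LINT b|lborel. F (a, b))"
    using lborel_pair.integral_fst'[of F] int by (simp add: lborel_prod)
  ultimately show "(LINT p:unit_simplex2|lborel. g p) = (LINT a:{0..1}|lborel. G (a, 1 - a) - G (a, 0))"
    by (simp add: set_lebesgue_integral_def F_def)
qed

lemma integral_unit_simplex2_deriv_fst:
  fixes G g :: "real \<times> real \<Rightarrow> real"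
  assumes cont: "continuous_on UNIV g"
    and deriv: "\<And>a b. ((\<lambda>a. G (a, b)) has_real_derivative g (a, b)) (at a)"
  shows "(LINT p:unit_simplex2|lborel. g p) = (LINT b:{0..1}|lborel. G (1 - b, b) - G (0, b))"
proof -
  define G' where "G' p = G (snd p, fst p)" for p
  define g' where "g' p = g (snd p, fst p)" for p
  have g': "continuous_on UNIV g'"
    unfolding g'_def by (rule continuous_on_compose2[OF cont]) (auto intro!: continuous_intros)
  have "set_integrable lborel unit_simplex2 g"
    unfolding set_integrable_def
    by (rule borel_integrable_compact[OF compact_unit_simplex2 continuous_on_subset[OF cont]]) simp
  then have int: "integrable (lborel \<Otimes>\<^sub>M lborel) (\<lambda>p. indicator unit_simplex2 p * g p)"
    by (simp add: set_integrable_def lborel_prod)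
  have "(LINT p:unit_simplex2|lborel. g p) =
      (LINT p|lborel. (\<lambda>(x, y). indicator unit_simplex2 (y, x) * g (y, x)) p)"
    using lborel_pair.integral_product_swap[of "\<lambda>p. indicator unit_simplex2 p * g p"] int
    by (simp add: set_lebesgue_integral_def lborel_prod)
  also have "(\<lambda>(x, y). indicator unit_simplex2 (y, x) * g (y, x)) = (\<lambda>p. indicator unit_simplex2 p * g' p)"
    by (auto simp: unit_simplex2_def indicator_def add.commute g'_def fun_eq_iff)
  also have "(LINT p|lborel. indicator unit_simplex2 p * g' p) = (LINT p:unit_simplex2|lborel. g' p)"
    by (simp add: set_lebesgue_integral_def)
  also have "\<dots> = (LINT a:{0..1}|lborel. G' (a, 1 - a) - G' (a, 0))"
    by (rule integral_unit_simplex2_deriv_snd[OF g']) (simp add: G'_def g'_def deriv)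
  finally show ?thesis by (simp add: G'_def)
qed

definition side :: "(real \<Rightarrow> real) \<Rightarrow> 'b::euclidean_space \<Rightarrow> 'b \<Rightarrow> 'b \<Rightarrow> real" where
  "side K P Q x = (LINT t:{0..1}|lborel. K ((norm (x - on_line P Q t))^2))"

lemma set_integral_reflect_01:
  "(LINT t:{0..1::real}|lborel. f (1 - t)) = (LINT t:{0..1}|lborel. (f t :: real))"
proof -
  have "(LINT t|lborel. indicator {0..1} t *\<^sub>R f t) =
      (LINT t|lborel. indicator {0..1} (1 - t) *\<^sub>R f (1 - t))"
    using lborel_integral_real_affine[of "-1" "\<lambda>t. indicator {0..1} t *\<^sub>R f t" 1] by simp
  also have "(\<lambda>t. indicator {0..1} (1 - t) *\<^sub>R f (1 - t)) = (\<lambda>t::real. indicator {0..1} t *\<^sub>R f (1 - t))"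
    by (auto simp: indicator_def)
  finally show ?thesis by (simp add: set_lebesgue_integral_def)
qed

lemma side_swap: "side K P Q = side K Q P"
  unfolding side_def on_line_swap[of Q P] by (rule ext) (rule set_integral_reflect_01[symmetric])

lemma continuous_on_line [continuous_intros]:
  "continuous_on S f \<Longrightarrow> continuous_on S (\<lambda>t. on_line P (Q :: 'b::real_normed_vector) (f t))"
  unfolding on_line_def by (intro continuous_intros)

context convex_kernel begin

lemma side_integrable: "set_integrable lborel {0..1} (\<lambda>t. K ((norm (x - on_line P (Q::'b::euclidean_space) t))^2))"
  by (intro set_integrable_continuous_bounded continuous_intros) auto

lemma side_deriv:
  fixes P Q x v :: "'b::euclidean_space"
  shows "((\<lambda>t. side K P Q (x + t *\<^sub>R v)) has_real_derivative
    (LINT s:{0..1}|lborel. 2 * ((on_line P Q s - (x + t *\<^sub>R v)) \<bullet> v) *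
      \<Psi> ((norm (x + t *\<^sub>R v - on_line P Q s))^2))) (at t)"
  unfolding side_def by (rule kernel_integral_deriv) (auto intro!: continuous_intros)

text \<open>The inequality is reversed because the kernel decreases.\<close>

lemma side_mono:
  fixes P Q P' Q' x :: "'b::euclidean_space"
  assumes "\<And>t. t \<in> {0..1} \<Longrightarrow> norm (x - on_line P' Q' t) \<le> norm (x - on_line P Q t)"
    and "\<And>t. t \<in> {0..1} \<Longrightarrow> (norm (x - on_line P Q t))^2 \<le> D"
  shows "side K P Q x \<le> side K P' Q' x"
  unfolding side_def
  by (intro set_integral_mono side_integrable K_antimono) (use assms in \<open>auto intro: power_mono\<close>)

lemma side_split:
  fixes P Q x :: "'b::euclidean_space"
  assumes \<theta>: "0 \<le> \<theta>" "\<theta> \<le> 1"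
  shows "side K P Q x = \<theta> * side K P (on_line P Q \<theta>) x + (1 - \<theta>) * side K (on_line P Q \<theta>) Q x"
proof -
  define h where "h t = K ((norm (x - on_line P Q t))^2)" for t
  have h: "continuous_on S h" for S unfolding h_def by (intro continuous_intros) auto
  have hm: "h \<in> borel_measurable borel" by (intro borel_measurable_continuous_onI h)
  have hi: "integrable lborel (\<lambda>s. indicator {a..b} s * h s)" for a b :: real
    using borel_integrable_compact[of "{a..b}" h] h by simp
  have scale: "(LINT s|lborel. indicator {a..b} s * h s) = (b - a) * (LINT t:{0..1}|lborel. h (a + (b - a) * t))"
    if ab: "a \<le> b" for a b :: real
  proof (cases "a = b")
    case True
    have "(LINT s|lborel. indicator {a..b} s * h s) = 0"
    proof (rule integral_eq_zero_AE)
      show "AE s in lborel. indicator {a..b} s * h s = 0"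
        using AE_lborel_singleton[of a] by eventually_elim (use True in \<open>auto simp: indicator_def\<close>)
    qed
    then show ?thesis using True by simp
  next
    case False
    then have "a < b" using ab by simp
    have "a + (b - a) * t \<in> {a..b} \<longleftrightarrow> t \<in> {0..1}" for t
    proof -
      have "a + s \<in> {a..b} \<longleftrightarrow> 0 \<le> s \<and> s \<le> (b - a) * 1" for s by auto
      then have "a + (b - a) * t \<in> {a..b} \<longleftrightarrow> 0 \<le> (b - a) * t \<and> (b - a) * t \<le> (b - a) * 1" .
      also have "\<dots> \<longleftrightarrow> t \<in> {0..1}"
        using \<open>a < b\<close> mult_le_cancel_left_pos[of "b - a" t 1] by (simp add: zero_le_mult_iff)
      finally show ?thesis .
    qed
    then have "(\<lambda>t. indicator {a..b} (a + (b - a) * t) * h (a + (b - a) * t)) =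
        (\<lambda>t. indicator {0..1} t * h (a + (b - a) * t))"
      unfolding indicator_def by simp
    then show ?thesis
      using lborel_integral_real_affine[of "b - a" "\<lambda>s. indicator {a..b} s * h s" a] \<open>a < b\<close>
      by (simp add: set_lebesgue_integral_def)
  qed
  have "(LINT s|lborel. indicator {0..1} s * h s) =
      (LINT s|lborel. indicator {0..\<theta>} s * h s + indicator {\<theta>..1} s * h s)"
  proof (rule integral_cong_AE)
    show "AE s in lborel. indicator {0..1} s * h s = indicator {0..\<theta>} s * h s + indicator {\<theta>..1} s * h s"
      using AE_lborel_singleton[of \<theta>] by eventually_elim (use \<theta> in \<open>auto simp: indicator_def\<close>)
  qed (use hm in auto)
  also have "\<dots> = (LINT s|lborel. indicator {0..\<theta>} s * h s) + (LINT s|lborel. indicator {\<theta>..1} s * h s)"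
    by (rule Bochner_Integration.integral_add[OF hi hi])
  also have "\<dots> = \<theta> * (LINT t:{0..1}|lborel. h (\<theta> * t)) + (1 - \<theta>) * (LINT t:{0..1}|lborel. h (\<theta> + (1 - \<theta>) * t))"
    using scale[of 0 \<theta>] scale[of \<theta> 1] \<theta> by simp
  also have "(\<lambda>t. h (\<theta> * t)) = (\<lambda>t. K ((norm (x - on_line P (on_line P Q \<theta>) t))^2))"
  proof -
    have "on_line P (on_line P Q \<theta>) t = on_line P Q (\<theta> * t)" for t
      by (simp add: on_line_def mult.commute)
    then show ?thesis by (simp add: h_def)
  qed
  also have "(\<lambda>t. h (\<theta> + (1 - \<theta>) * t)) = (\<lambda>t. K ((norm (x - on_line (on_line P Q \<theta>) Q t))^2))"
  proof -
    have "on_line (on_line P Q \<theta>) Q t = on_line P Q (\<theta> + (1 - \<theta>) * t)" for t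
      by (simp add: on_line_def algebra_simps)
    then show ?thesis by (simp add: h_def)
  qed
  finally show ?thesis by (simp add: side_def h_def[abs_def] set_lebesgue_integral_def)
qed

end

section \<open>Potentials of triangles\<close>

lemma det2_linear:
  "det2 e (U + U') V = det2 e U V + det2 e U' V" "det2 e U (V + V') = det2 e U V + det2 e U V'"
  "det2 e (U - U') V = det2 e U V - det2 e U' V" "det2 e U (V - V') = det2 e U V - det2 e U V'"
  "det2 e (r *\<^sub>R U) V = r * det2 e U V" "det2 e U (r *\<^sub>R V) = r * det2 e U V" "det2 e U U = 0"
  "det2 e (- U) V = - det2 e U V" "det2 e U (- V) = - det2 e U V"
  by (simp_all add: det2_def inner_add_left inner_diff_left algebra_simps)

lemma det2_swap: "det2 e V U = - det2 e U V"
  by (simp add: det2_def)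

locale line_basis =
  fixes e :: "'a::euclidean_space"
  assumes Basis: "Basis = {e}"
begin

lemma e_norm: "e \<bullet> e = 1"
  by (rule inner_same_Basis) (simp add: Basis)

lemma single: "(u \<bullet> e) *\<^sub>R e = u"
  using euclidean_representation[of u, unfolded Basis] by simp

lemma inner_single: "u \<bullet> v = (u \<bullet> e) * (v \<bullet> e)"
proof -
  have "u \<bullet> v = ((u \<bullet> e) *\<^sub>R e) \<bullet> ((v \<bullet> e) *\<^sub>R e)" by (simp only: single)
  then show ?thesis by (simp add: e_norm)
qed

lemma plane_eqI: "fst y = fst z \<Longrightarrow> snd y \<bullet> e = snd z \<bullet> e \<Longrightarrow> y = z"
  by (metis prod_eq_iff single)

lemma inner_plane: "y \<bullet> z = fst y * fst z + (snd y \<bullet> e) * (snd z \<bullet> e)"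
  by (simp add: inner_prod_def inner_single[of "snd y" "snd z"])

lemma lagrange_identity: "(y \<bullet> v)^2 + (det2 e v y)^2 = (v \<bullet> v) * (y \<bullet> y)"
  unfolding inner_plane det2_def by algebra

lemma collinear_if_det2_eq_0:
  assumes "det2 e (B - A) (C - A) = 0"
  shows "collinear {A, B, C}"
proof -
  have "((C - A) \<bullet> (B - A))^2 = (norm (C - A) * norm (B - A))^2"
    using lagrange_identity[of "C - A" "B - A"] assms
    by (simp add: power_mult_distrib power2_norm_eq_inner)
  then have "\<bar>(C - A) \<bullet> (B - A)\<bar> = norm (C - A) * norm (B - A)"
    by (metis abs_mult abs_norm_cancel real_sqrt_abs)
  then have "collinear {0, C - A, B - A}" by (simp only: norm_cauchy_schwarz_equal)
  then show ?thesis using collinear_3[of C A B] by (simp add: insert_commute)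
qed

end

locale oriented_triangle = line_basis e for e :: "'a::euclidean_space" +
  fixes A B C :: "real \<times> 'a"
  assumes pos: "0 < det2 e (B - A) (C - A)"
begin

definition area2 :: real where "area2 = det2 e (B - A) (C - A)"

definition T :: "(real \<times> 'a) set" where "T = convex hull {A, B, C}"

definition chart :: "real \<times> real \<Rightarrow> real \<times> 'a" where
  "chart p = A + fst p *\<^sub>R (B - A) + snd p *\<^sub>R (C - A)"

lemma area2_pos: "0 < area2" using pos by (simp add: area2_def)

lemma det2_edges: "det2 e (B - A) (C - A) = area2" "det2 e (C - A) (B - A) = - area2"
  using det2_swap[of e "C - A" "B - A"] by (simp_all add: area2_def)

lemma rotate: "oriented_triangle e B C A"
proof
  have "det2 e (C - B) (A - B) = det2 e (B - A) (C - A)"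
    using det2_swap[of e A B] det2_swap[of e A C] det2_swap[of e B C]
    by (simp add: det2_linear)
  then show "0 < det2 e (C - B) (A - B)" using pos by simp
qed

lemma det2_zero_imp: "det2 e v (B - A) = 0 \<Longrightarrow> det2 e v (C - A) = 0 \<Longrightarrow> v = 0"
proof -
  assume 1: "det2 e v (B - A) = 0" and 2: "det2 e v (C - A) = 0"
  have "fst v * area2 = fst (B - A) * det2 e v (C - A) - fst (C - A) * det2 e v (B - A)"
    "(snd v \<bullet> e) * area2 = (snd (B - A) \<bullet> e) * det2 e v (C - A) - (snd (C - A) \<bullet> e) * det2 e v (B - A)"
    unfolding area2_def det2_def by (simp_all add: algebra_simps del: fst_diff snd_diff)
  then have "fst v = 0" "snd v \<bullet> e = 0" using 1 2 area2_pos by auto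
  then show "v = 0" by (intro plane_eqI) auto
qed

lemma chart_surj: obtains p where "z = chart p"
proof
  define p where "p = (det2 e (z - A) (C - A) / area2, det2 e (B - A) (z - A) / area2)"
  have "z - chart p = 0"
  proof (rule det2_zero_imp)
    define U V W where "U = B - A" and "V = C - A" and "W = z - A"
    have eq: "z - chart p = W - fst p *\<^sub>R U - snd p *\<^sub>R V"
      unfolding chart_def U_def V_def W_def by (simp only: diff_diff_eq add.assoc)
    have p: "fst p * area2 = det2 e W V" "snd p * area2 = det2 e U W"
      using area2_pos by (auto simp: p_def U_def V_def W_def)
    have d: "det2 e U V = area2" "det2 e V U = - area2"
      using det2_edges by (simp_all add: U_def V_def)
    show "det2 e (z - chart p) (B - A) = 0" "det2 e (z - chart p) (C - A) = 0"
      unfolding eq U_def[symmetric] V_def[symmetric]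
      using p det2_swap[of e W U] by (simp_all add: det2_linear d)
  qed
  then show "z = chart p" by simp
qed

lemma chart_inj: "chart p = chart q \<Longrightarrow> p = q"
proof -
  assume "chart p = chart q"
  then have z: "(fst p - fst q) *\<^sub>R (B - A) + (snd p - snd q) *\<^sub>R (C - A) = 0"
    by (simp add: chart_def algebra_simps)
  have "det2 e ((fst p - fst q) *\<^sub>R (B - A) + (snd p - snd q) *\<^sub>R (C - A)) (C - A) = (fst p - fst q) * area2"
    "det2 e ((fst p - fst q) *\<^sub>R (B - A) + (snd p - snd q) *\<^sub>R (C - A)) (B - A) = - ((snd p - snd q) * area2)"
    unfolding det2_linear(1,5,7) det2_edges by (simp_all add: det2_linear(7))
  then show "p = q" unfolding z using area2_pos by (simp add: det2_def prod_eq_iff)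
qed

lemma mem_T: "chart p \<in> T \<longleftrightarrow> p \<in> unit_simplex2"
proof -
  have "T = chart ` unit_simplex2"
  proof (intro equalityI subsetI)
    fix z assume "z \<in> T"
    then obtain u v where "z = A + u *\<^sub>R (B - A) + v *\<^sub>R (C - A)" "0 \<le> u" "0 \<le> v" "u + v \<le> 1"
      unfolding T_def convex_hull_3_alt by blast
    then show "z \<in> chart ` unit_simplex2"
      by (intro image_eqI[of _ _ "(u, v)"]) (simp_all add: chart_def unit_simplex2_def)
  next
    fix z assume "z \<in> chart ` unit_simplex2"
    then obtain u v where "z = chart (u, v)" "0 \<le> u" "0 \<le> v" "u + v \<le> 1"
      by (auto simp: unit_simplex2_def)
    then show "z \<in> T"
      unfolding T_def convex_hull_3_alt chart_def fst_conv snd_conv by blast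
  qed
  then show ?thesis by (metis chart_inj imageE imageI)
qed

lemma T_compact: "compact T"
  unfolding T_def by (rule finite_imp_compact_convex_hull) simp

lemma T_bounded: "bounded T" and T_borel: "T \<in> sets borel"
  using T_compact by (auto intro: compact_imp_bounded borel_compact)

lemma chart_cont [continuous_intros]: "continuous_on S f \<Longrightarrow> continuous_on S (\<lambda>x. chart (f x))"
  unfolding chart_def by (intro continuous_intros)

lemma T_integral:
  fixes f :: "real \<times> 'a \<Rightarrow> real"
  assumes "continuous_on UNIV f"
  shows "(LINT y:T|lborel. f y) = area2 * (LINT p:unit_simplex2|lborel. f (chart p))"
proof -
  have f: "f \<in> borel_measurable borel" using assms by (rule borel_measurable_continuous_onI)
  then have m: "(\<lambda>y. indicator T y * f y) \<in> borel_measurable borel"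
    using T_borel by (auto intro!: borel_measurable_times borel_measurable_indicator)
  have chart: "chart \<in> borel_measurable borel"
    using chart_cont[OF continuous_on_id, of UNIV] by (intro borel_measurable_continuous_onI) simp
  have d: "lborel = density (distr lborel borel chart) (\<lambda>_. ennreal area2)"
    using lborel_eq_affine_image[OF Basis, of "B - A" "C - A" A] pos
    by (simp add: area2_def chart_def[abs_def])
  have "(LINT y:T|lborel. f y) = (LINT y|lborel. indicator T y * f y)"
    by (simp add: set_lebesgue_integral_def)
  also have "\<dots> = (LINT y|density (distr lborel borel chart) (\<lambda>_. ennreal area2). indicator T y * f y)"
    using d by simp
  also have "\<dots> = (LINT y|distr lborel borel chart. area2 *\<^sub>R (indicator T y * f y))"
    by (rule integral_density) (use m area2_pos in auto)
  also have "\<dots> = (LINT p|lborel. area2 *\<^sub>R (indicator T (chart p) * f (chart p)))"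
    by (rule integral_distr) (use chart m in auto)
  also have "\<dots> = area2 * (LINT p|lborel. indicator T (chart p) * f (chart p))" by simp
  also have "(\<lambda>p. indicator T (chart p) * f (chart p)) = (\<lambda>p. indicator unit_simplex2 p *\<^sub>R f (chart p))"
    by (simp add: indicator_def mem_T fun_eq_iff)
  finally show ?thesis by (simp add: set_lebesgue_integral_def)
qed

lemma chart_edges:
  "chart (0, t) = on_line A C t" "chart (t, 0) = on_line A B t" "chart (1 - t, t) = on_line B C t"
  "chart (t, 1 - t) = on_line C B t"
  by (simp_all add: chart_def on_line_def algebra_simps)

text \<open>The derivative of the potential in the direction \<open>\<beta>A A + \<beta>B B + \<beta>C C\<close>, the
  \<open>\<beta>\<close> adding up to \<open>0\<close>. The coefficients replace the normal components of this
  vector: the derivative of a barycentric coordinate is proportional to the inner product with the normal of the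
  opposite side.\<close>

definition edge_sum :: "(real \<Rightarrow> real) \<Rightarrow> real \<Rightarrow> real \<Rightarrow> real \<Rightarrow> real \<times> 'a \<Rightarrow> real" where
  "edge_sum K \<beta>A \<beta>B \<beta>C x = area2 * (\<beta>A * side K B C x + \<beta>B * side K C A x + \<beta>C * side K A B x)"

text \<open>The divergence theorem on the triangle. In affine coordinates it is the fundamental theorem of calculus applied
  in each of the two coordinates of the standard simplex.\<close>

lemma potential_T_deriv:
  assumes "convex_kernel K \<Psi> w D" and \<beta>: "\<beta>A + \<beta>B + \<beta>C = 0"
  defines "v \<equiv> \<beta>A *\<^sub>R A + \<beta>B *\<^sub>R B + \<beta>C *\<^sub>R C"
  shows "((\<lambda>t. potential K T (x + t *\<^sub>R v)) has_real_derivative edge_sum K \<beta>A \<beta>B \<beta>C (x + t *\<^sub>R v)) (at t)"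
proof -
  interpret convex_kernel K \<Psi> w D by fact
  define z where "z = x + t *\<^sub>R v"
  have v: "v = \<beta>B *\<^sub>R (B - A) + \<beta>C *\<^sub>R (C - A)"
  proof -
    have \<beta>A: "\<beta>A = - \<beta>B - \<beta>C" using \<beta> by simp
    show ?thesis unfolding v_def \<beta>A by (simp add: algebra_simps)
  qed
  define G where "G p = K ((norm (z - chart p))^2)" for p
  define g where "g U p = 2 * ((z - chart p) \<bullet> U) * \<Psi> ((norm (z - chart p))^2)" for U p
  have g_cont: "continuous_on UNIV (g U)" for U
    unfolding g_def by (intro continuous_intros) auto
  have fst_deriv: "((\<lambda>a. G (a, b)) has_real_derivative g (B - A) (a, b)) (at a)" for a b
    using kernel_deriv[of "A + b *\<^sub>R (C - A)" "B - A" z a]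
    by (simp add: G_def g_def chart_def norm_minus_commute add.commute add.left_commute)
  have snd_deriv: "((\<lambda>b. G (a, b)) has_real_derivative g (C - A) (a, b)) (at b)" for a b
    using kernel_deriv[of "A + a *\<^sub>R (B - A)" "C - A" z b]
    by (simp add: G_def g_def chart_def norm_minus_commute)
  have G_int: "set_integrable lborel {0..1} (\<lambda>s. G (f s))" if "continuous_on UNIV f" for f :: "real \<Rightarrow> real \<times> real"
    unfolding G_def using that
    by (intro set_integrable_continuous_bounded continuous_intros) auto
  have G_side: "(LINT s:{0..1}|lborel. G (0, s)) = side K C A z" "(LINT s:{0..1}|lborel. G (s, 0)) = side K A B z"
    "(LINT s:{0..1}|lborel. G (1 - s, s)) = side K B C z"
    unfolding side_swap[of K C A] by (simp_all add: G_def chart_edges side_def)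
  have G_side': "(LINT s:{0..1}|lborel. G (s, 1 - s)) = side K B C z"
    unfolding side_swap[of K B C] by (simp add: G_def chart_edges side_def)
  have gB: "(LINT p:unit_simplex2|lborel. g (B - A) p) = side K B C z - side K C A z"
    using integral_unit_simplex2_deriv_fst[OF g_cont fst_deriv]
    by (subst (asm) set_integral_diff) (auto intro!: G_int continuous_intros simp: G_side)
  have gC: "(LINT p:unit_simplex2|lborel. g (C - A) p) = side K B C z - side K A B z"
    using integral_unit_simplex2_deriv_snd(1)[OF g_cont snd_deriv]
    by (subst (asm) set_integral_diff) (auto intro!: G_int continuous_intros simp: G_side G_side')
  have gint: "set_integrable lborel unit_simplex2 (g U)" for U
    unfolding set_integrable_def
    by (rule borel_integrable_compact[OF compact_unit_simplex2 continuous_on_subset[OF g_cont]]) simp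
  have "(LINT y:T|lborel. 2 * ((y - z) \<bullet> v) * \<Psi> ((norm (z - y))^2)) =
      area2 * (LINT p:unit_simplex2|lborel. 2 * ((chart p - z) \<bullet> v) * \<Psi> ((norm (z - chart p))^2))"
    by (rule T_integral) (intro continuous_intros; simp)
  also have "(\<lambda>p. 2 * ((chart p - z) \<bullet> v) * \<Psi> ((norm (z - chart p))^2)) =
      (\<lambda>p. - \<beta>B * g (B - A) p - \<beta>C * g (C - A) p)"
    by (simp add: g_def v inner_add_right inner_diff_left algebra_simps)
  also have "(LINT p:unit_simplex2|lborel. - \<beta>B * g (B - A) p - \<beta>C * g (C - A) p) =
      - \<beta>B * (side K B C z - side K C A z) - \<beta>C * (side K B C z - side K A B z)"
    using set_integral_diff(2)[OF set_integrable_mult_right[OF gint[of "B - A"], of "- \<beta>B"]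
        set_integrable_mult_right[OF gint[of "C - A"], of \<beta>C]]
    by (simp only: set_integral_mult_right gB gC)
  also have "\<dots> = \<beta>A * side K B C z + \<beta>B * side K C A z + \<beta>C * side K A B z"
  proof -
    have \<beta>A: "\<beta>A = - \<beta>B - \<beta>C" using \<beta> by simp
    show ?thesis unfolding \<beta>A by (simp add: algebra_simps)
  qed
  finally show ?thesis
    using potential_deriv[OF T_bounded T_borel, of x v t] by (simp add: edge_sum_def z_def)
qed


lemma T_measure_pos: "0 < measure lborel T"
proof -
  have "measure lborel T = (LINT y:T|lborel. 1)"
    using T_borel by (simp add: set_lebesgue_integral_def)
  also have "\<dots> = area2 * (LINT p:unit_simplex2|lborel. 1)"
    by (rule T_integral) simp
  also have "(LINT p:unit_simplex2|lborel. (1::real)) = (LINT a:{0..1}|lborel. (1 - a) - 0)"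
    using integral_unit_simplex2_deriv_snd(1)[of "\<lambda>_. 1" snd] by simp
  also have "\<dots> = (LINT a|lborel. indicator {0..1} a *\<^sub>R (1 - a))"
    by (simp add: set_lebesgue_integral_def)
  also have "\<dots> = (1 - 1\<^sup>2 / 2) - (0 - 0\<^sup>2 / 2 :: real)"
    by (rule integral_FTC_atLeastAtMost)
      (auto simp: has_real_derivative_iff_has_vector_derivative[symmetric]
        intro!: derivative_eq_intros continuous_intros)
  finally show ?thesis using area2_pos by simp
qed

lemma T_solid: "0 < \<alpha> \<Longrightarrow> \<alpha> < real DIM(real \<times> 'a) + 2 \<Longrightarrow> solid T \<alpha>"
  by unfold_locales (use T_bounded T_borel T_measure_pos in auto)

lemma on_line_T: "P \<in> T \<Longrightarrow> Q \<in> T \<Longrightarrow> t \<in> {0..1} \<Longrightarrow> on_line P Q t \<in> T"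
proof -
  assume "P \<in> T" "Q \<in> T" "t \<in> {0..1}"
  moreover have "on_line P Q t = (1 - t) *\<^sub>R P + t *\<^sub>R Q" by (simp add: on_line_def algebra_simps)
  moreover have "convex T" by (simp add: T_def)
  ultimately show "on_line P Q t \<in> T" by (auto intro!: convexD)
qed

lemma vertices_T: "A \<in> T" "B \<in> T" "C \<in> T"
  by (auto simp: T_def intro: hull_inc)

text \<open>Coordinates in which \<open>v\<close> points along the first axis. Leaving \<open>v\<close> unnormalised scales
  all lengths by \<open>norm v\<close>, which is harmless since the radius of the disc is scaled too.\<close>

definition frame :: "real \<times> 'a \<Rightarrow> real \<times> 'a \<Rightarrow> real \<times> real" where
  "frame v y = (y \<bullet> v, det2 e v y)"

lemma frame_norm: "norm (frame v y) = norm v * norm y"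
proof (rule power2_eq_imp_eq)
  have "(norm (frame v y))^2 = (y \<bullet> v)^2 + (det2 e v y)^2"
    by (simp add: frame_def norm_Pair)
  also have "\<dots> = (v \<bullet> v) * (y \<bullet> y)" by (rule lagrange_identity)
  finally show "(norm (frame v y))^2 = (norm v * norm y)^2"
    by (simp add: power_mult_distrib power2_norm_eq_inner)
qed auto

lemma frame_cross: "cross (frame v P) (frame v Q) = (norm v)^2 * det2 e P Q"
  unfolding power2_norm_eq_inner cross_def frame_def fst_conv snd_conv inner_plane det2_def by algebra

lemma frame_on_line: "frame v (on_line P Q t - z) = on_line (frame v (P - z)) (frame v (Q - z)) t"
  by (simp add: frame_def on_line_def det2_linear inner_add_left inner_diff_left algebra_simps)

lemma frame_snd_diff: "snd (frame v (Q - z)) - snd (frame v (P - z)) = det2 e v (Q - P)"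
  by (simp add: frame_def det2_linear)

text \<open>The contribution of one side, up to its coefficient, to the derivative of \<open>edge_sum\<close> along
  \<open>v\<close> at \<open>z\<close>, for the step \<open>\<Psi> q = 1(q < s)\<close>.\<close>

definition edge_flux :: "real \<Rightarrow> real \<times> 'a \<Rightarrow> real \<times> 'a \<Rightarrow> real \<times> 'a \<Rightarrow> real \<times> 'a \<Rightarrow> real" where
  "edge_flux s v z P Q = (LINT t:{0..1}|lborel. 2 * ((on_line P Q t - z) \<bullet> v) *
    indicator {t. (norm (z - on_line P Q t))^2 < s} t)"

lemma edge_flux_clipped:
  assumes "v \<noteq> 0"
  shows "edge_flux s v z P Q = 2 * clipped (norm v * sqrt s) (frame v (P - z)) (frame v (Q - z))"
proof -
  have "(norm y)^2 < s \<longleftrightarrow> norm y < sqrt s" for y :: "real \<times> 'a"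
    using real_sqrt_less_iff[of "(norm y)^2" s] by simp
  then have "(norm (z - on_line P Q t))^2 < s \<longleftrightarrow>
      norm (on_line (frame v (P - z)) (frame v (Q - z)) t) < norm v * sqrt s" for t
    using assms by (simp add: frame_on_line[symmetric] frame_norm norm_minus_commute)
  moreover have "(on_line P Q t - z) \<bullet> v = fst (on_line (frame v (P - z)) (frame v (Q - z)) t)" for t
    unfolding frame_on_line[symmetric] by (simp add: frame_def)
  ultimately show ?thesis
    by (simp add: edge_flux_def clipped_def mult.assoc)
qed

text \<open>In the frame of \<open>v\<close> the increments of the second coordinate along the sides are proportional to the
  coefficients \<open>\<beta>\<close>, so the sum is a negative multiple of the clipped boundary integral.\<close>

lemma edge_flux_sum_nonpos:
  assumes bary: "a + b + c = 1" and half: "a \<le> 1/2" "b \<le> 1/2" "c \<le> 1/2"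
    and \<beta>: "\<beta>A + \<beta>B + \<beta>C = 0"
  defines "z \<equiv> a *\<^sub>R A + b *\<^sub>R B + c *\<^sub>R C" and "v \<equiv> \<beta>A *\<^sub>R A + \<beta>B *\<^sub>R B + \<beta>C *\<^sub>R C"
  shows "\<beta>A * edge_flux s v z B C + \<beta>B * edge_flux s v z C A + \<beta>C * edge_flux s v z A B \<le> 0"
proof (cases "v = 0")
  case True
  then show ?thesis by (simp add: edge_flux_def)
next
  case False
  have a: "a = 1 - b - c" using bary by simp
  have \<beta>A: "\<beta>A = - \<beta>B - \<beta>C" using \<beta> by simp
  define U V where "U = B - A" and "V = C - A"
  have UV: "det2 e U V = area2" "det2 e V U = - area2" using det2_edges by (simp_all add: U_def V_def)
  have Az: "A - z = - (b *\<^sub>R U) - c *\<^sub>R V" "B - z = (1 - b) *\<^sub>R U - c *\<^sub>R V" "C - z = (1 - c) *\<^sub>R V - b *\<^sub>R U"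
    unfolding z_def a U_def V_def by (simp_all add: algebra_simps)
  have v: "v = \<beta>B *\<^sub>R U + \<beta>C *\<^sub>R V"
    unfolding v_def \<beta>A U_def V_def by (simp add: algebra_simps)
  have edges: "B - A = U" "C - B = V - U" "A - C = - V" by (simp_all add: U_def V_def)
  define J where "J = (norm v)^2 * area2"
  interpret m: medial_origin "frame v (A - z)" "frame v (B - z)" "frame v (C - z)" a b c J
  proof
    show "cross (frame v (A - z)) (frame v (B - z)) = c * J"
      "cross (frame v (B - z)) (frame v (C - z)) = a * J"
      "cross (frame v (C - z)) (frame v (A - z)) = b * J"
      unfolding frame_cross Az J_def det2_linear UV a by (simp_all add: algebra_simps)
    show "0 \<le> J" using area2_pos by (simp add: J_def)
  qed (use bary half in auto)
  define r where "r = norm v * sqrt s"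
  have "0 \<le> m.clipped_sum r" by (rule m.clipped_sum_nonneg)
  also have "m.clipped_sum r = - (area2 / 2) *
      (\<beta>A * edge_flux s v z B C + \<beta>B * edge_flux s v z C A + \<beta>C * edge_flux s v z A B)"
    unfolding m.clipped_sum_def frame_snd_diff edges v[THEN arg_cong, of "\<lambda>v. det2 e v _"] det2_linear UV
      edge_flux_clipped[OF False] r_def \<beta>A
    by (simp add: algebra_simps)
  finally show ?thesis
    using area2_pos by (simp add: mult_le_0_iff zero_le_mult_iff)
qed

lemma edge_sum_deriv_nonpos:
  assumes K: "convex_kernel K \<Psi> w D"
    and bary: "a + b + c = 1" and half: "a \<le> 1/2" "b \<le> 1/2" "c \<le> 1/2"
    and \<beta>: "\<beta>A + \<beta>B + \<beta>C = 0"
  defines "z \<equiv> a *\<^sub>R A + b *\<^sub>R B + c *\<^sub>R C" and "v \<equiv> \<beta>A *\<^sub>R A + \<beta>B *\<^sub>R B + \<beta>C *\<^sub>R C"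
  assumes D: "\<And>y. y \<in> T \<Longrightarrow> (norm (z - y))^2 \<le> D"
  shows "\<exists>d\<le>0. \<forall>x t. x + t *\<^sub>R v = z \<longrightarrow>
    ((\<lambda>t. edge_sum K \<beta>A \<beta>B \<beta>C (x + t *\<^sub>R v)) has_real_derivative d) (at t)"
proof -
  interpret convex_kernel K \<Psi> w D by (rule K)
  define d where "d P Q = (LINT t:{0..1}|lborel. 2 * ((on_line P Q t - z) \<bullet> v) *
      \<Psi> ((norm (z - on_line P Q t))^2))" for P Q
  have cake: "d P Q = \<Psi> D * edge_flux (D + 1) v z P Q + (LINT s:{0..D}|lborel. w s * edge_flux s v z P Q)"
    and cake_int: "set_integrable lborel {0..D} (\<lambda>s. w s * edge_flux s v z P Q)"
    if "P \<in> {A, B, C}" "Q \<in> {A, B, C}" for P Q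
  proof -
    have q: "0 \<le> (norm (z - on_line P Q t))^2 \<and> (norm (z - on_line P Q t))^2 \<le> D" if "t \<in> {0..1}" for t
    proof -
      have "on_line P Q t \<in> T" using \<open>P \<in> {A, B, C}\<close> \<open>Q \<in> {A, B, C}\<close> \<open>t \<in> {0..1}\<close> vertices_T
        by (intro on_line_T) auto
      then show ?thesis using D by simp
    qed
    have int: "set_integrable lborel {0..1} (\<lambda>t. 2 * ((on_line P Q t - z) \<bullet> v))"
      by (intro set_integrable_continuous_bounded continuous_intros) auto
    have m: "(\<lambda>t. (norm (z - on_line P Q t))^2) \<in> borel_measurable borel"
      by (intro borel_measurable_continuous_onI continuous_intros)
    note c = layer_cake[OF int m q, folded edge_flux_def d_def]
    have "(LINT t:{0..1}|lborel. 2 * ((on_line P Q t - z) \<bullet> v)) = edge_flux (D + 1) v z P Q"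
    proof -
      have "(norm (z - on_line P Q t))^2 < D + 1" if "t \<in> {0..1}" for t
        using q[OF that] by linarith
      then show ?thesis
        unfolding edge_flux_def
        by (intro set_lebesgue_integral_cong) (simp_all add: indicator_def)
    qed
    with c(1) show "d P Q = \<Psi> D * edge_flux (D + 1) v z P Q + (LINT s:{0..D}|lborel. w s * edge_flux s v z P Q)"
      by simp
    show "set_integrable lborel {0..D} (\<lambda>s. w s * edge_flux s v z P Q)" by (rule c(2))
  qed
  define S where "S s = \<beta>A * edge_flux s v z B C + \<beta>B * edge_flux s v z C A + \<beta>C * edge_flux s v z A B" for s
  have S: "S s \<le> 0" for s
    unfolding S_def z_def v_def by (rule edge_flux_sum_nonpos[OF bary half \<beta>])
  define I where "I P Q = (LINT s:{0..D}|lborel. w s * edge_flux s v z P Q)" for P Q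
  have "\<beta>A * I B C + \<beta>B * I C A + \<beta>C * I A B = (LINT s:{0..D}|lborel. w s * S s)"
  proof -
    have "(LINT s:{0..D}|lborel. w s * S s) = (LINT s:{0..D}|lborel.
        \<beta>A * (w s * edge_flux s v z B C) + \<beta>B * (w s * edge_flux s v z C A) + \<beta>C * (w s * edge_flux s v z A B))"
      by (simp add: S_def algebra_simps)
    also have "\<dots> = \<beta>A * I B C + \<beta>B * I C A + \<beta>C * I A B"
      unfolding I_def using cake_int by (simp add: set_integral_add)
    finally show ?thesis ..
  qed
  moreover have "(LINT s:{0..D}|lborel. w s * S s) \<le> 0"
  proof -
    have "0 \<le> (LINT s:{0..D}|lborel. w s * - S s)"
      unfolding set_lebesgue_integral_def
      by (intro Bochner_Integration.integral_nonneg) (use S w_nonneg in \<open>auto simp: indicator_def intro!: mult_nonneg_nonpos\<close>)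
    then show ?thesis by (simp add: set_lebesgue_integral_def)
  qed
  moreover have "\<Psi> D * S (D + 1) \<le> 0" using \<Psi>_D S by (rule mult_nonneg_nonpos)
  moreover have "\<beta>A * d B C + \<beta>B * d C A + \<beta>C * d A B =
      \<Psi> D * S (D + 1) + (\<beta>A * I B C + \<beta>B * I C A + \<beta>C * I A B)"
    by (simp add: cake S_def I_def algebra_simps)
  ultimately have "\<beta>A * d B C + \<beta>B * d C A + \<beta>C * d A B \<le> 0" by linarith
  moreover have "((\<lambda>t. edge_sum K \<beta>A \<beta>B \<beta>C (x + t *\<^sub>R v)) has_real_derivative
      area2 * (\<beta>A * d B C + \<beta>B * d C A + \<beta>C * d A B)) (at t)" if "x + t *\<^sub>R v = z" for x t
    unfolding edge_sum_def d_def that[symmetric]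
    by (intro DERIV_cmult DERIV_add side_deriv)
  ultimately show ?thesis
    using area2_pos by (intro exI[of _ "area2 * (\<beta>A * d B C + \<beta>B * d C A + \<beta>C * d A B)"])
      (auto intro: mult_nonneg_nonpos)
qed

end

section \<open>Non-obtuse triangles\<close>

context oriented_triangle begin

lemma barycentric: obtains a b c where "a + b + c = 1" "z = a *\<^sub>R A + b *\<^sub>R B + c *\<^sub>R C"
proof -
  obtain p where "z = chart p" by (rule chart_surj)
  then show ?thesis
    by (intro that[of "1 - fst p - snd p" "fst p" "snd p"]) (simp_all add: chart_def algebra_simps)
qed

lemma B_neq_C: "B \<noteq> C"
  using pos by (auto simp: det2_linear(7))

text \<open>The foot of the altitude from \<open>A\<close> lies on the side \<open>BC\<close> because the angles at
  \<open>B\<close> and \<open>C\<close> are not obtuse.\<close>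

lemma foot_of_altitude:
  assumes "0 \<le> (A - B) \<bullet> (C - B)" "0 \<le> (A - C) \<bullet> (B - C)"
  obtains b c where "0 \<le> b" "0 \<le> c" "b + c = 1" "(b *\<^sub>R B + c *\<^sub>R C - A) \<bullet> (C - B) = 0"
proof -
  define L where "L = (C - B) \<bullet> (C - B)"
  have L: "0 < L" using B_neq_C by (simp add: L_def)
  define c where "c = ((A - B) \<bullet> (C - B)) / L"
  have c: "0 \<le> c" using assms L by (simp add: c_def)
  have "L - (A - B) \<bullet> (C - B) = (A - C) \<bullet> (B - C)"
    by (simp add: L_def inner_diff_left inner_diff_right inner_commute)
  then have b: "0 \<le> 1 - c" using assms L by (simp add: c_def)
  have cL: "c * L = (A - B) \<bullet> (C - B)" using L by (simp add: c_def)
  have eq: "(1 - c) *\<^sub>R B + c *\<^sub>R C - A = c *\<^sub>R (C - B) - (A - B)"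
    by (simp add: algebra_simps)
  have perp: "((1 - c) *\<^sub>R B + c *\<^sub>R C - A) \<bullet> (C - B) = 0"
    unfolding eq inner_diff_left[of "c *\<^sub>R (C - B)" "A - B"] inner_scaleR_left L_def[symmetric] cL by simp
  show ?thesis by (rule that[OF b c _ perp]) simp
qed

text \<open>The points of \<open>PA\<close> and \<open>PF\<close> with the same parameter lie on a common parallel to the
  altitude \<open>FA\<close>. The second is at height \<open>0\<close>, the first at height \<open>t \<le> 1 \<le>
  2 a\<close>, and \<open>z\<close> at height \<open>a\<close>, in units of the altitude.\<close>

lemma closer_to_upper_side:
  fixes F :: "real \<times> 'a"
  assumes P: "(P - F) \<bullet> (F - A) = 0" and z: "(z - F) \<bullet> (F - A) = - a * ((F - A) \<bullet> (F - A))"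
    and a: "1/2 \<le> a" and t: "t \<in> {0..1}"
  shows "norm (z - on_line P A t) \<le> norm (z - on_line P F t)"
proof (rule power2_le_imp_le)
  define v where "v = F - A"
  define y where "y = z - on_line P F t"
  have step: "z - on_line P A t = y + t *\<^sub>R v"
    by (simp add: on_line_def v_def y_def algebra_simps)
  have yv: "y \<bullet> v = - a * (v \<bullet> v)"
  proof -
    have eq: "y = (z - F) - (1 - t) *\<^sub>R (P - F)" by (simp add: y_def on_line_def algebra_simps)
    show ?thesis
      unfolding eq v_def inner_diff_left[of "z - F" "(1 - t) *\<^sub>R (P - F)"] inner_scaleR_left P z by simp
  qed
  have "(norm (y + t *\<^sub>R v))^2 = (norm y)^2 + 2 * t * (y \<bullet> v) + t * t * (v \<bullet> v)"
    unfolding power2_norm_eq_inner inner_add_left inner_add_right inner_scaleR_left inner_scaleR_right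
      inner_commute[of v y] by (simp only: ring_distribs mult_2 mult.assoc add.assoc)
  also have "\<dots> = (norm y)^2 - t * (2 * a - t) * (v \<bullet> v)"
    unfolding yv by (simp add: algebra_simps)
  finally have "(norm (z - on_line P A t))^2 = (norm (z - on_line P F t))^2 - t * (2 * a - t) * (v \<bullet> v)"
    unfolding step y_def .
  moreover have "0 \<le> t * (2 * a - t) * (v \<bullet> v)" using a t by simp
  ultimately show "(norm (z - on_line P A t))^2 \<le> (norm (z - on_line P F t))^2" by simp
qed simp

text \<open>In the direction of the altitude \<open>AF\<close> the side \<open>BC\<close> counts negatively with weight
  \<open>1\<close>, and \<open>AB\<close> and \<open>CA\<close> count positively with weights that are exactly the
  proportions in which \<open>F\<close> divides \<open>BC\<close>. So each of \<open>AB\<close> and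
  \<open>CA\<close> is compared with the part of \<open>BC\<close> below it.\<close>

lemma edge_sum_altitude_nonneg:
  assumes K: "convex_kernel K \<Psi> w D"
    and foot: "0 \<le> b'" "0 \<le> c'" "b' + c' = 1" "(b' *\<^sub>R B + c' *\<^sub>R C - A) \<bullet> (C - B) = 0"
    and bary: "a + b + c = 1" and a: "1/2 \<le> a" and z: "z = a *\<^sub>R A + b *\<^sub>R B + c *\<^sub>R C"
    and D: "\<And>y. y \<in> T \<Longrightarrow> (norm (z - y))^2 \<le> D"
  shows "0 \<le> edge_sum K (-1) b' c' z"
proof -
  interpret convex_kernel K \<Psi> w D by (rule K)
  define F where "F = on_line B C c'"
  have F: "F = b' *\<^sub>R B + c' *\<^sub>R C"
  proof -
    have b': "b' = 1 - c'" using foot by simp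
    show ?thesis unfolding F_def on_line_def b' by (simp add: algebra_simps)
  qed
  have F_T: "F \<in> T" unfolding F_def using foot by (intro on_line_T vertices_T) auto
  have perp: "(C - B) \<bullet> (F - A) = 0" using foot(4) by (simp add: F inner_commute)
  have "B - F = (- c') *\<^sub>R (C - B)" "C - F = (1 - c') *\<^sub>R (C - B)"
    by (simp_all add: F_def on_line_def algebra_simps)
  then have BF: "(B - F) \<bullet> (F - A) = 0" and CF: "(C - F) \<bullet> (F - A) = 0"
    using perp by simp_all
  have zF: "(z - F) \<bullet> (F - A) = - a * ((F - A) \<bullet> (F - A))"
  proof -
    have a_eq: "a = 1 - b - c" using bary by simp
    have eq: "z - F = (- a) *\<^sub>R (F - A) + b *\<^sub>R (B - F) + c *\<^sub>R (C - F)"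
      unfolding z a_eq by (simp add: algebra_simps)
    show ?thesis unfolding eq inner_add_left inner_scaleR_left BF CF by simp
  qed
  have "side K B F z \<le> side K B A z" "side K C F z \<le> side K C A z"
    by (intro side_mono closer_to_upper_side[OF BF zF a] closer_to_upper_side[OF CF zF a] D
        on_line_T vertices_T F_T; assumption)+
  then have "c' * side K B F z + b' * side K F C z \<le> c' * side K A B z + b' * side K C A z"
    using foot by (intro add_mono mult_left_mono) (auto simp: side_swap[of K A B] side_swap[of K F C])
  moreover have "side K B C z = c' * side K B F z + b' * side K F C z"
    using side_split[of c' B C z] foot by (simp add: F_def)
  ultimately show ?thesis
    using area2_pos by (simp add: edge_sum_def)
qed

lemma dist_T_bounded:
  obtains D where "0 \<le> D" "\<And>t y. t \<in> {0..1} \<Longrightarrow> y \<in> T \<Longrightarrow> (norm (x + t *\<^sub>R v - y))^2 \<le> D"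
proof -
  obtain \<rho> where \<rho>: "\<And>y. y \<in> T \<Longrightarrow> norm y \<le> \<rho>"
    using T_bounded unfolding bounded_iff by blast
  show ?thesis
  proof (rule that[of "(norm x + norm v + \<rho>)^2"])
    fix t y assume t: "t \<in> {0..1::real}" and y: "y \<in> T"
    have "norm (x + t *\<^sub>R v - y) \<le> norm x + norm (t *\<^sub>R v) + norm y"
      using norm_triangle_ineq4[of "x + t *\<^sub>R v" y] norm_triangle_ineq[of x "t *\<^sub>R v"] by linarith
    also have "norm (t *\<^sub>R v) \<le> norm v" using t by (simp add: mult_left_le_one_le)
    finally show "(norm (x + t *\<^sub>R v - y))^2 \<le> (norm x + norm v + \<rho>)^2"
      using \<rho>[OF y] by (intro power_mono) auto
  qed simp
qed

text \<open>Moving along the altitude until the coordinate at \<open>A\<close> has dropped to \<open>1/2\<close>, the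
  potential grows all the way.\<close>

lemma dominated_near_A:
  assumes acute: "0 \<le> (A - B) \<bullet> (C - B)" "0 \<le> (A - C) \<bullet> (B - C)"
    and bary: "a + b + c = 1" and a: "1/2 < a" and z: "z = a *\<^sub>R A + b *\<^sub>R B + c *\<^sub>R C"
  shows "dominated T z"
proof -
  obtain b' c' where foot: "0 \<le> b'" "0 \<le> c'" "b' + c' = 1" "(b' *\<^sub>R B + c' *\<^sub>R C - A) \<bullet> (C - B) = 0"
    using foot_of_altitude[OF acute] by blast
  define u where "u = (-1) *\<^sub>R A + b' *\<^sub>R B + c' *\<^sub>R C"
  \<comment> \<open>The coordinate at \<open>A\<close> decreases at unit speed along \<open>u\<close>.\<close>
  define h where "h = a - 1/2"
  have h: "0 < h" using a by (simp add: h_def)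
  obtain D where D: "0 \<le> D" "\<And>t y. t \<in> {0..1} \<Longrightarrow> y \<in> T \<Longrightarrow> (norm (z + t *\<^sub>R (h *\<^sub>R u) - y))^2 \<le> D"
    using dist_T_bounded by blast
  have D': "(norm (z + t *\<^sub>R u - y))^2 \<le> D" if "0 \<le> t" "t \<le> h" "y \<in> T" for t y
    using D(2)[of "t / h" y] that h by simp
  have mono: "potential K T (z + s *\<^sub>R u) \<le> potential K T (z + h *\<^sub>R u)"
    if K: "convex_kernel K \<Psi> w D" and s: "0 \<le> s" "s \<le> h" for K \<Psi> w s
  proof (rule DERIV_nonneg_imp_nondecreasing[OF \<open>s \<le> h\<close>])
    fix t assume t: "s \<le> t" "t \<le> h"
    have "((\<lambda>t. potential K T (z + t *\<^sub>R u)) has_real_derivative edge_sum K (-1) b' c' (z + t *\<^sub>R u)) (at t)"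
      unfolding u_def using foot by (intro potential_T_deriv[OF K]) simp
    moreover have "0 \<le> edge_sum K (-1) b' c' (z + t *\<^sub>R u)"
    proof (rule edge_sum_altitude_nonneg[OF K foot])
      show "(a - t) + (b + t * b') + (c + t * c') = 1"
      proof -
        have "(a - t) + (b + t * b') + (c + t * c') = (a + b + c) - t + t * (b' + c')"
          by (simp add: algebra_simps)
        then show ?thesis unfolding bary foot(3) by simp
      qed
      show "1/2 \<le> a - t" using t by (simp add: h_def)
      show "z + t *\<^sub>R u = (a - t) *\<^sub>R A + (b + t * b') *\<^sub>R B + (c + t * c') *\<^sub>R C"
        by (simp add: z u_def algebra_simps)
      show "(norm (z + t *\<^sub>R u - y))^2 \<le> D" if "y \<in> T" for y
        using D'[of t y] t s that by simp
    qed
    ultimately show "\<exists>y. ((\<lambda>t. potential K T (z + t *\<^sub>R u)) has_real_derivative y) (at t) \<and> 0 \<le> y"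
      by blast
  qed
  have "u \<noteq> 0"
  proof
    assume "u = 0"
    define U V where "U = B - A" and "V = C - A"
    have UV: "det2 e U V = area2" "det2 e V U = - area2" using det2_edges by (simp_all add: U_def V_def)
    have c': "c' = 1 - b'" using foot by simp
    have u: "u = V - b' *\<^sub>R (V - U)"
      unfolding u_def c' U_def V_def by (simp add: algebra_simps)
    have "det2 e u (V - U) = area2"
      unfolding u by (simp add: det2_linear UV)
    with \<open>u = 0\<close> area2_pos show False by (simp add: det2_def)
  qed
  moreover have "midpoint z (z + h *\<^sub>R u) = z + (h / 2) *\<^sub>R u"
    by (simp add: midpoint_def algebra_simps flip: scaleR_add_left)
  ultimately show ?thesis
    unfolding dominated_def
    using h mono[of _ _ _ 0] mono[of _ _ _ "h / 2"] D(1)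
    by (intro exI[of _ "z + h *\<^sub>R u"] exI[of _ D]) auto
qed

lemma potential_midpoint_medial:
  assumes x: "a + b + c = 1" "a \<le> 1/2" "b \<le> 1/2" "c \<le> 1/2" "x = a *\<^sub>R A + b *\<^sub>R B + c *\<^sub>R C"
    and z: "a' + b' + c' = 1" "a' \<le> 1/2" "b' \<le> 1/2" "c' \<le> 1/2" "z = a' *\<^sub>R A + b' *\<^sub>R B + c' *\<^sub>R C"
  shows "midpoint_concave T x z"
proof -
  define u where "u = (a' - a) *\<^sub>R A + (b' - b) *\<^sub>R B + (c' - c) *\<^sub>R C"
  have \<beta>: "(a' - a) + (b' - b) + (c' - c) = 0" using x(1) z(1) by linarith
  have zu: "z = x + 1 *\<^sub>R u" by (simp add: x z u_def algebra_simps)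
  obtain D where D: "0 \<le> D" "\<And>t y. t \<in> {0..1} \<Longrightarrow> y \<in> T \<Longrightarrow> (norm (x + t *\<^sub>R u - y))^2 \<le> D"
    using dist_T_bounded by blast
  have "(potential K T x + potential K T z) / 2 \<le> potential K T (midpoint x z)"
    if K: "convex_kernel K \<Psi> w D" for K \<Psi> w
  proof -
    define S where "S t = edge_sum K (a' - a) (b' - b) (c' - c) (x + t *\<^sub>R u)" for t
    have convex_comb: "p + t * (p' - p) \<le> 1/2" if "p \<le> 1/2" "p' \<le> 1/2" "t \<in> {0..1}" for p p' t :: real
    proof -
      have "p + t * (p' - p) = (1 - t) * p + t * p'" by (simp add: algebra_simps)
      also have "\<dots> \<le> (1 - t) * (1/2) + t * (1/2)" using that by (intro add_mono mult_left_mono) auto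
      also have "\<dots> = 1/2" by (simp add: field_simps)
      finally show ?thesis .
    qed
    have S_deriv: "\<exists>d\<le>0. (S has_real_derivative d) (at t)" if t: "t \<in> {0..1}" for t
    proof -
      have pt: "x + t *\<^sub>R u = (a + t * (a' - a)) *\<^sub>R A + (b + t * (b' - b)) *\<^sub>R B + (c + t * (c' - c)) *\<^sub>R C"
        by (simp add: x(5) u_def algebra_simps)
      have sum: "(a + t * (a' - a)) + (b + t * (b' - b)) + (c + t * (c' - c)) = 1"
      proof -
        have "(a + t * (a' - a)) + (b + t * (b' - b)) + (c + t * (c' - c)) =
            (a + b + c) + t * ((a' - a) + (b' - b) + (c' - c))" by (simp add: algebra_simps)
        then show ?thesis unfolding x(1) \<beta> by simp
      qed
      have "\<exists>d\<le>0. \<forall>y s. y + s *\<^sub>R u = x + t *\<^sub>R u \<longrightarrow>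
          ((\<lambda>s. edge_sum K (a' - a) (b' - b) (c' - c) (y + s *\<^sub>R u)) has_real_derivative d) (at s)"
        unfolding pt unfolding u_def
        by (rule edge_sum_deriv_nonpos[OF K sum convex_comb[OF x(2) z(2) t] convex_comb[OF x(3) z(3) t]
              convex_comb[OF x(4) z(4) t] \<beta>]) (rule D(2)[OF t, unfolded pt])
      then show ?thesis unfolding S_def[abs_def] by blast
    qed
    have "concave_on {0..1} (\<lambda>t. potential K T (x + t *\<^sub>R u))"
      unfolding concave_on_def
    proof (rule convex_on_realI)
      show "((\<lambda>t. - potential K T (x + t *\<^sub>R u)) has_real_derivative - S t) (at t)" for t
        unfolding S_def u_def by (intro DERIV_minus potential_T_deriv[OF K \<beta>])
      fix s t :: real assume "s \<in> {0..1}" "t \<in> {0..1}" "s \<le> t"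
      have "S t \<le> S s"
      proof (rule DERIV_nonpos_imp_nonincreasing[OF \<open>s \<le> t\<close>])
        fix r assume "s \<le> r" "r \<le> t"
        then have "r \<in> {0..1}" using \<open>s \<in> {0..1}\<close> \<open>t \<in> {0..1}\<close> by simp
        then show "\<exists>y. (S has_real_derivative y) (at r) \<and> y \<le> 0" using S_deriv by blast
      qed
      then show "- S s \<le> - S t" by simp
    qed simp
    from this[unfolded concave_on_iff, THEN conjunct2, rule_format, of 0 1 "1/2" "1/2"]
    have "(potential K T x + potential K T z) / 2 \<le> potential K T (x + (1/2) *\<^sub>R u)"
      by (simp add: zu add_divide_distrib)
    also have "x + (1/2) *\<^sub>R u = midpoint x z"
      by (simp add: zu midpoint_def algebra_simps flip: scaleR_add_left)
    finally show ?thesis .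
  qed
  with D(1) show ?thesis unfolding midpoint_concave_def by blast
qed

text \<open>The set \<open>C\<close> of the criterion is the medial triangle. Outside it, one coordinate exceeds
  \<open>1/2\<close>, and cyclic rotation moves the corresponding vertex to the first place.\<close>

lemma unique_center_triangle:
  assumes acute: "0 \<le> (B - A) \<bullet> (C - A)" "0 \<le> (A - B) \<bullet> (C - B)" "0 \<le> (A - C) \<bullet> (B - C)"
    and \<alpha>: "0 < \<alpha>" "\<alpha> < real DIM(real \<times> 'a) + 2"
  shows "\<exists>!x. is_center \<alpha> T x"
proof -
  interpret solid T \<alpha> by (rule T_solid[OF \<alpha>])
  interpret BCA: oriented_triangle e B C A by (rule rotate)
  interpret CAB: oriented_triangle e C A B by (rule BCA.rotate)
  have T: "BCA.T = T" "CAB.T = T"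
    by (simp_all add: T_def BCA.T_def CAB.T_def insert_commute)
  define M where "M = {a *\<^sub>R A + b *\<^sub>R B + c *\<^sub>R C | a b c.
    a + b + c = 1 \<and> a \<le> 1/2 \<and> b \<le> 1/2 \<and> c \<le> 1/2}"
  show ?thesis
  proof (rule unique_center[of M])
    fix z assume "z \<notin> M"
    obtain a b c where z: "a + b + c = 1" "z = a *\<^sub>R A + b *\<^sub>R B + c *\<^sub>R C"
      by (rule barycentric)
    then consider "1/2 < a" | "1/2 < b" | "1/2 < c"
      using \<open>z \<notin> M\<close> unfolding M_def by fastforce
    then show "dominated T z"
    proof cases
      case 1
      then show ?thesis using dominated_near_A[of a b c z] acute z by simp
    next
      case 2
      then show ?thesis
        using BCA.dominated_near_A[of b c a z] acute z by (simp add: T inner_commute add.commute add.left_commute)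
    next
      case 3
      then show ?thesis
        using CAB.dominated_near_A[of c a b z] acute z by (simp add: T inner_commute add.commute add.left_commute)
    qed
  next
    fix x z assume "x \<in> M" "z \<in> M"
    then show "midpoint_concave T x z"
      unfolding M_def using potential_midpoint_medial by blast
  qed
qed

end

section \<open>Uniqueness of the center\<close>

lemma solid_body:
  fixes \<Omega> :: "'b::euclidean_space set"
  assumes "body \<Omega>" "0 < \<alpha>" "\<alpha> < real DIM('b) + 2"
  shows "solid \<Omega> \<alpha>" and "closed \<Omega>"
proof -
  obtain U where U: "open U" "bounded U" "U \<noteq> {}" "\<Omega> = closure U"
    using \<open>body \<Omega>\<close> by (auto simp: body_def)
  then obtain y r where r: "0 < r" "ball y r \<subseteq> U" by (meson all_not_in_conv openE)
  have \<Omega>: "bounded \<Omega>" "closed \<Omega>" using U by auto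
  then have borel: "\<Omega> \<in> sets borel" by auto
  have "0 < measure lborel (ball y r)" using r by (simp add: content_ball)
  also have "\<dots> \<le> measure lborel \<Omega>"
  proof (rule measure_mono_fmeasurable)
    show "ball y r \<subseteq> \<Omega>" using r U closure_subset by blast
    show "\<Omega> \<in> fmeasurable lborel"
      using \<Omega> borel emeasure_bounded_finite by (auto intro!: fmeasurableI)
  qed simp
  finally show "solid \<Omega> \<alpha>" using \<Omega> borel assms by unfold_locales auto
  show "closed \<Omega>" by fact
qed

lemma inner_nonneg_if_angle_le:
  assumes "angle_at a b c \<le> pi / 2"
  shows "0 \<le> (b - a) \<bullet> (c - a)"
proof (rule ccontr)
  assume neg: "\<not> 0 \<le> (b - a) \<bullet> (c - a)"
  then have "b \<noteq> a" "c \<noteq> a" by auto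
  then have pos: "0 < norm (b - a) * norm (c - a)" by simp
  define q where "q = (b - a) \<bullet> (c - a) / (norm (b - a) * norm (c - a))"
  have q: "q < 0" "-1 \<le> q"
    using neg pos Cauchy_Schwarz_ineq2[of "b - a" "c - a"]
    by (auto simp: q_def divide_neg_pos le_divide_eq)
  have "arccos 0 < arccos q" using q by (intro arccos_less_arccos) auto
  then show False using assms by (simp add: angle_at_def q_def)
qed

lemma unique_center_nonobtuse_triangle:
  fixes \<Omega> :: "(real \<times> 'a::euclidean_space) set"
  assumes dim: "DIM('a) = 1" and \<Omega>: "non_obtuse_triangle \<Omega>"
    and \<alpha>: "0 < \<alpha>" "\<alpha> < real DIM(real \<times> 'a) + 2"
  shows "\<exists>!x. is_center \<alpha> \<Omega> x"
proof -
  obtain e :: 'a where e: "Basis = {e}" using dim card_1_singletonE by blast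
  interpret line_basis e by standard (rule e)
  obtain A B C where ABC: "\<not> collinear {A, B, C}" "\<Omega> = convex hull {A, B, C}"
    and acute: "0 \<le> (B - A) \<bullet> (C - A)" "0 \<le> (C - B) \<bullet> (A - B)" "0 \<le> (A - C) \<bullet> (B - C)"
    using \<Omega> inner_nonneg_if_angle_le unfolding non_obtuse_triangle_def by metis
  have "det2 e (B - A) (C - A) \<noteq> 0" using collinear_if_det2_eq_0 ABC(1) by blast
  then consider "0 < det2 e (B - A) (C - A)" | "0 < det2 e (C - A) (B - A)"
    using det2_swap[of e "C - A" "B - A"] by linarith
  then show ?thesis
  proof cases
    case 1
    then interpret oriented_triangle e A B C by unfold_locales
    show ?thesis
      using unique_center_triangle acute \<alpha> by (simp add: T_def ABC(2) inner_commute)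
  next
    case 2
    then interpret oriented_triangle e A C B by unfold_locales
    show ?thesis
      using unique_center_triangle acute \<alpha> by (simp add: T_def ABC(2) inner_commute insert_commute)
  qed
qed

theorem proposition5p5:
  fixes \<Omega> :: "(real \<times> 'a::euclidean_space) set" and \<alpha> :: real
  assumes "(body \<Omega> \<and>
             (\<exists>\<omega> :: real \<Rightarrow> real.
                (\<forall>t\<in>{0..1}. 0 \<le> \<omega> t) \<and>
                \<omega> piecewise_C1_differentiable_on {0..1} \<and>
                concave_on {0..1} (\<lambda>t. \<omega> t ^ (DIM(real \<times> 'a) - 1)) \<and>
                \<Omega> = profile_solid \<omega>))
           \<or> (DIM(real \<times> 'a) = 2 \<and> non_obtuse_triangle \<Omega>)"
    and "1 < \<alpha>" and "\<alpha> < real DIM(real \<times> 'a) + 2"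
  shows "\<exists>!x. is_center \<alpha> \<Omega> x"
  using assms(1)
proof
  assume "DIM(real \<times> 'a) = 2 \<and> non_obtuse_triangle \<Omega>"
  then show ?thesis
    using unique_center_nonobtuse_triangle[of \<Omega> \<alpha>] assms(2,3) by simp
next
  assume "body \<Omega> \<and>
    (\<exists>\<omega> :: real \<Rightarrow> real.
       (\<forall>t\<in>{0..1}. 0 \<le> \<omega> t) \<and>
       \<omega> piecewise_C1_differentiable_on {0..1} \<and>
       concave_on {0..1} (\<lambda>t. \<omega> t ^ (DIM(real \<times> 'a) - 1)) \<and>
       \<Omega> = profile_solid \<omega>)"
  then obtain \<omega> where body: "body \<Omega>" and \<omega>: "\<And>t. t \<in> {0..1} \<Longrightarrow> 0 \<le> \<omega> t"
    "\<omega> piecewise_C1_differentiable_on {0..1}" "concave_on {0..1} (\<lambda>t. \<omega> t ^ DIM('a))"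
    "\<Omega> = profile_solid \<omega>"
    by auto
  interpret solid \<Omega> \<alpha> using body assms(2,3) by (intro solid_body) auto
  have cont: "continuous_on {0..1} \<omega>" using \<omega>(2) by (simp add: piecewise_C1_differentiable_on_def)
  obtain p where p: "p \<in> {0..1}" "\<And>t. t \<in> {0..1} \<Longrightarrow> \<omega> t \<le> \<omega> p"
    using continuous_attains_sup[OF _ _ cont] by auto
  have "concave_profile \<omega> p \<Omega>"
    by unfold_locales (use \<omega> cont p bounded solid_body(2)[OF body, of \<alpha>] assms(2,3) in auto)
  then show ?thesis
    by (rule concave_profile.unique_center_profile) (rule solid_axioms)
qed

end
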